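(* Let $k$ be even and $\ell=k/2$. (1) The components of $\mathbf{DCM}_k$ of smallest order have exactly $2$ vertices, and there are exactly $\ell\cdot 2^{\ell-1}$ of them. (2) For $k\ge 4$, the components of $\mathbf{DCM}_k$ of second smallest order have exactly $6\ell-6$ vertices, and for $k\ge 6$ there are exactly $\ell\cdot 2^{\ell-2}$ of them.
   Context: Let $k\ge 1$ and let $X_{2k}=\{P_1,\dots,P_{2k}\}$ be $2k$ points in convex position in the plane, labeled in clockwise cyclic order; indices are taken modulo $2k$. A matching of $X_{2k}$ means a set of $k$ pairwise non-crossing straight segments (edges) with endpoints in $X_{2k}$ covering every point exactly once; its size is $k$. Two matchings $M,M'$ of $X_{2k}$ are disjoint compatible if they have no common edge and no edge of $M$ crosses an edge of $M'$. $\mathbf{DCM}_k$ is the graph whose vertices are the matchings of $X_{2k}$, two being adjacent iff they are disjoint compatible. The order of a component is its number of vertices. *)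

theory Defs
  imports Main
begin

text \<open>Points of X_{2k} are labelled 0,...,2k-1 in clockwise cyclic order (P_{i+1} is label i).
  An edge is a two-element set of labels. For points in convex position, two segments
  with four distinct endpoints cross iff their endpoints interleave in the cyclic order;
  segments sharing an endpoint do not cross.\<close>

definition interleave :: "nat set \<Rightarrow> nat set \<Rightarrow> bool" where
  "interleave e f \<longleftrightarrow> (\<exists>a b c d. e = {a, b} \<and> f = {c, d} \<and> a < c \<and> c < b \<and> b < d)"

definition crosses :: "nat set \<Rightarrow> nat set \<Rightarrow> bool" where
  "crosses e f \<longleftrightarrow> interleave e f \<or> interleave f e"

definition is_edge :: "nat \<Rightarrow> nat set \<Rightarrow> bool" where
  "is_edge k e \<longleftrightarrow> (\<exists>a b. a \<noteq> b \<and> a < 2 * k \<and> b < 2 * k \<and> e = {a, b})"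

definition is_matching :: "nat \<Rightarrow> nat set set \<Rightarrow> bool" where
  "is_matching k M \<longleftrightarrow>
     (\<forall>e\<in>M. is_edge k e) \<and>
     (\<forall>p<2 * k. \<exists>!e. e \<in> M \<and> p \<in> e) \<and>
     (\<forall>e\<in>M. \<forall>f\<in>M. \<not> crosses e f)"

definition matchings :: "nat \<Rightarrow> nat set set set" where
  "matchings k = {M. is_matching k M}"

definition disjoint_compatible :: "nat set set \<Rightarrow> nat set set \<Rightarrow> bool" where
  "disjoint_compatible M M' \<longleftrightarrow> M \<inter> M' = {} \<and> (\<forall>e\<in>M. \<forall>f\<in>M'. \<not> crosses e f)"

definition dcm_adj :: "nat \<Rightarrow> nat set set \<Rightarrow> nat set set \<Rightarrow> bool" where
  "dcm_adj k M M' \<longleftrightarrow> M \<in> matchings k \<and> M' \<in> matchings k \<and> disjoint_compatible M M'"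

definition dcm_component :: "nat \<Rightarrow> nat set set \<Rightarrow> nat set set set" where
  "dcm_component k M = {M'. (dcm_adj k)\<^sup>*\<^sup>* M M'}"

definition dcm_components :: "nat \<Rightarrow> nat set set set set" where
  "dcm_components k = dcm_component k ` matchings k"

end

theory Submission
  imports Defs
begin

text \<open>Every matching of a convex \<open>4l\<close>-gon is, up to rotation, a concatenation \<open>y \<frown> t\<close> where \<open>t\<close> is
  one of the two matchings \<open>cA\<close>, \<open>cB\<close> of a quadrangle. The neighbours of \<open>x \<frown> cB\<close> are exactly the
  \<open>y \<frown> cA\<close> with \<open>y\<close> a neighbour of \<open>x\<close>, so attaching \<open>cB\<close> preserves degrees. Starting from a
  quadrangle and attaching copies of \<open>cB\<close>, with a rotation by 1 or 3 in between, one
  obtains matchings of degree 1; these form the components of order 2. As soon as another rotation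
  occurs, the component contains a ring of four boundary edges on an octagon.

  Starting instead from such a ring, whose component has order 6, the same construction
  yields components of order \<open>6l - 6\<close>, which are determined explicitly. Any other
  component contains a 12-gon ring or a concatenation of two parts with an octagon each; since the parts
  can be moved independently up to parity, its order is in the second case at least three times
  that of either part, and such components are larger.

  The components are counted through their representatives: the last attached \<open>cB\<close> is the only
  nested pair of edges on four consecutive points, so the rotation and the word of shifts can be
  recovered, and each component contains exactly two representatives.\<close>

text \<open>Appending after a rotation is insertion into a gap: \<open>rot p x \<frown> t\<close>
  places \<open>t\<close> into the gap \<open>p\<close> points before the end of \<open>x\<close>.
  The shifts 1 and 3 are the two gaps between the inner and the outer edge of the last
  \<open>cB\<close>. The obstacle is that a component is given only through walks. For order
  \<open>6 * l - 6\<close>, explicit vertex lists are shown to be closed under moves by comparing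
  the number of known neighbours with the degree. Degrees follow two recursions: attaching
  \<open>cB\<close> changes nothing, while attaching \<open>cA\<close> beside a spanning edge
  (\<open>cap\<close>) allows, besides the flip of the quadrangle, only the flip of one hexagon.
  Each attachment of \<open>cB\<close> then adds as many vertices as the octagon component has,
  namely 6. For components with two octagon parts, the factor 3 is the number of octagon vertices of
  one parity. It suffices except on 16 points, where 18 = 6 * 4 - 6 is a tie; there a matching with
  an edge between the two parts decides.\<close>

datatype conf = Conf (sz: nat) (edges: "nat set set")

section \<open>Configurations, concatenation and rotation\<close>

definition img :: "(nat \<Rightarrow> nat) \<Rightarrow> nat set set \<Rightarrow> nat set set" where
  "img f M = (\<lambda>e. f ` e) ` M"

lemma img_img: "img f (img g M) = img (\<lambda>i. f (g i)) M"
  by (simp add: img_def image_image)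

lemma img_Un: "img f (M \<union> N) = img f M \<union> img f N"
  by (simp add: img_def image_Un)

lemma img_cong: "(\<And>e i. e \<in> M \<Longrightarrow> i \<in> e \<Longrightarrow> f i = g i) \<Longrightarrow> img f M = img g M"
  unfolding img_def by (intro image_cong) auto

lemma img_ident: "(\<And>e i. e \<in> M \<Longrightarrow> i \<in> e \<Longrightarrow> f i = i) \<Longrightarrow> img f M = M"
  using img_cong[of M f "\<lambda>i. i"] by (simp add: img_def)

lemma in_imgI: "{a, b} \<in> M \<Longrightarrow> {f a, f b} \<in> img f M"
  unfolding img_def by (metis image_empty image_insert rev_image_eqI)

lemma conf_eqI: "sz x = sz y \<Longrightarrow> edges x = edges y \<Longrightarrow> x = y"
  by (cases x; cases y) simp

definition cat :: "conf \<Rightarrow> conf \<Rightarrow> conf" (infixl "\<frown>" 70) where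
  "x \<frown> y = Conf (sz x + sz y) (edges x \<union> img (\<lambda>i. sz x + i) (edges y))"

definition rot :: "nat \<Rightarrow> conf \<Rightarrow> conf" where
  "rot p x = Conf (sz x) (img (\<lambda>i. (i + p) mod sz x) (edges x))"

lemma sz_cat [simp]: "sz (x \<frown> y) = sz x + sz y" by (simp add: cat_def)
lemma sz_rot [simp]: "sz (rot p x) = sz x" by (simp add: rot_def)

definition bd :: "conf \<Rightarrow> bool" where
  "bd x \<longleftrightarrow> (\<forall>e\<in>edges x. \<forall>i\<in>e. i < sz x)"

lemma bd_cat [simp]: "bd x \<Longrightarrow> bd y \<Longrightarrow> bd (x \<frown> y)"
  by (fastforce simp: bd_def cat_def img_def)

lemma bd_rot [simp]: "bd x \<Longrightarrow> bd (rot p x)"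
  by (fastforce simp: bd_def rot_def img_def)

lemma cat_assoc: "(x \<frown> y) \<frown> z = x \<frown> (y \<frown> z)"
  by (simp add: cat_def img_img img_Un Un_assoc add.assoc)

lemma rot_rot: "rot p (rot q x) = rot (q + p) x"
  by (simp add: rot_def img_img mod_add_left_eq add.assoc)

lemma rot_mod: "rot (p mod sz x) x = rot p x"
  by (simp add: rot_def mod_add_right_eq)

lemma rot_0 [simp]: "bd x \<Longrightarrow> rot 0 x = x"
  by (rule conf_eqI) (auto simp: rot_def bd_def intro!: img_ident)

lemma rot_sz: "bd x \<Longrightarrow> rot (sz x) x = x"
  using rot_mod[of "sz x" x] by simp

lemma rot_cong: "bd x \<Longrightarrow> sz x = n \<Longrightarrow> p mod n = q mod n \<Longrightarrow> rot p x = rot q x"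
  by (metis rot_mod)

lemma rot_inverse: "bd x \<Longrightarrow> p \<le> sz x \<Longrightarrow> rot (sz x - p) (rot p x) = x"
  by (simp add: rot_rot rot_sz)

lemma mod2: "m < n + n \<Longrightarrow> m mod n = (if m < n then m else m - n)" for m n :: nat
  by (simp add: le_mod_geq)

lemma cat_swap:
  assumes "bd x" "bd y"
  shows "y \<frown> x = rot (sz y) (x \<frown> y)"
proof (rule conf_eqI)
  let ?a = "sz x" and ?b = "sz y"
  have 1: "img (\<lambda>i. (i + ?b) mod (?a + ?b)) (edges x) = img (\<lambda>i. ?b + i) (edges x)"
    using assms(1) by (intro img_cong) (auto simp: bd_def)
  have 2: "img (\<lambda>i. (?a + i + ?b) mod (?a + ?b)) (edges y) = edges y"
  proof (intro img_ident)
    fix e i assume "e \<in> edges y" "i \<in> e"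
    then have "i < ?b" using assms(2) by (auto simp: bd_def)
    moreover have "?a + i + ?b = i + (?a + ?b)" by simp
    ultimately show "(?a + i + ?b) mod (?a + ?b) = i" by (metis mod_add_self2 mod_less trans_less_add2)
  qed
  show "edges (y \<frown> x) = edges (rot (sz y) (x \<frown> y))"
    by (auto simp: cat_def rot_def img_Un img_img 1 2)
qed simp

text \<open>For \<open>c \<le> sz y\<close> the gap that receives \<open>z\<close> lies in
  \<open>y\<close>, so the insertion can be carried out in \<open>y\<close> alone. The inner
  rotation by \<open>sz y + sz z - c\<close> undoes \<open>rot c\<close> after \<open>z\<close> has
  been appended.\<close>

lemma cat_rot_cat:
  assumes "bd x" "bd y" "bd z" "c \<le> sz y"
  shows "rot c (x \<frown> y) \<frown> z = rot c (x \<frown> rot (sz y + sz z - c) (rot c y \<frown> z))"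
proof (rule conf_eqI)
  let ?a = "sz x" and ?b = "sz y" and ?d = "sz z"
  have x1: "img (\<lambda>i. (i + c) mod (?a + ?b)) (edges x) = img (\<lambda>i. (i + c) mod (?a + (?b + ?d))) (edges x)"
  proof (intro img_cong)
    fix e i assume "e \<in> edges x" "i \<in> e"
    then have "i < ?a" using assms(1) by (auto simp: bd_def)
    then show "(i + c) mod (?a + ?b) = (i + c) mod (?a + (?b + ?d))" using assms(4) by simp
  qed
  have y1: "img (\<lambda>i. (?a + i + c) mod (?a + ?b)) (edges y) =
    img (\<lambda>i. (?a + ((i + c) mod ?b + (?b + ?d - c)) mod (?b + ?d) + c) mod (?a + (?b + ?d))) (edges y)"
  proof (intro img_cong)
    fix e i assume "e \<in> edges y" "i \<in> e"
    then have i: "i < ?b" using assms by (auto simp: bd_def)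
    show "(?a + i + c) mod (?a + ?b) =
      (?a + ((i + c) mod ?b + (?b + ?d - c)) mod (?b + ?d) + c) mod (?a + (?b + ?d))"
    proof (cases "i + c < ?b")
      case True
      have "(i + c) mod ?b + (?b + ?d - c) = i + (?b + ?d)" using True assms(4) by simp
      then show ?thesis using True i by simp
    next
      case False
      have "(i + c) mod ?b + (?b + ?d - c) = i + ?d" using False assms(4) i by (simp add: mod2)
      then have "(?a + ((i + c) mod ?b + (?b + ?d - c)) mod (?b + ?d) + c) mod (?a + (?b + ?d))
        = i + c - ?b" using False i assms(4) by (simp add: mod2)
      moreover have "(?a + i + c) mod (?a + ?b) = i + c - ?b" using False i assms(4) by (simp add: mod2)
      ultimately show ?thesis by simp
    qed
  qed
  have z1: "img (\<lambda>i. ?a + ?b + i) (edges z) =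
    img (\<lambda>i. (?a + (?b + i + (?b + ?d - c)) mod (?b + ?d) + c) mod (?a + (?b + ?d))) (edges z)"
  proof (intro img_cong)
    fix e i assume "e \<in> edges z" "i \<in> e"
    then have i: "i < ?d" using assms by (auto simp: bd_def)
    have "(?b + i + (?b + ?d - c)) = (?b + i - c) + (?b + ?d)" using assms(4) by simp
    then have "(?b + i + (?b + ?d - c)) mod (?b + ?d) = ?b + i - c"
      using i by (metis mod_add_self2 mod_less nat_add_left_cancel_less less_imp_diff_less)
    then show "?a + ?b + i = (?a + (?b + i + (?b + ?d - c)) mod (?b + ?d) + c) mod (?a + (?b + ?d))"
      using i assms(4) by simp
  qed
  show "edges (rot c (x \<frown> y) \<frown> z) = edges (rot c (x \<frown> rot (sz y + sz z - c) (rot c y \<frown> z)))"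
    by (simp add: cat_def rot_def img_Un img_img x1 y1 z1 Un_assoc)
qed simp

text \<open>The companion of \<open>cat_rot_cat\<close> for a gap in the left factor; exchanging the
  factors by \<open>cat_swap\<close> reduces it to that law.\<close>

lemma cat_rot_cat2:
  assumes "bd x" "bd y" "bd z" "j \<le> sz x"
  shows "rot (sz y + j) (x \<frown> y) \<frown> z = rot (sz y + j) (rot (sz x + sz z - j) (rot j x \<frown> z) \<frown> y)"
proof -
  have "rot (sz y + j) (x \<frown> y) = rot j (y \<frown> x)"
    using assms by (simp add: cat_swap[of x y] rot_rot)
  then show ?thesis
    using assms cat_rot_cat[of y x z j]
    by (simp add: cat_swap[of "rot (sz x + sz z - j) (rot j x \<frown> z)" y] rot_rot)
qed

text \<open>Lets an induction peel \<open>t\<close> off the right factor of a concatenation;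
  \<open>rot (sz w - r) w\<close> is what remains of \<open>y\<close> once \<open>t\<close> is
  removed.\<close>

lemma rot_cat_rot:
  assumes "bd x" "bd y" "bd w" "bd t" "w \<frown> t = rot r y" "r \<le> sz w"
  shows "rot r (x \<frown> y) = rot r (x \<frown> rot (sz w - r) w) \<frown> t"
proof -
  have sy: "sz y = sz w + sz t" using assms(5) by (metis sz_cat sz_rot)
  have y: "y = rot (sz y - r) (w \<frown> t)"
    using rot_inverse[OF assms(2), of r] assms(5,6) sy by simp
  have "rot r (rot (sz w - r) w) = w"
    using assms by (simp add: rot_rot rot_sz)
  then have "rot r (x \<frown> rot (sz w - r) w) \<frown> t
      = rot r (x \<frown> rot (sz w + sz t - r) (w \<frown> t))"
    using assms cat_rot_cat[of x "rot (sz w - r) w" t r] by simp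
  then show ?thesis using y sy by simp
qed

section \<open>Matchings\<close>

lemma crosses_iff:
  "crosses {a, b} {c, d} \<longleftrightarrow>
    (min a b < min c d \<and> min c d < max a b \<and> max a b < max c d) \<or>
    (min c d < min a b \<and> min a b < max c d \<and> max c d < max a b)"
proof -
  have il: "interleave {a, b} {c, d} \<longleftrightarrow> min a b < min c d \<and> min c d < max a b \<and> max a b < max c d"
    for a b c d :: nat
  proof
    assume "interleave {a, b} {c, d}"
    then show "min a b < min c d \<and> min c d < max a b \<and> max a b < max c d"
      unfolding interleave_def doubleton_eq_iff by auto
  next
    assume *: "min a b < min c d \<and> min c d < max a b \<and> max a b < max c d"
    have "{a, b} = {min a b, max a b}" "{c, d} = {min c d, max c d}"
      by (auto simp: min_def max_def)
    then show "interleave {a, b} {c, d}"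
      unfolding interleave_def using * by blast
  qed
  show ?thesis unfolding crosses_def il by blast
qed

lemma crosses_sym: "crosses e f \<longleftrightarrow> crosses f e"
  by (auto simp: crosses_def)

text \<open>This is \<open>is_matching\<close> with the number of points as parameter, so that parts
  of a matching can be treated without halving sizes.\<close>

definition mat :: "nat \<Rightarrow> nat set set \<Rightarrow> bool" where
  "mat n M \<longleftrightarrow>
     (\<forall>e\<in>M. \<exists>a b. a \<noteq> b \<and> a < n \<and> b < n \<and> e = {a, b}) \<and>
     (\<forall>p<n. \<exists>!e. e \<in> M \<and> p \<in> e) \<and>
     (\<forall>e\<in>M. \<forall>f\<in>M. \<not> crosses e f)"

fun ok :: "conf \<Rightarrow> bool" where "ok (Conf n M) = mat n M"

definition compat :: "nat set set \<Rightarrow> nat set set \<Rightarrow> bool" where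
  "compat M N \<longleftrightarrow> (\<forall>e\<in>M. \<forall>f\<in>N. \<not> crosses e f)"

definition adj :: "conf \<Rightarrow> conf \<Rightarrow> bool" where
  "adj x y \<longleftrightarrow> sz x = sz y \<and> ok x \<and> ok y \<and> edges x \<inter> edges y = {} \<and> compat (edges x) (edges y)"

lemma ok_def': "ok x \<longleftrightarrow> mat (sz x) (edges x)" by (cases x) simp

lemma adj_ok: "adj x y \<Longrightarrow> ok x" "adj x y \<Longrightarrow> ok y" and adj_sz: "adj x y \<Longrightarrow> sz y = sz x"
  by (auto simp: adj_def)

lemma adj_sym: "adj x y \<Longrightarrow> adj y x"
  unfolding adj_def compat_def by (metis Int_commute crosses_sym)

lemma ok_bd [simp]: "ok x \<Longrightarrow> bd x"
  by (fastforce simp: ok_def' mat_def bd_def)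

lemma mat_edge: "mat n M \<Longrightarrow> e \<in> M \<Longrightarrow> \<exists>a b. a \<noteq> b \<and> a < n \<and> b < n \<and> e = {a, b}"
  by (simp add: mat_def)

lemma mat_partner: "mat n M \<Longrightarrow> p < n \<Longrightarrow> \<exists>q. q < n \<and> q \<noteq> p \<and> {p, q} \<in> M"
proof -
  assume m: "mat n M" and "p < n"
  then obtain e where e: "e \<in> M" "p \<in> e" unfolding mat_def by blast
  with mat_edge[OF m e(1)] show ?thesis by (auto simp: insert_commute)
qed

lemma mat_unique: "mat n M \<Longrightarrow> e \<in> M \<Longrightarrow> f \<in> M \<Longrightarrow> p \<in> e \<Longrightarrow> p \<in> f \<Longrightarrow> e = f"
proof -
  assume m: "mat n M" and e: "e \<in> M" "f \<in> M" "p \<in> e" "p \<in> f"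
  have "p < n" using mat_edge[OF m e(1)] e by auto
  then show ?thesis using m e unfolding mat_def by blast
qed

lemma mat_unique2: "mat n M \<Longrightarrow> {p, q} \<in> M \<Longrightarrow> {p, r} \<in> M \<Longrightarrow> q = r"
  using mat_unique[of n M "{p,q}" "{p,r}" p] by (auto simp: doubleton_eq_iff)

lemma mat_ex: "mat n M \<Longrightarrow> p < n \<Longrightarrow> \<exists>e. e \<in> M \<and> p \<in> e \<and> (\<forall>f. f \<in> M \<longrightarrow> p \<in> f \<longrightarrow> f = e)"
  by (metis mat_def)

lemma mat_nocross: "mat n M \<Longrightarrow> e \<in> M \<Longrightarrow> f \<in> M \<Longrightarrow> \<not> crosses e f"
  by (simp add: mat_def)

lemma crosses_shift:
  assumes "mat n M" "mat m N" "e \<in> M" "f \<in> N"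
  shows "crosses ((\<lambda>i. k + i) ` e) ((\<lambda>i. k + i) ` f) \<longleftrightarrow> crosses e f"
proof -
  obtain a b where e: "e = {a, b}" using mat_edge[OF assms(1,3)] by blast
  obtain c d where f: "f = {c, d}" using mat_edge[OF assms(2,4)] by blast
  show ?thesis by (simp add: e f crosses_iff flip: max_add_distrib_right min_add_distrib_right)
qed

lemma no_cross_shift:
  assumes "mat n M" "mat m N" "e \<in> M" "f \<in> N"
  shows "\<not> crosses e ((\<lambda>i. n + i) ` f)"
proof -
  obtain a b where e: "e = {a, b}" "a < n" "b < n" using mat_edge[OF assms(1,3)] by blast
  obtain c d where f: "f = {c, d}" using mat_edge[OF assms(2,4)] by blast
  show ?thesis using e by (auto simp: f crosses_iff min_def max_def)
qed

text \<open>The two blocks occupy disjoint intervals of labels, so only edges of the same block can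
  cross.\<close>

lemma compat_cat:
  assumes "mat n M" "mat m N" "mat n M'" "mat m N'"
  shows "compat (M \<union> img (\<lambda>i. n + i) N) (M' \<union> img (\<lambda>i. n + i) N') \<longleftrightarrow> compat M M' \<and> compat N N'"
proof -
  have 1: "crosses ((\<lambda>i. n + i) ` e) ((\<lambda>i. n + i) ` f) \<longleftrightarrow> crosses e f" if "e \<in> N" "f \<in> N'" for e f
    using crosses_shift[OF assms(2,4) that] .
  have 2: "\<not> crosses e ((\<lambda>i. n + i) ` f)" if "e \<in> M" "f \<in> N'" for e f
    using no_cross_shift[OF assms(1,4) that] .
  have 3: "\<not> crosses ((\<lambda>i. n + i) ` f) e" if "e \<in> M'" "f \<in> N" for e f
    using no_cross_shift[OF assms(3,2) that] by (subst crosses_sym)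
  show ?thesis unfolding compat_def img_def using 1 2 3 by (simp add: ball_Un)
qed

lemma mat_compat: "mat n M \<Longrightarrow> compat M M"
  by (simp add: mat_def compat_def)

lemma inj_img_shift: "(\<lambda>i. n + i) ` e = (\<lambda>i. n + i) ` f \<longleftrightarrow> e = f" for n :: nat
  by (simp add: inj_image_eq_iff)

lemma mat_cat:
  assumes "mat n M" "mat m N"
  shows "mat (n + m) (M \<union> img (\<lambda>i. n + i) N)"
proof -
  have 1: "\<exists>a b. a \<noteq> b \<and> a < n + m \<and> b < n + m \<and> e = {a, b}" if "e \<in> M" for e
    using mat_edge[OF assms(1) that] by (metis trans_less_add1)
  have 2: "\<exists>a b. a \<noteq> b \<and> a < n + m \<and> b < n + m \<and> (\<lambda>i. n + i) ` e = {a, b}" if e: "e \<in> N" for e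
  proof -
    obtain a b where "a \<noteq> b" "a < m" "b < m" "e = {a, b}" using mat_edge[OF assms(2) e] by blast
    then show ?thesis by (intro exI[of _ "n+a"] exI[of _ "n+b"]) auto
  qed
  have M: "e \<in> M \<Longrightarrow> p \<in> e \<Longrightarrow> p < n" for e p using mat_edge[OF assms(1)] by fastforce
  have 3: "\<exists>!e. e \<in> M \<union> img (\<lambda>i. n + i) N \<and> p \<in> e" if p: "p < n + m" for p
  proof (cases "p < n")
    case True
    then obtain e where "e \<in> M" "p \<in> e" "\<And>f. f \<in> M \<Longrightarrow> p \<in> f \<Longrightarrow> f = e"
      using mat_ex[OF assms(1)] by blast
    note e = this
    have "p \<notin> f" if "f \<in> img (\<lambda>i. n + i) N" for f
      using that True by (auto simp: img_def)
    then show ?thesis using e by (intro ex1I[of _ e]) blast+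
  next
    case False
    then have "p - n < m" using p by simp
    then obtain e where "e \<in> N" "p - n \<in> e" "\<And>f. f \<in> N \<Longrightarrow> p - n \<in> f \<Longrightarrow> f = e"
      using mat_ex[OF assms(2)] by blast
    note e = this
    show ?thesis
    proof (rule ex1I)
      have "p \<in> (\<lambda>i. n + i) ` e" using e(2) False by (intro image_eqI[of _ _ "p - n"]) auto
      then show "(\<lambda>i. n + i) ` e \<in> M \<union> img (\<lambda>i. n + i) N \<and> p \<in> (\<lambda>i. n + i) ` e"
        using e(1) by (simp add: img_def)
    next
      fix g assume g: "g \<in> M \<union> img (\<lambda>i. n + i) N \<and> p \<in> g"
      then obtain f where f: "f \<in> N" "g = (\<lambda>i. n + i) ` f" using M False by (auto simp: img_def)
      then have "p - n \<in> f" using g by auto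
      then show "g = (\<lambda>i. n + i) ` e" using e(3) f by simp
    qed
  qed
  have "compat (M \<union> img (\<lambda>i. n + i) N) (M \<union> img (\<lambda>i. n + i) N)"
    using compat_cat[OF assms assms] mat_compat assms by blast
  then show ?thesis
    unfolding mat_def using 1 2 3 unfolding compat_def img_def by blast
qed

lemma ok_cat [simp]: "ok x \<Longrightarrow> ok y \<Longrightarrow> ok (x \<frown> y)"
  by (simp add: ok_def' cat_def mat_cat)

lemma adj_cat_iff:
  assumes "ok x" "ok x'" "ok y" "ok y'" "sz x = sz x'" "sz y = sz y'"
  shows "adj (x \<frown> y) (x' \<frown> y') \<longleftrightarrow> adj x x' \<and> adj y y'"
proof -
  let ?n = "sz x"
  have c: "compat (edges (x \<frown> y)) (edges (x' \<frown> y')) \<longleftrightarrow> compat (edges x) (edges x') \<and> compat (edges y) (edges y')"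
    using compat_cat[of ?n "edges x" "sz y" "edges y" "edges x'" "edges y'"] assms
    by (simp add: cat_def ok_def')
  have sep: "e \<in> edges z \<Longrightarrow> f \<in> edges w \<Longrightarrow> ok z \<Longrightarrow> ok w \<Longrightarrow> e \<noteq> (\<lambda>i. sz z + i) ` f" for e f z w
    using mat_edge[of "sz z" "edges z" e] mat_edge[of "sz w" "edges w" f]
    by (auto simp: ok_def')
  have "edges (x \<frown> y) \<inter> edges (x' \<frown> y') = {} \<longleftrightarrow> edges x \<inter> edges x' = {} \<and> edges y \<inter> edges y' = {}"
    using sep[of _ x _ y'] sep[of _ x' _ y] assms
    by (auto simp: cat_def img_def inj_img_shift)
  then show ?thesis using c assms by (auto simp: adj_def)
qed

lemma adj_cat: "adj x x' \<Longrightarrow> adj y y' \<Longrightarrow> adj (x \<frown> y) (x' \<frown> y')"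
  using adj_cat_iff[of x x' y y'] by (simp add: adj_def)

text \<open>Only the unit rotation is checked, where a single label wraps around; other rotations
  are iterations of \<open>rot 1\<close>.\<close>

lemma crosses_rot1:
  assumes "a < n" "b < n" "c < n" "d < n"
  shows "crosses {Suc a mod n, Suc b mod n} {Suc c mod n, Suc d mod n} \<longleftrightarrow> crosses {a, b} {c, d}"
proof -
  have m: "Suc i mod n = (if Suc i = n then 0 else Suc i)" if "i < n" for i
    using that by (simp add: mod_Suc)
  show ?thesis
    unfolding crosses_iff m[OF assms(1)] m[OF assms(2)] m[OF assms(3)] m[OF assms(4)]
    using assms by (auto simp: min_def max_def split: if_splits)
qed

lemma inj_on_rot: "inj_on (\<lambda>i. (i + p) mod n) {..<n}" for n :: nat
proof (rule inj_on_inverseI)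
  fix i assume i: "i \<in> {..<n}"
  \<comment> \<open>The number \<open>n * p - p\<close> represents \<open>- p\<close> modulo
    \<open>n\<close> without any bound on \<open>p\<close>.\<close>
  then have "p \<le> n * p" by (cases n) auto
  then have "i + p + (n * p - p) = i + n * p" by simp
  then show "((i + p) mod n + (n * p - p)) mod n = i"
    using i by (metis mod_add_left_eq mod_mult_self2 mod_less lessThan_iff)
qed

lemma bij_rot: "(\<lambda>i. (i + p) mod n) ` {..<n} = {..<n}" for n :: nat
  using inj_on_rot[of p n] by (intro endo_inj_surj) auto

lemma mat_rot1:
  assumes "mat n M" shows "mat n (img (\<lambda>i. (i + 1) mod n) M)"
proof -
  let ?f = "\<lambda>i. (i + 1) mod n"
  have inj: "inj_on ?f {..<n}" by (rule inj_on_rot)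
  have sub: "e \<subseteq> {..<n}" if "e \<in> M" for e using mat_edge[OF assms that] by auto
  have 1: "\<exists>a b. a \<noteq> b \<and> a < n \<and> b < n \<and> e' = {a, b}" if e': "e' \<in> img ?f M" for e'
  proof -
    obtain e where e: "e \<in> M" "e' = ?f ` e" using e' by (auto simp: img_def)
    obtain a b where ab: "a \<noteq> b" "a < n" "b < n" "e = {a, b}" using mat_edge[OF assms e(1)] by blast
    have "?f a \<noteq> ?f b" using ab inj_onD[OF inj, of a b] by blast
    moreover have "?f a < n" "?f b < n" using ab by simp_all
    moreover have "e' = {?f a, ?f b}" using e ab by simp
    ultimately show ?thesis by blast
  qed
  have 2: "\<exists>!e. e \<in> img ?f M \<and> p \<in> e" if p: "p < n" for p
  proof -
    obtain q where q: "q < n" "p = ?f q"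
    proof -
      have "p \<in> ?f ` {..<n}" using p by (simp only: bij_rot lessThan_iff)
      then show ?thesis using that by blast
    qed
    obtain e where e: "e \<in> M" "q \<in> e" "\<And>f. f \<in> M \<Longrightarrow> q \<in> f \<Longrightarrow> f = e"
      using mat_ex[OF assms q(1)] by blast
    show ?thesis
    proof (rule ex1I)
      show "?f ` e \<in> img ?f M \<and> p \<in> ?f ` e" unfolding img_def using e(1,2) q(2) by blast
      fix g assume "g \<in> img ?f M \<and> p \<in> g"
      then obtain f r where f: "f \<in> M" "g = ?f ` f" "r \<in> f" "p = ?f r" unfolding img_def by blast
      then have "r = q" using inj_onD[OF inj, of r q] q sub[OF f(1)] by auto
      then show "g = ?f ` e" using e f by blast
    qed
  qed
  have 3: "\<not> crosses e' f'" if ef: "e' \<in> img ?f M" "f' \<in> img ?f M" for e' f'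
  proof -
    obtain e f where *: "e \<in> M" "e' = ?f ` e" "f \<in> M" "f' = ?f ` f" using ef by (auto simp: img_def)
    obtain a b where ab: "a < n" "b < n" "e = {a, b}" using mat_edge[OF assms *(1)] by blast
    obtain c d where cd: "c < n" "d < n" "f = {c, d}" using mat_edge[OF assms *(3)] by blast
    show ?thesis using crosses_rot1[of a n b c d] ab cd * mat_nocross[OF assms *(1,3)] by simp
  qed
  show ?thesis unfolding mat_def using 1 2 3 by blast
qed

lemma adj_rot1:
  assumes "adj x y" shows "adj (rot 1 x) (rot 1 y)"
proof -
  let ?n = "sz x" let ?f = "\<lambda>i. (i + 1) mod ?n"
  have s: "sz y = ?n" using assms by (simp add: adj_def)
  have mx: "mat ?n (edges x)" and my: "mat ?n (edges y)"
    using assms by (auto simp: adj_def ok_def')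
  have inj: "inj_on ?f {..<?n}" by (rule inj_on_rot)
  have "?f ` e \<noteq> ?f ` f" if "e \<in> edges x" "f \<in> edges y" for e f
  proof
    assume "?f ` e = ?f ` f"
    moreover have "e \<subseteq> {..<?n}" "f \<subseteq> {..<?n}"
      using mat_edge[OF mx that(1)] mat_edge[OF my that(2)] by auto
    ultimately have "e = f" using inj by (simp add: inj_on_image_eq_iff)
    then show False using that assms by (auto simp: adj_def)
  qed
  then have 1: "edges (rot 1 x) \<inter> edges (rot 1 y) = {}"
    by (auto simp: rot_def img_def s)
  have "\<not> crosses (?f ` e) (?f ` f)" if ef: "e \<in> edges x" "f \<in> edges y" for e f
  proof -
    obtain a b where ab: "a < ?n" "b < ?n" "e = {a, b}" using mat_edge[OF mx ef(1)] by blast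
    obtain c d where cd: "c < ?n" "d < ?n" "f = {c, d}" using mat_edge[OF my ef(2)] by blast
    show ?thesis using crosses_rot1[of a ?n b c d] ab cd assms ef
      by (simp add: adj_def compat_def)
  qed
  then have 2: "compat (edges (rot 1 x)) (edges (rot 1 y))"
    by (auto simp: rot_def img_def s compat_def)
  show ?thesis using 1 2 mat_rot1[OF mx] mat_rot1[OF my] s by (simp add: adj_def ok_def' rot_def)
qed

lemma rot_Suc: "rot (Suc p) x = rot 1 (rot p x)"
  by (simp add: rot_rot)

lemma ok_rot1: "ok x \<Longrightarrow> ok (rot 1 x)"
  using mat_rot1[of "sz x" "edges x"] by (simp add: ok_def' rot_def)

lemma ok_rot [simp]: "ok x \<Longrightarrow> ok (rot p x)"
proof (induction p)
  case (Suc p) then show ?case by (simp add: rot_Suc ok_rot1 del: One_nat_def)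
qed simp

lemma adj_rot: "adj x y \<Longrightarrow> adj (rot p x) (rot p y)"
proof (induction p)
  case 0
  then show ?case using adj_ok[of x y] by simp
next
  case (Suc p)
  then show ?case unfolding rot_Suc[of p x] rot_Suc[of p y] by (intro adj_rot1) simp
qed

text \<open>One \<open>q\<close> serves all configurations of size \<open>n\<close>, for arbitrary
  \<open>p\<close>; this allows rotations to be cancelled throughout a set or a walk.\<close>

lemma rot_back: "\<exists>q. \<forall>x. bd x \<longrightarrow> sz x = n \<longrightarrow> rot q (rot p x) = x \<and> rot p (rot q x) = x"
proof (cases "n = 0")
  case True
  have "rot q x = x" if "bd x" "sz x = 0" for q x
  proof (rule conf_eqI)
    show "edges (rot q x) = edges x"
      unfolding rot_def conf.sel by (rule img_ident) (use that in \<open>auto simp: bd_def\<close>)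
  qed simp
  then show ?thesis using True by auto
next
  case False
  then have "p \<le> n * p" by (cases n) auto
  then have "rot (p + (n * p - p)) x = x \<and> rot (n * p - p + p) x = x" if "bd x" "sz x = n" for x
    using that rot_mod[of "n * p" x] by simp
  then show ?thesis by (intro exI[of _ "n * p - p"]) (simp add: rot_rot)
qed

lemma rot_inj: "bd x \<Longrightarrow> bd y \<Longrightarrow> rot p x = rot p y \<Longrightarrow> x = y"
  by (metis rot_back sz_rot)

lemma adj_rot_iff: "bd x \<Longrightarrow> adj (rot p x) d \<longleftrightarrow> (\<exists>y. adj x y \<and> d = rot p y)"
proof
  assume x: "bd x" and a: "adj (rot p x) d"
  obtain q where q: "\<And>z. bd z \<Longrightarrow> sz z = sz x \<Longrightarrow> rot q (rot p z) = z \<and> rot p (rot q z) = z"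
    using rot_back by metis
  have d: "bd d" "sz d = sz x" using adj_ok[OF a] adj_sz[OF a] by auto
  have "adj x (rot q d)" using adj_rot[OF a, of q] q[OF x] by simp
  then show "\<exists>y. adj x y \<and> d = rot p y" using q[OF d] by metis
qed (auto intro: adj_rot)

lemma crosses_shift2: "crosses {k + a, k + b} {k + c, k + d} \<longleftrightarrow> crosses {a, b} {c, d}"
  by (simp add: crosses_iff flip: max_add_distrib_right min_add_distrib_right)

text \<open>Edges are unordered, so if partners never leave the last \<open>m\<close> points, they
  never leave the first \<open>n\<close> either; each block is then a matching by itself.\<close>

lemma cat_split:
  assumes "ok c" "sz c = n + m" and cl: "\<And>p q. {p, q} \<in> edges c \<Longrightarrow> n \<le> p \<Longrightarrow> n \<le> q"
  obtains x y where "ok x" "ok y" "sz x = n" "sz y = m" "c = x \<frown> y"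
proof -
  let ?M = "edges c"
  have M: "mat (n + m) ?M" using assms by (simp add: ok_def')
  define X where "X = {e \<in> ?M. e \<subseteq> {..<n}}"
  define Y where "Y = {f. f \<subseteq> {..<m} \<and> (\<lambda>i. n + i) ` f \<in> ?M}"
  have split: "e \<subseteq> {..<n} \<or> (\<exists>a b. a < m \<and> b < m \<and> a \<noteq> b \<and> e = {n + a, n + b})" if e: "e \<in> ?M" for e
  proof -
    obtain a b where ab: "a \<noteq> b" "a < n + m" "b < n + m" "e = {a, b}" using mat_edge[OF M e] by blast
    have "n \<le> a \<longleftrightarrow> n \<le> b" using cl[of a b] cl[of b a] e ab by (auto simp: insert_commute)
    note iff = this
    show ?thesis
    proof (cases "n \<le> a")
      case True
      then have "a - n < m" "b - n < m" "a - n \<noteq> b - n" "e = {n + (a - n), n + (b - n)}"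
        using ab iff by auto
      then show ?thesis by blast
    qed (use ab iff in auto)
  qed
  have XY: "?M = X \<union> img (\<lambda>i. n + i) Y"
  proof (intro equalityI subsetI)
    fix e assume e: "e \<in> ?M"
    from split[OF e] show "e \<in> X \<union> img (\<lambda>i. n + i) Y"
    proof (elim disjE exE conjE)
      fix a b assume ab: "a < m" "b < m" "a \<noteq> b" "e = {n + a, n + b}"
      then have "{a, b} \<in> Y" "e = (\<lambda>i. n + i) ` {a, b}" using e by (auto simp: Y_def)
      then show ?thesis unfolding img_def by blast
    qed (use e in \<open>simp add: X_def\<close>)
  qed (auto simp: X_def Y_def img_def)
  have Ye: "\<exists>a b. a \<noteq> b \<and> a < m \<and> b < m \<and> f = {a, b}" if f: "f \<in> Y" for f
  proof -
    have "(\<lambda>i. n + i) ` f \<in> ?M" using f by (simp add: Y_def)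
    then obtain a b where ab: "a \<noteq> b" "a < n + m" "b < n + m" "(\<lambda>i. n + i) ` f = {a, b}"
      using mat_edge[OF M] by blast
    have "f = (\<lambda>i. i - n) ` ((\<lambda>i. n + i) ` f)" by (simp add: image_image)
    then have "f = {a - n, b - n}" by (simp add: ab(4))
    moreover have "n \<le> a" "n \<le> b"
    proof -
      have "a \<in> (\<lambda>i. n + i) ` f" "b \<in> (\<lambda>i. n + i) ` f" unfolding ab(4) by simp_all
      then show "n \<le> a" "n \<le> b" by auto
    qed
    ultimately have "a - n \<noteq> b - n" "a - n < m" "b - n < m" "f = {a - n, b - n}" using ab by auto
    then show ?thesis by blast
  qed
  have "mat n X"
    unfolding mat_def
  proof (intro conjI ballI allI impI)
    fix e assume "e \<in> X"
    then show "\<exists>a b. a \<noteq> b \<and> a < n \<and> b < n \<and> e = {a, b}"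
      using mat_edge[OF M, of e] by (auto simp: X_def)
  next
    fix p assume p: "p < n"
    then obtain e where e: "e \<in> ?M" "p \<in> e" "\<And>f. f \<in> ?M \<Longrightarrow> p \<in> f \<Longrightarrow> f = e"
      using mat_ex[OF M, of p] by auto
    have "e \<subseteq> {..<n}" using split[OF e(1)] p e(2) by auto
    then have "e \<in> X \<and> p \<in> e" using e(1,2) by (simp add: X_def)
    moreover have "f = e" if "f \<in> X \<and> p \<in> f" for f using that e(3) by (simp add: X_def)
    ultimately show "\<exists>!e. e \<in> X \<and> p \<in> e" by (rule ex1I)
  next
    fix e f assume "e \<in> X" "f \<in> X"
    then show "\<not> crosses e f" using mat_nocross[OF M] by (simp add: X_def)
  qed
  moreover have "mat m Y"
    unfolding mat_def
  proof (intro conjI ballI allI impI)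
    fix p assume p: "p < m"
    then obtain e where e: "e \<in> ?M" "n + p \<in> e" "\<And>f. f \<in> ?M \<Longrightarrow> n + p \<in> f \<Longrightarrow> f = e"
      using mat_ex[OF M, of "n + p"] by auto
    obtain a b where ab: "a < m" "b < m" "a \<noteq> b" "e = {n + a, n + b}"
      using split[OF e(1)] e(2) by auto
    have "{a, b} \<in> Y" "p \<in> {a, b}" using e(1,2) ab by (auto simp: Y_def)
    moreover have "f = {a, b}" if f: "f \<in> Y" "p \<in> f" for f
    proof -
      have "(\<lambda>i. n + i) ` f = e" using f by (intro e(3)) (auto simp: Y_def)
      also have "e = (\<lambda>i. n + i) ` {a, b}" using ab by simp
      finally show ?thesis by (simp only: inj_img_shift)
    qed
    ultimately have "{a, b} \<in> Y \<and> p \<in> {a, b}" "\<And>f. f \<in> Y \<and> p \<in> f \<Longrightarrow> f = {a, b}" by blast+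
    then show "\<exists>!e. e \<in> Y \<and> p \<in> e" by (rule ex1I)
  next
    fix e f assume ef: "e \<in> Y" "f \<in> Y"
    obtain a b where ab: "e = {a, b}" using Ye[OF ef(1)] by blast
    obtain c d where cd: "f = {c, d}" using Ye[OF ef(2)] by blast
    have "{n + a, n + b} \<in> ?M" "{n + c, n + d} \<in> ?M" using ef ab cd by (auto simp: Y_def)
    then show "\<not> crosses e f" using mat_nocross[OF M] crosses_shift2[of n a b c d] ab cd by auto
  qed (use Ye in auto)
  moreover have "c = Conf n X \<frown> Conf m Y" using XY assms(2) by (intro conf_eqI) (auto simp: cat_def)
  ultimately show ?thesis using that[of "Conf n X" "Conf m Y"] by simp
qed

lemma mat_eqI:
  assumes "mat n M" "P \<subseteq> M" "\<And>p. p < n \<Longrightarrow> \<exists>e\<in>P. p \<in> e"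
  shows "M = P"
proof (intro equalityI subsetI)
  fix e assume e: "e \<in> M"
  obtain a b where ab: "a < n" "e = {a, b}" using mat_edge[OF assms(1) e] by blast
  obtain f where "f \<in> P" "a \<in> f" using assms(3)[OF ab(1)] by blast
  then show "e \<in> P" using mat_unique[OF assms(1) e, of f a] ab assms(2) by auto
qed (use assms in auto)

lemma in_img_doubleton: "img f (insert e M) = insert (f ` e) (img f M)" "img f {} = {}"
  by (simp_all add: img_def)

section \<open>Small matchings\<close>

definition leaf :: conf where "leaf = Conf 2 {{0, 1}}"
definition cA :: conf where "cA = leaf \<frown> leaf"
definition cB :: conf where "cB = rot 1 cA"
text \<open>\<open>T0\<close>, \<open>T1\<close> and \<open>R0\<close>, \<open>R1\<close> are the
  pairs of boundary matchings of the hexagon and of the octagon. \<open>BB\<close> will be a vertex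
  of degree 1 in the octagon component.\<close>

definition T0 :: conf where "T0 = cA \<frown> leaf"
definition T1 :: conf where "T1 = rot 1 T0"
definition R0 :: conf where "R0 = cA \<frown> cA"
definition R1 :: conf where "R1 = rot 1 R0"
definition BB :: conf where "BB = cB \<frown> cB"

lemma sz_small [simp]: "sz leaf = 2" "sz cA = 4" "sz cB = 4" "sz T0 = 6" "sz T1 = 6"
  "sz R0 = 8" "sz R1 = 8" "sz BB = 8"
  by (simp_all add: leaf_def cA_def cB_def T0_def T1_def R0_def R1_def BB_def)

lemma edges_leaf: "edges leaf = {{0, 1}}" by (simp add: leaf_def)
lemma edges_cA: "edges cA = {{0, 1}, {2, 3}}"
  by (simp add: cA_def cat_def edges_leaf in_img_doubleton) (auto simp: doubleton_eq_iff eval_nat_numeral)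
lemma edges_cB: "edges cB = {{0, 3}, {1, 2}}"
  by (simp add: cB_def rot_def edges_cA in_img_doubleton) (auto simp: doubleton_eq_iff eval_nat_numeral)
lemma edges_T0: "edges T0 = {{0, 1}, {2, 3}, {4, 5}}"
  by (simp add: T0_def cat_def edges_cA edges_leaf in_img_doubleton) (auto simp: doubleton_eq_iff eval_nat_numeral)
lemma edges_T1: "edges T1 = {{1, 2}, {3, 4}, {0, 5}}"
  by (simp add: T1_def rot_def edges_T0 in_img_doubleton) (auto simp: doubleton_eq_iff eval_nat_numeral)
lemma edges_R0: "edges R0 = {{0, 1}, {2, 3}, {4, 5}, {6, 7}}"
  by (simp add: R0_def cat_def edges_cA in_img_doubleton) (auto simp: doubleton_eq_iff eval_nat_numeral)
lemma edges_R1: "edges R1 = {{1, 2}, {3, 4}, {5, 6}, {0, 7}}"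
  by (simp add: R1_def rot_def edges_R0 in_img_doubleton) (auto simp: doubleton_eq_iff eval_nat_numeral)
lemma edges_BB: "edges BB = {{0, 3}, {1, 2}, {4, 7}, {5, 6}}"
  by (simp add: BB_def cat_def edges_cB in_img_doubleton) (auto simp: doubleton_eq_iff eval_nat_numeral)

lemma ok_leaf [simp]: "ok leaf"
proof -
  have "\<exists>!e. e = {0, 1} \<and> p \<in> e" if "p < 2" for p :: nat
    using that by (auto simp: less_2_cases_iff)
  moreover have "\<exists>a b::nat. a \<noteq> b \<and> a < 2 \<and> b < 2 \<and> {0, 1} = {a, b}"
    by (intro exI[of _ 0] exI[of _ 1]) simp
  ultimately show ?thesis by (simp add: leaf_def mat_def crosses_iff)
qed

lemma ok_small [simp]: "ok cA" "ok cB" "ok T0" "ok T1" "ok R0" "ok R1" "ok BB"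
  by (simp_all add: cA_def cB_def T0_def T1_def R0_def R1_def BB_def)

lemma adj_AB: "adj cA cB" and adj_T01: "adj T0 T1" and adj_R01: "adj R0 R1"
  by (simp_all add: adj_def edges_cA edges_cB edges_T0 edges_T1 edges_R0 edges_R1
      compat_def crosses_iff doubleton_eq_iff)

lemma rot_leaf [simp]: "rot p leaf = leaf"
proof (induction p)
  case (Suc p)
  have "rot 1 leaf = leaf" by (simp add: rot_def leaf_def img_def insert_commute)
  then show ?case using Suc by (simp only: rot_Suc[of p])
qed simp

lemma rot_2_cA: "rot 2 cA = cA"
  using cat_swap[of leaf leaf] by (simp add: cA_def)

lemma rot_2_T0: "rot 2 T0 = T0"
  using cat_swap[of cA leaf] by (simp add: T0_def cA_def cat_assoc)

lemma rot_2_R0: "rot 2 R0 = R0"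
  using cat_swap[of "cA \<frown> leaf" leaf] by (simp add: R0_def cA_def cat_assoc)

lemma rot_4_BB: "rot 4 BB = BB"
  using cat_swap[of cB cB] by (simp add: BB_def)

lemma rot_even: "rot 2 x = x \<Longrightarrow> bd x \<Longrightarrow> rot p x = rot (p mod 2) x"
proof -
  assume x: "rot 2 x = x" and b: "bd x"
  have "rot (2 * k) x = x" for k
  proof (induction k)
    case (Suc k)
    have "rot (2 * Suc k) x = rot 2 (rot (2 * k) x)" by (simp add: rot_rot)
    then show ?case using Suc x by simp
  qed (use b in simp)
  then have "rot (p mod 2) (rot (2 * (p div 2)) x) = rot (p mod 2) x" by simp
  then show ?thesis by (simp add: rot_rot)
qed

lemma rot_parity: "rot 2 x = x \<Longrightarrow> bd x \<Longrightarrow> rot p x = (if even p then x else rot 1 x)"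
  using rot_even[of x p] by (metis mod2_eq_if rot_0)

lemma rot_cA: "rot p cA = (if even p then cA else cB)"
  unfolding cB_def by (rule rot_parity[OF rot_2_cA]) simp
lemma rot_cB: "rot p cB = (if even p then cB else cA)"
  using rot_cA[of "1 + p"] by (simp only: cB_def rot_rot) simp
lemma rot_T0: "rot p T0 = (if even p then T0 else T1)"
  unfolding T1_def by (rule rot_parity[OF rot_2_T0]) simp
lemma rot_R0: "rot p R0 = (if even p then R0 else R1)"
  unfolding R1_def by (rule rot_parity[OF rot_2_R0]) simp
lemma rot_R1: "rot p R1 = (if even p then R1 else R0)"
  using rot_R0[of "1 + p"] by (simp only: R1_def rot_rot) simp

lemma adj_BA: "adj cB cA" and adj_T10: "adj T1 T0" and adj_R10: "adj R1 R0"
  using adj_AB adj_T01 adj_R01 adj_sym by blast+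

lemma adj_R0_BB: "adj R0 BB" unfolding R0_def BB_def by (intro adj_cat adj_AB)
lemma adj_R0_rot_BB: "adj R0 (rot 2 BB)"
  using adj_rot[OF adj_R0_BB, of 2] by (simp add: rot_R0)

lemma mat_cross:
  assumes "mat n M" "{a, b} \<in> M" "{c, d} \<in> M" "a < c" "c < b" "b < d"
  shows False
  using mat_nocross[OF assms(1-3)] assms(4-6) by (simp add: crosses_iff)

lemma mat_unique3: "mat n M \<Longrightarrow> {p, q} \<in> M \<Longrightarrow> {r, p} \<in> M \<Longrightarrow> q = r"
  by (metis insert_commute mat_unique2)

lemma mat_unique4: "mat n M \<Longrightarrow> {q, p} \<in> M \<Longrightarrow> {r, p} \<in> M \<Longrightarrow> q = r"
  by (metis insert_commute mat_unique2)

lemma ok_4: assumes "ok y" "sz y = 4" shows "y = cA \<or> y = cB"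
proof -
  let ?M = "edges y"
  have M: "mat 4 ?M" using assms by (simp add: ok_def')
  obtain q where q: "q < 4" "q \<noteq> 0" "{0, q} \<in> ?M" using mat_partner[OF M, of 0] by auto
  then consider "q = 1" | "q = 2" | "q = 3" by linarith
  then show ?thesis
  proof cases
    case 1
    obtain r where r: "r < 4" "r \<noteq> 2" "{2, r} \<in> ?M" using mat_partner[OF M, of 2] by auto
    have "r \<noteq> 0 \<and> r \<noteq> 1" using mat_unique2[OF M, of 0 1 2] mat_unique2[OF M, of 1 0 2] r q 1
      by (cases "r = 0"; cases "r = 1") (auto simp: insert_commute)
    then have "r = 3" using r by linarith
    then have "?M = {{0, 1}, {2, 3}}"
    proof (intro mat_eqI[OF M])
      fix p :: nat assume "p < 4"
      then have "p = 0 \<or> p = 1 \<or> p = 2 \<or> p = 3" by linarith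
      then show "\<exists>e\<in>{{0, 1}, {2, 3}}. p \<in> e" by auto
    qed (use q r 1 in simp)
    then show ?thesis using assms edges_cA by (intro disjI1 conf_eqI) simp_all
  next
    case 3
    obtain r where r: "r < 4" "r \<noteq> 1" "{1, r} \<in> ?M" using mat_partner[OF M, of 1] by auto
    have "r \<noteq> 0 \<and> r \<noteq> 3" using mat_unique2[OF M, of 0 3 1] mat_unique2[OF M, of 3 0 1] r q 3
      by (cases "r = 0"; cases "r = 3") (auto simp: insert_commute)
    then have "r = 2" using r by linarith
    then have "?M = {{0, 3}, {1, 2}}"
    proof (intro mat_eqI[OF M])
      fix p :: nat assume "p < 4"
      then have "p = 0 \<or> p = 1 \<or> p = 2 \<or> p = 3" by linarith
      then show "\<exists>e\<in>{{0, 3}, {1, 2}}. p \<in> e" by auto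
    qed (use q r 3 in simp)
    then show ?thesis using assms edges_cB by (intro disjI2 conf_eqI) simp_all
  next
    case 2
    obtain r where r: "r < 4" "r \<noteq> 1" "{1, r} \<in> ?M" using mat_partner[OF M, of 1] by auto
    have "r \<noteq> 0 \<and> r \<noteq> 2" using mat_unique2[OF M, of 0 2 1] mat_unique2[OF M, of 2 0 1] r q 2
      by (cases "r = 0"; cases "r = 2") (auto simp: insert_commute)
    then have "r = 3" using r by linarith
    then show ?thesis using mat_cross[OF M, of 0 2 1 3] q r 2 by simp
  qed
qed

section \<open>Neighbours and degrees after attaching a quadrangle\<close>

lemma mat_closed:
  assumes "mat (n + m) M" "\<And>p. n \<le> p \<Longrightarrow> p < n + m \<Longrightarrow> \<exists>q\<ge>n. {p, q} \<in> M"
    "{p, q} \<in> M" "n \<le> p"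
  shows "n \<le> q"
proof -
  have "p < n + m" using mat_edge[OF assms(1,3)] by (auto simp: doubleton_eq_iff)
  then show ?thesis using assms(2)[OF assms(4)] mat_unique2[OF assms(1,3)] by blast
qed

lemma edge_cat_right: "{a, b} \<in> edges y \<Longrightarrow> {sz x + a, sz x + b} \<in> edges (x \<frown> y)"
  using in_imgI[of a b "edges y" "\<lambda>i. sz x + i"] by (simp add: cat_def)

lemma edge_cat_left: "e \<in> edges x \<Longrightarrow> e \<in> edges (x \<frown> y)"
  by (simp add: cat_def)

lemma adj_nocross: "adj x d \<Longrightarrow> e \<in> edges x \<Longrightarrow> f \<in> edges d \<Longrightarrow> \<not> crosses e f"
  by (simp add: adj_def compat_def)

lemma adj_notin: "adj x d \<Longrightarrow> e \<in> edges x \<Longrightarrow> e \<notin> edges d"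
  by (auto simp: adj_def)

lemma cat_splitE:
  assumes "ok c" "sz c = n + m" "\<forall>p q. {p, q} \<in> edges c \<longrightarrow> n \<le> p \<longrightarrow> n \<le> q"
  shows "\<exists>x y. ok x \<and> ok y \<and> sz x = n \<and> sz y = m \<and> c = x \<frown> y"
  by (rule cat_split[OF assms(1,2)]) (use assms(3) in blast)+

lemma adj_cat_closed:
  assumes "adj (x \<frown> y) d" "ok x" "ok y"
    and "\<forall>p q. {p, q} \<in> edges d \<longrightarrow> sz x \<le> p \<longrightarrow> sz x \<le> q"
  shows "\<exists>x' y'. adj x x' \<and> adj y y' \<and> d = x' \<frown> y'"
proof -
  obtain x' y' where *: "ok x'" "ok y'" "sz x' = sz x" "sz y' = sz y" "d = x' \<frown> y'"
    using cat_splitE[OF adj_ok(2)[OF assms(1)] _ assms(4), of "sz y"] adj_sz[OF assms(1)]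
    unfolding sz_cat by blast
  then have "adj x x' \<and> adj y y'" using assms(1) adj_cat_iff[of x x' y y'] assms(2,3) by simp
  then show ?thesis using *(5) by blast
qed

lemma adj_4: "adj cB y \<Longrightarrow> y = cA" "adj cA y \<Longrightarrow> y = cB"
proof -
  have "y \<noteq> cB" if "adj cB y" using adj_notin[OF that, of "{0, 3}"] by (auto simp: edges_cB)
  moreover have "y \<noteq> cA" if "adj cA y" using adj_notin[OF that, of "{0, 1}"] by (auto simp: edges_cA)
  moreover have "y = cA \<or> y = cB" if "adj z y" "sz z = 4" for z
    using ok_4 adj_ok(2)[OF that(1)] adj_sz[OF that(1)] that(2) by simp
  ultimately show "adj cB y \<Longrightarrow> y = cA" "adj cA y \<Longrightarrow> y = cB" by fastforce+
qed

text \<open>In \<open>d\<close> the two points under the outer edge of \<open>cB\<close> can be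
  matched neither beyond that edge nor with each other. Each takes one end of the outer edge, and
  non-crossing leaves only \<open>cA\<close>.\<close>

lemma adj_cat_B:
  assumes "adj (x \<frown> cB) d" "ok x"
  obtains y where "adj x y" "d = y \<frown> cA"
proof -
  let ?n = "sz x" and ?D = "edges d"
  have D: "mat (?n + 4) ?D" using adj_ok(2)[OF assms(1)] adj_sz[OF assms(1)] by (simp add: ok_def')
  have e1: "{?n, ?n + 3} \<in> edges (x \<frown> cB)"
    using edge_cat_right[of 0 3 cB x] by (simp add: edges_cB)
  have e2: "{?n + 1, ?n + 2} \<in> edges (x \<frown> cB)"
    using edge_cat_right[of 1 2 cB x] by (simp add: edges_cB)
  have n12: "{?n + 1, ?n + 2} \<notin> ?D" using adj_notin[OF assms(1) e2] .
  have in': "?n \<le> r" if "{?n + i, r} \<in> ?D" "i = 1 \<or> i = 2" for i r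
  proof (rule ccontr)
    assume "\<not> ?n \<le> r"
    then show False using adj_nocross[OF assms(1) e1 that(1)] that(2) by (auto simp: crosses_iff)
  qed
  obtain q where q: "q < ?n + 4" "q \<noteq> ?n + 1" "{?n + 1, q} \<in> ?D" using mat_partner[OF D, of "?n + 1"] by auto
  obtain r where r: "r < ?n + 4" "r \<noteq> ?n + 2" "{?n + 2, r} \<in> ?D" using mat_partner[OF D, of "?n + 2"] by auto
  have q1: "q = ?n \<or> q = ?n + 3"
  proof -
    have "q \<noteq> ?n + 2" using q(3) n12 by blast
    then show ?thesis using in'[OF q(3)] q by linarith
  qed
  have r1: "r = ?n \<or> r = ?n + 3"
  proof -
    have "r \<noteq> ?n + 1" using r(3) n12 by (metis insert_commute)
    then show ?thesis using in'[OF r(3)] r by linarith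
  qed
  have qr: "q \<noteq> r" using mat_unique4[OF D q(3), of "?n + 2"] r(3) by auto
  have q2: "q = ?n"
  proof (rule ccontr)
    assume "q \<noteq> ?n"
    then have "q = ?n + 3" "r = ?n" using q1 r1 qr by auto
    then show False using mat_cross[OF D, of ?n "?n + 2" "?n + 1" "?n + 3"] q(3) r(3)
      by (simp add: insert_commute)
  qed
  then have r2: "r = ?n + 3" using r1 qr by auto
  have cl: "?n \<le> b" if "{a, b} \<in> ?D" "?n \<le> a" for a b
  proof (rule mat_closed[OF D _ that])
    fix p assume "?n \<le> p" "p < ?n + 4"
    then consider "p = ?n" | "p = ?n + 1" | "p = ?n + 2" | "p = ?n + 3" by linarith
    moreover have "{?n, ?n + 1} \<in> ?D" "{?n + 1, ?n} \<in> ?D" "{?n + 2, ?n + 3} \<in> ?D" "{?n + 3, ?n + 2} \<in> ?D"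
      using q(3) r(3) q2 r2 by (simp_all add: insert_commute)
    ultimately show "\<exists>q\<ge>?n. {p, q} \<in> ?D" by (metis le_add1 le_refl)
  qed
  obtain x' y' where "adj x x'" "adj cB y'" "d = x' \<frown> y'"
    using adj_cat_closed[OF assms(1,2) ok_small(2)] cl by blast
  then show ?thesis using that adj_4 by blast
qed

text \<open>The rotation carries one end of the appended edge around to label 0, so that this edge
  spans all of \<open>x\<close>, which is shifted by one.\<close>

definition cap :: "conf \<Rightarrow> conf" where "cap x = rot 1 (x \<frown> leaf)"

lemma sz_cap [simp]: "sz (cap x) = sz x + 2" by (simp add: cap_def)
lemma ok_cap [simp]: "ok x \<Longrightarrow> ok (cap x)" by (simp add: cap_def)

lemma leaf_cat_cA: "leaf \<frown> cA = T0"
  by (simp add: T0_def cA_def cat_assoc)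

text \<open>The spanning edge and the two edges of \<open>cA\<close> are alternate sides of a
  hexagon outside \<open>x\<close>; the same edges can thus be regrouped as \<open>x\<close> beside
  \<open>T1\<close>.\<close>

lemma cap_cat_A: "bd x \<Longrightarrow> cap x \<frown> cA = rot 1 (x \<frown> T1)"
  using cat_rot_cat[of x leaf cA 1] by (simp add: cap_def leaf_cat_cA rot_T0)

lemma cap_cat_leaf: "bd x \<Longrightarrow> cap x \<frown> leaf = rot 1 (x \<frown> cB)"
  using cat_rot_cat[of x leaf leaf 1] by (simp add: cap_def rot_cA flip: cA_def)

lemma edge_rot: "{a, b} \<in> edges x \<Longrightarrow> {(a + p) mod sz x, (b + p) mod sz x} \<in> edges (rot p x)"
  using in_imgI[of a b "edges x" "\<lambda>i. (i + p) mod sz x"] by (simp add: rot_def)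

lemma cap_root_edge: "{0, sz x + 1} \<in> edges (cap x)"
proof -
  have "{sz x, sz x + 1} \<in> edges (x \<frown> leaf)" using edge_cat_right[of 0 1 leaf x] by (simp add: edges_leaf)
  from edge_rot[OF this, of 1] show ?thesis by (simp add: cap_def insert_commute)
qed

lemma mat_ne: "mat n M \<Longrightarrow> {a, b} \<in> M \<Longrightarrow> {c, d} \<in> M \<Longrightarrow> a \<noteq> c \<Longrightarrow> b \<noteq> d"
  using mat_unique4[of n M a b c] by blast

lemma mat_sym: "mat n M \<Longrightarrow> {a, b} \<in> M \<Longrightarrow> {c, d} \<in> M \<Longrightarrow> b = c \<longleftrightarrow> d = a"
  using mat_unique3[of n M c d a] mat_unique3[of n M a b c] by blast

lemma ok_6_T0:
  assumes "ok t" "sz t = 6" "{0, 1} \<in> edges t" "{2, 3} \<in> edges t" "{4, 5} \<in> edges t"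
  shows "t = T0"
proof -
  have "mat 6 (edges t)" using assms by (simp add: ok_def')
  then have "edges t = {{0, 1}, {2, 3}, {4, 5}}"
  proof (rule mat_eqI)
    fix p :: nat assume "p < 6"
    then have "p = 0 \<or> p = 1 \<or> p = 2 \<or> p = 3 \<or> p = 4 \<or> p = 5" by linarith
    then show "\<exists>e\<in>{{0, 1}, {2, 3}, {4, 5}}. p \<in> e" by auto
  qed (use assms in simp)
  then show ?thesis using assms edges_T0 by (intro conf_eqI) simp_all
qed

lemma edge_cat_rightD:
  assumes "{sz x + a, sz x + b} \<in> edges (x \<frown> y)" "bd x"
  shows "{a, b} \<in> edges y"
proof -
  have "{sz x + a, sz x + b} \<notin> edges x" using assms(2) by (auto simp: bd_def)
  then obtain f where f: "f \<in> edges y" "{sz x + a, sz x + b} = (\<lambda>i. sz x + i) ` f"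
    using assms(1) by (auto simp: cat_def img_def)
  moreover have "{sz x + a, sz x + b} = (\<lambda>i. sz x + i) ` {a, b}" by simp
  ultimately show ?thesis by (simp only: inj_img_shift)
qed

text \<open>The spanning edge screens off \<open>x\<close>, so in \<open>d\<close> the last four
  points are matched among themselves and the two ends of that edge. On these six points either the
  quadrangle flips alone or all three edges flip as a hexagon.\<close>

lemma adj_cap_cat_A:
  assumes "adj (cap x \<frown> cA) d" "ok x"
  shows "(\<exists>y. adj (cap x) y \<and> d = y \<frown> cB) \<or> (\<exists>y. adj x y \<and> d = rot 1 (y \<frown> T0))"
proof -
  let ?n = "sz x + 2" and ?D = "edges d"
  have sd: "sz d = ?n + 4" using adj_sz[OF assms(1)] by simp
  have D: "mat (?n + 4) ?D" using adj_ok(2)[OF assms(1)] sd by (simp add: ok_def')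
  have e0: "{0, ?n - 1} \<in> edges (cap x \<frown> cA)"
    using edge_cat_left[OF cap_root_edge, of x cA] by simp
  have e1: "{?n, ?n + 1} \<in> edges (cap x \<frown> cA)"
    using edge_cat_right[of 0 1 cA "cap x"] by (simp add: edges_cA)
  have e2: "{?n + 2, ?n + 3} \<in> edges (cap x \<frown> cA)"
    using edge_cat_right[of 2 3 cA "cap x"] by (simp add: edges_cA)
  have out: "r = 0 \<or> ?n - 1 \<le> r" if "{?n + i, r} \<in> ?D" for i r
  proof (rule ccontr)
    assume "\<not> ?thesis"
    then show False using adj_nocross[OF assms(1) e0 that] by (auto simp: crosses_iff)
  qed
  have part: "\<exists>r. {?n + i, r} \<in> ?D \<and> (r = 0 \<or> r = ?n - 1 \<or> r = ?n \<or> r = ?n + 1 \<or> r = ?n + 2 \<or> r = ?n + 3) \<and> r \<noteq> ?n + i"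
    if "i < 4" for i
  proof -
    obtain r where r: "r < ?n + 4" "r \<noteq> ?n + i" "{?n + i, r} \<in> ?D"
      using mat_partner[OF D, of "?n + i"] \<open>i < 4\<close> by auto
    then show ?thesis using out[OF r(3)] by (intro exI[of _ r]) auto
  qed
  have n1: "{?n, ?n + 1} \<notin> ?D" and n2: "{?n + 2, ?n + 3} \<notin> ?D"
    using adj_notin[OF assms(1)] e1 e2 by blast+
  obtain q0 where q0: "{?n, q0} \<in> ?D"
    "q0 = 0 \<or> q0 = ?n - 1 \<or> q0 = ?n + 1 \<or> q0 = ?n + 2 \<or> q0 = ?n + 3" using part[of 0] by auto
  obtain q1 where q1: "{?n + 1, q1} \<in> ?D"
    "q1 = 0 \<or> q1 = ?n - 1 \<or> q1 = ?n \<or> q1 = ?n + 2 \<or> q1 = ?n + 3" using part[of 1] by auto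
  obtain q2 where q2: "{?n + 2, q2} \<in> ?D"
    "q2 = 0 \<or> q2 = ?n - 1 \<or> q2 = ?n \<or> q2 = ?n + 1 \<or> q2 = ?n + 3" using part[of 2] by auto
  obtain q3 where q3: "{?n + 3, q3} \<in> ?D"
    "q3 = 0 \<or> q3 = ?n - 1 \<or> q3 = ?n \<or> q3 = ?n + 1 \<or> q3 = ?n + 2" using part[of 3] by auto
  have u: "q0 \<noteq> ?n + 1" "q1 \<noteq> ?n" "q2 \<noteq> ?n + 3" "q3 \<noteq> ?n + 2"
    using n1 n2 q0(1) q1(1) q2(1) q3(1) by (auto simp: insert_commute)
  have sym: "q0 = ?n + 2 \<longleftrightarrow> q2 = ?n" "q0 = ?n + 3 \<longleftrightarrow> q3 = ?n" "q1 = ?n + 2 \<longleftrightarrow> q2 = ?n + 1"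
    "q1 = ?n + 3 \<longleftrightarrow> q3 = ?n + 1"
    by (rule mat_sym[OF D]; fact)+
  have dist: "q0 \<noteq> q1" "q0 \<noteq> q2" "q0 \<noteq> q3" "q1 \<noteq> q2" "q1 \<noteq> q3" "q2 \<noteq> q3"
    by (rule mat_ne[OF D], fact, fact, simp)+
  have c: "\<not> crosses {?n, q0} {?n + 1, q1}" "\<not> crosses {?n, q0} {?n + 2, q2}" "\<not> crosses {?n, q0} {?n + 3, q3}"
    "\<not> crosses {?n + 1, q1} {?n + 2, q2}" "\<not> crosses {?n + 1, q1} {?n + 3, q3}" "\<not> crosses {?n + 2, q2} {?n + 3, q3}"
    using mat_nocross[OF D] q0(1) q1(1) q2(1) q3(1) by blast+
  have "q0 \<noteq> 0"
  proof
    assume "q0 = 0"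
    then have "q2 = ?n + 1" "q3 = ?n + 1"
      using q2(2) q3(2) u sym(1,2) dist(2,3) c(2,3) by (auto simp: crosses_iff)
    then show False using dist(6) by simp
  qed
  moreover have "q0 \<noteq> ?n + 2"
  proof
    assume "q0 = ?n + 2"
    then show False using q1(2) u(2) dist(1) c(1) by (auto simp: crosses_iff)
  qed
  moreover have "q1 = ?n + 2" if "q0 = ?n + 3"
    using that q1(2) u(2) dist(1) c(1) by (auto simp: crosses_iff)
  moreover have "q1 = ?n + 2 \<and> q3 = 0" if "q0 = ?n - 1"
  proof -
    have "q1 \<noteq> 0" using q2(2) u(3) sym(1,3) dist(2,4) that by auto
    moreover have "q1 \<noteq> ?n + 3"
    proof
      assume "q1 = ?n + 3"
      then have "q2 = 0" using q2(2) u(3) sym(1,3) dist(2) that by auto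
      then show False using c(4) \<open>q1 = ?n + 3\<close> by (simp add: crosses_iff)
    qed
    ultimately have "q1 = ?n + 2" using q1(2) u(2) dist(1) that by auto
    moreover have "q3 = 0" using q3(2) u(4) sym(2,4) dist(3) that \<open>q1 \<noteq> ?n + 3\<close> by auto
    ultimately show ?thesis by blast
  qed
  ultimately have "(q0 = ?n + 3 \<and> q1 = ?n + 2) \<or> (q0 = ?n - 1 \<and> q1 = ?n + 2 \<and> q3 = 0)"
    using q0(2) u(1) by blast
  then consider "q0 = ?n + 3" "q1 = ?n + 2" | "q0 = ?n - 1" "q1 = ?n + 2" "q3 = 0" by blast
  then show ?thesis
  proof cases
    case 1
    have cl: "sz (cap x) \<le> b" if "{a, b} \<in> ?D" "sz (cap x) \<le> a" for a b
      unfolding sz_cap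
    proof (rule mat_closed[OF D _ that(1) that(2)[unfolded sz_cap]])
      fix p assume "?n \<le> p" "p < ?n + 4"
      then consider "p = ?n" | "p = ?n + 1" | "p = ?n + 2" | "p = ?n + 3" by linarith
      moreover have "q2 = ?n + 1" "q3 = ?n" using sym 1 by blast+
      ultimately show "\<exists>q\<ge>?n. {p, q} \<in> ?D" using q0(1) q1(1) q2(1) q3(1) 1 by (metis le_add1 le_refl)
    qed
    obtain x' y' where "adj (cap x) x'" "adj cA y'" "d = x' \<frown> y'"
      using adj_cat_closed[OF assms(1) ok_cap[OF assms(2)] ok_small(1)] cl by blast
    then show ?thesis using adj_4 by blast
  next
    case 2
    obtain d' where d': "adj (x \<frown> T1) d'" "d = rot 1 d'"
      using assms adj_rot_iff[of "x \<frown> T1" 1 d] by (auto simp: cap_cat_A)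
    let ?D' = "edges d'"
    have sd': "sz d' = sz x + 6" using adj_sz[OF d'(1)] by simp
    \<comment> \<open>Rotating back by one, that is by \<open>sz x + 5\<close> on
      \<open>sz x + 6\<close> points, puts the three flipped edges on the last six points.\<close>
    have dd: "d' = rot (sz x + 5) d"
      using rot_inverse[of d' 1] adj_ok(2)[OF d'(1)] sd' d'(2) by (simp add: add.commute)
    have f: "{sz x + 0, sz x + 1} \<in> ?D'" "{sz x + 2, sz x + 3} \<in> ?D'" "{sz x + 4, sz x + 5} \<in> ?D'"
      using edge_rot[OF q0(1), of "sz x + 5"] edge_rot[OF q1(1), of "sz x + 5"]
        edge_rot[OF q3(1), of "sz x + 5"] 2
      by (simp_all add: dd sd mod2 insert_commute add.commute)
    have D': "mat (sz x + 6) ?D'" using adj_ok(2)[OF d'(1)] sd' by (simp add: ok_def')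
    have cl: "sz x \<le> b" if "{a, b} \<in> ?D'" "sz x \<le> a" for a b
    proof (rule mat_closed[OF D' _ that])
      fix p assume "sz x \<le> p" "p < sz x + 6"
      then consider "p = sz x" | "p = sz x + 1" | "p = sz x + 2" | "p = sz x + 3" | "p = sz x + 4" | "p = sz x + 5"
        by linarith
      then show "\<exists>q\<ge>sz x. {p, q} \<in> ?D'"
        using f by (metis le_add1 le_refl insert_commute add_0_right)
    qed
    obtain x' y' where *: "adj x x'" "adj T1 y'" "d' = x' \<frown> y'"
      using adj_cat_closed[OF d'(1) assms(2) ok_small(4)] cl by blast
    have "bd x'" "sz x' = sz x" using adj_ok(2)[OF *(1)] adj_sz[OF *(1)] by auto
    then have "{0, 1} \<in> edges y'" "{2, 3} \<in> edges y'" "{4, 5} \<in> edges y'"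
      using f *(3) edge_cat_rightD[of x' _ _ y'] by auto
    then have "y' = T0" using ok_6_T0 adj_ok(2)[OF *(2)] adj_sz[OF *(2)] by auto
    then show ?thesis using * d'(2) by blast
  qed
qed

definition deg :: "conf \<Rightarrow> nat" where "deg x = card {d. adj x d}"

lemma finite_adj [simp]: "finite {d. adj x d}"
proof (rule finite_subset)
  show "{d. adj x d} \<subseteq> Conf (sz x) ` Pow (Pow {..<sz x})"
  proof
    fix d assume "d \<in> {d. adj x d}"
    then have "sz d = sz x" "bd d" using adj_ok(2) adj_sz by auto
    then show "d \<in> Conf (sz x) ` Pow (Pow {..<sz x})" by (cases d) (auto simp: bd_def)
  qed
qed simp

lemma cat_inj: "x \<frown> y = x' \<frown> y' \<Longrightarrow> bd x \<Longrightarrow> bd x' \<Longrightarrow> bd y \<Longrightarrow> bd y' \<Longrightarrow> sz x = sz x' \<Longrightarrow>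
  {} \<notin> edges y \<Longrightarrow> {} \<notin> edges y' \<Longrightarrow> x = x' \<and> y = y'"
proof -
  assume a: "x \<frown> y = x' \<frown> y'" "bd x" "bd x'" "bd y" "bd y'" "sz x = sz x'" "{} \<notin> edges y" "{} \<notin> edges y'"
  let ?n = "sz x"
  have e: "edges x \<union> img (\<lambda>i. ?n + i) (edges y) = edges x' \<union> img (\<lambda>i. ?n + i) (edges y')"
    using a(1,6) by (simp add: cat_def)
  have 1: "edges u = {g \<in> edges u \<union> img (\<lambda>i. sz u + i) (edges v). g \<subseteq> {..<sz u}}"
    if "bd u" "{} \<notin> edges v" for u v
  proof -
    have "f \<notin> edges v" if "(\<lambda>i. sz u + i) ` f \<subseteq> {..<sz u}" for f
      using that \<open>{} \<notin> edges v\<close> by (cases "f = {}") auto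
    then show ?thesis using that by (auto simp: bd_def img_def)
  qed
  have 2: "edges v = {f. f \<noteq> {} \<and> (\<lambda>i. sz u + i) ` f \<in> edges u \<union> img (\<lambda>i. sz u + i) (edges v)}"
    if "bd u" "{} \<notin> edges v" for u v
  proof -
    have "(\<lambda>i. sz u + i) ` f \<notin> edges u" if "f \<noteq> {}" for f using that \<open>bd u\<close> by (fastforce simp: bd_def)
    then show ?thesis using that(2) by (auto simp: img_def inj_img_shift)
  qed
  have "edges x = {g \<in> edges x \<union> img (\<lambda>i. ?n + i) (edges y). g \<subseteq> {..<?n}}" by (rule 1) fact+
  also have "\<dots> = edges x'" unfolding e using 1[of x' y'] a by simp
  finally have "edges x = edges x'" .
  moreover have "edges y = {f. f \<noteq> {} \<and> (\<lambda>i. ?n + i) ` f \<in> edges x \<union> img (\<lambda>i. ?n + i) (edges y)}" by (rule 2) fact+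
  then have "edges y = edges y'" unfolding e using 2[of x' y'] a by simp
  ultimately show ?thesis using a by (auto intro!: conf_eqI) (metis add_left_cancel sz_cat)
qed

lemma ok_nonempty: "ok x \<Longrightarrow> {} \<notin> edges x"
  using mat_edge[of "sz x" "edges x" "{}"] by (auto simp: ok_def')

lemma cat_inj_ok: "x \<frown> y = x' \<frown> y' \<Longrightarrow> ok x \<Longrightarrow> ok x' \<Longrightarrow> ok y \<Longrightarrow> ok y' \<Longrightarrow> sz x = sz x' \<or> sz y = sz y' \<Longrightarrow>
  x = x' \<and> y = y'"
  using cat_inj[of x y x' y'] ok_nonempty[of y] ok_nonempty[of y'] sz_cat[of x y] sz_cat[of x' y'] by auto

lemma deg_rot [simp]: "bd x \<Longrightarrow> deg (rot p x) = deg x"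
proof -
  assume x: "bd x"
  have "{d. adj (rot p x) d} = rot p ` {d. adj x d}" using adj_rot_iff[OF x] by auto
  moreover have "inj_on (rot p) {d. adj x d}"
    by (rule inj_onI) (use adj_ok rot_inj in \<open>blast intro: ok_bd\<close>)
  ultimately show ?thesis by (simp add: deg_def card_image)
qed

lemma adj_cat_B_iff: "ok x \<Longrightarrow> adj (x \<frown> cB) d \<longleftrightarrow> (\<exists>y. adj x y \<and> d = y \<frown> cA)"
  by (metis adj_cat_B adj_cat adj_BA)

lemma deg_cat_B [simp]: "ok x \<Longrightarrow> deg (x \<frown> cB) = deg x"
proof -
  assume x: "ok x"
  have "{d. adj (x \<frown> cB) d} = (\<lambda>y. y \<frown> cA) ` {d. adj x d}" using adj_cat_B_iff[OF x] by auto
  moreover have "inj_on (\<lambda>y. y \<frown> cA) {d. adj x d}"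
    by (rule inj_onI) (use adj_ok cat_inj_ok in \<open>blast intro: ok_small\<close>)
  ultimately show ?thesis by (simp add: deg_def card_image)
qed

lemma deg_B_cat [simp]: "ok x \<Longrightarrow> deg (cB \<frown> x) = deg x"
  by (subst cat_swap) auto

lemma deg_cap_cat_A: assumes x: "ok x" shows "deg (cap x \<frown> cA) = deg (cap x) + deg x"
proof -
  let ?N = "{d. adj (cap x) d}" and ?M = "{d. adj x d}"
  have b: "adj (cap x \<frown> cA) (rot 1 (y \<frown> T0))" if "adj x y" for y
    using that x by (simp add: cap_cat_A adj_rot adj_cat adj_T10)
  have "{d. adj (cap x \<frown> cA) d} = (\<lambda>y. y \<frown> cB) ` ?N \<union> (\<lambda>y. rot 1 (y \<frown> T0)) ` ?M"
  proof (intro equalityI subsetI)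
    fix d assume "d \<in> {d. adj (cap x \<frown> cA) d}"
    then show "d \<in> (\<lambda>y. y \<frown> cB) ` ?N \<union> (\<lambda>y. rot 1 (y \<frown> T0)) ` ?M"
      using adj_cap_cat_A[OF _ x, of d] by blast
  next
    fix d assume "d \<in> (\<lambda>y. y \<frown> cB) ` ?N \<union> (\<lambda>y. rot 1 (y \<frown> T0)) ` ?M"
    then show "d \<in> {d. adj (cap x \<frown> cA) d}" using b adj_cat[OF _ adj_AB] by blast
  qed
  moreover have "inj_on (\<lambda>y. y \<frown> cB) ?N"
    by (rule inj_onI) (use adj_ok cat_inj_ok in \<open>blast intro: ok_small\<close>)
  moreover have "inj_on (\<lambda>y. rot 1 (y \<frown> T0)) ?M"
  proof (rule inj_onI)
    fix y z assume a: "y \<in> ?M" "z \<in> ?M" "rot 1 (y \<frown> T0) = rot 1 (z \<frown> T0)"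
    then have o: "ok y" "ok z" using adj_ok by auto
    then have "y \<frown> T0 = z \<frown> T0" using rot_inj[OF _ _ a(3)] by simp
    then show "y = z" using cat_inj_ok[of y T0 z T0] o by simp
  qed
  \<comment> \<open>The point \<open>sz x + 2\<close> tells the two kinds of neighbours apart: its
    partner is \<open>sz x + 5\<close> when the quadrangle has flipped and \<open>sz x + 1\<close>
    when the hexagon has.\<close>
  moreover have "y \<frown> cB \<noteq> rot 1 (z \<frown> T0)" if "adj (cap x) y" "adj x z" for y z
  proof
    assume eq: "y \<frown> cB = rot 1 (z \<frown> T0)"
    have s: "sz y = sz x + 2" "sz z = sz x" "ok y" "ok z"
      using adj_sz adj_ok(2) that by auto
    have "{sz x + 2 + 0, sz x + 2 + 3} \<in> edges (y \<frown> cB)"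
      using edge_cat_right[of 0 3 cB y] s by (simp add: edges_cB)
    moreover have "{sz x + 0, sz x + 1} \<in> edges (z \<frown> T0)"
      using edge_cat_right[of 0 1 T0 z] s by (simp add: edges_T0)
    then have "{sz x + 1, sz x + 2} \<in> edges (y \<frown> cB)"
      using edge_rot[of "sz x + 0" "sz x + 1" "z \<frown> T0" 1] s eq by simp
    moreover have "mat (sz x + 6) (edges (y \<frown> cB))" using ok_cat[of y cB] s unfolding ok_def'[of "y \<frown> cB"] by (simp add: add.commute)
    ultimately show False using mat_unique3[of "sz x + 6" "edges (y \<frown> cB)" "sz x + 2" "sz x + 5" "sz x + 1"] by (simp add: add.commute)
  qed
  then have "(\<lambda>y. y \<frown> cB) ` ?N \<inter> (\<lambda>y. rot 1 (y \<frown> T0)) ` ?M = {}" by blast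
  ultimately show ?thesis
    unfolding deg_def by (simp only: card_Un_disjoint finite_imageI finite_adj card_image)
qed

section \<open>Peeling a quadrangle off a matching\<close>

lemma closed_not_1:
  assumes "mat n M" "s < n" "\<forall>p q. {p, q} \<in> M \<longrightarrow> s \<le> p \<longrightarrow> p < s + 1 \<longrightarrow> s \<le> q \<and> q < s + 1"
  shows False
proof -
  obtain q where "q \<noteq> s" "{s, q} \<in> M" using mat_partner[OF assms(1,2)] by blast
  then show False using assms(3) by (metis Suc_eq_plus1 le_antisym less_Suc_eq_le le_refl)
qed

lemma closed_2:
  assumes "mat n M" "s < n" "\<forall>p q. {p, q} \<in> M \<longrightarrow> s \<le> p \<longrightarrow> p < s + 2 \<longrightarrow> s \<le> q \<and> q < s + 2"
  shows "{s, s + 1} \<in> M"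
proof -
  obtain q where q: "q \<noteq> s" "{s, q} \<in> M" using mat_partner[OF assms(1,2)] by blast
  then have "s \<le> q \<and> q < s + 2" using assms(3)[rule_format, of s q] by simp
  then have "q = s + 1" using q by linarith
  then show ?thesis using q by simp
qed

lemma closed_not_3:
  assumes "mat n M" "s + 2 < n" "\<forall>p q. {p, q} \<in> M \<longrightarrow> s \<le> p \<longrightarrow> p < s + 3 \<longrightarrow> s \<le> q \<and> q < s + 3"
  shows False
proof -
  have p: "\<exists>q. {s + i, s + q} \<in> M \<and> q \<noteq> i \<and> q < 3" if i: "i < 3" for i
  proof -
    obtain q where q: "q \<noteq> s + i" "{s + i, q} \<in> M" using mat_partner[OF assms(1), of "s + i"] assms(2) i by auto
    then have "s \<le> q \<and> q < s + 3" using assms(3)[rule_format, of "s + i" q] i by simp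
    then show ?thesis using q by (intro exI[of _ "q - s"]) auto
  qed
  obtain a where a: "{s + 0, s + a} \<in> M" "a \<noteq> 0" "a < 3" using p[of 0] by auto
  obtain b where b: "{s + 1, s + b} \<in> M" "b \<noteq> 1" "b < 3" using p[of 1] by auto
  obtain c where c: "{s + 2, s + c} \<in> M" "c \<noteq> 2" "c < 3" using p[of 2] by auto
  have "s + a \<noteq> s + b" by (rule mat_ne[OF assms(1) a(1) b(1)]) simp
  moreover have "s + a \<noteq> s + c" by (rule mat_ne[OF assms(1) a(1) c(1)]) simp
  moreover have "s + b \<noteq> s + c" by (rule mat_ne[OF assms(1) b(1) c(1)]) simp
  moreover have "s + a = s + 1 \<longleftrightarrow> s + b = s + 0" by (rule mat_sym[OF assms(1) a(1) b(1)])
  moreover have "s + a = s + 2 \<longleftrightarrow> s + c = s + 0" by (rule mat_sym[OF assms(1) a(1) c(1)])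
  ultimately show False using a(2,3) b(2,3) c(2,3) by presburger
qed

text \<open>The edge at the first point cuts the block into an inner and an outer block. If one of
  them has at least four points, recurse into it; otherwise both have 0 or 2 points, since closed
  blocks are even, and the first edge completes the pattern.\<close>

lemma pattern_exists:
  "mat n M \<Longrightarrow> a + m \<le> n \<Longrightarrow> 4 \<le> m \<Longrightarrow>
    \<forall>p q. {p, q} \<in> M \<longrightarrow> a \<le> p \<longrightarrow> p < a + m \<longrightarrow> a \<le> q \<and> q < a + m \<Longrightarrow>
    \<exists>i. i + 4 \<le> a + m \<and> (({i, i + 1} \<in> M \<and> {i + 2, i + 3} \<in> M) \<or> ({i, i + 3} \<in> M \<and> {i + 1, i + 2} \<in> M))"
proof (induction m arbitrary: a rule: less_induct)
  case (less m)
  note M = less.prems(1)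
  have cl: "a \<le> q \<and> q < a + m" if "{p, q} \<in> M" "a \<le> p" "p < a + m" for p q
    using less.prems(4) that by blast
  obtain j where j: "j \<noteq> a" "{a, j} \<in> M" using mat_partner[OF M, of a] less.prems by auto
  have ja: "a < j" "j < a + m" using cl[OF j(2)] j(1) less.prems by auto
  have inn: "a < q \<and> q < j" if pq: "{p, q} \<in> M" "a < p" "p < j" for p q
  proof -
    have "a \<le> q" "q < a + m" using cl[OF pq(1)] pq ja by auto
    moreover have "q \<noteq> a" using mat_sym[OF M j(2) pq(1)] pq(3) by auto
    moreover have "q \<noteq> j" using mat_ne[OF M j(2) pq(1)] pq(2) by auto
    moreover have "\<not> j < q" using mat_cross[OF M j(2) pq(1)] pq by auto
    ultimately show ?thesis by linarith
  qed
  have out: "j < q \<and> q < a + m" if pq: "{p, q} \<in> M" "j < p" "p < a + m" for p q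
  proof -
    have "a \<le> q" "q < a + m" using cl[OF pq(1)] pq ja by auto
    moreover have "q \<noteq> a" using mat_sym[OF M j(2) pq(1)] pq(2) by auto
    moreover have "q \<noteq> j" using mat_ne[OF M j(2) pq(1)] pq(2) ja by auto
    moreover have "\<not> (a < q \<and> q < j)" using inn[of q p] pq by (auto simp: insert_commute)
    ultimately show ?thesis by linarith
  qed
  let ?k = "j - a - 1" and ?l = "a + m - j - 1"
  have inn': "\<forall>p q. {p, q} \<in> M \<longrightarrow> a + 1 \<le> p \<longrightarrow> p < a + 1 + ?k \<longrightarrow> a + 1 \<le> q \<and> q < a + 1 + ?k"
    using inn ja by fastforce
  have out': "\<forall>p q. {p, q} \<in> M \<longrightarrow> j + 1 \<le> p \<longrightarrow> p < j + 1 + ?l \<longrightarrow> j + 1 \<le> q \<and> q < j + 1 + ?l"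
    using out ja by fastforce
  consider "4 \<le> ?k" | "4 \<le> ?l" | "?k < 4" "?l < 4" by linarith
  then show ?case
  proof cases
    case 1
    have "\<exists>i. i + 4 \<le> a + 1 + ?k \<and> (({i, i + 1} \<in> M \<and> {i + 2, i + 3} \<in> M) \<or> ({i, i + 3} \<in> M \<and> {i + 1, i + 2} \<in> M))"
      by (rule less.IH[OF _ M _ 1 inn']) (use ja less.prems in auto)
    moreover have "a + 1 + ?k \<le> a + m" using ja by linarith
    ultimately show ?thesis by (meson order_trans)
  next
    case 2
    have "\<exists>i. i + 4 \<le> j + 1 + ?l \<and> (({i, i + 1} \<in> M \<and> {i + 2, i + 3} \<in> M) \<or> ({i, i + 3} \<in> M \<and> {i + 1, i + 2} \<in> M))"
      by (rule less.IH[OF _ M _ 2 out']) (use ja less.prems in auto)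
    moreover have "j + 1 + ?l \<le> a + m" using ja by linarith
    ultimately show ?thesis by (meson order_trans)
  next
    case 3
    have "?k \<noteq> 1"
    proof
      assume k: "?k = 1"
      show False by (rule closed_not_1[OF M _ inn'[unfolded k]]) (use ja less.prems in linarith)
    qed
    moreover have "?k \<noteq> 3"
    proof
      assume k: "?k = 3"
      show False by (rule closed_not_3[OF M _ inn'[unfolded k]]) (use k ja less.prems in linarith)
    qed
    ultimately have "?k = 0 \<or> ?k = 2" using 3 by linarith
    then show ?thesis
    proof
      assume k: "?k = 2"
      then have "j = a + 3" by linarith
      moreover have "{a + 1, a + 1 + 1} \<in> M"
        by (rule closed_2[OF M _ inn'[unfolded k]]) (use ja less.prems in linarith)
      ultimately show ?thesis using j ja by (intro exI[of _ a]) (simp add: eval_nat_numeral)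
    next
      assume k: "?k = 0"
      then have ja1: "j = a + 1" using ja by linarith
      have "?l \<noteq> 3"
      proof
        assume l: "?l = 3"
        show False by (rule closed_not_3[OF M _ out'[unfolded l]]) (use l ja less.prems in linarith)
      qed
      then have l: "?l = 2" using 3 ja1 less.prems(3) by linarith
      have "{j + 1, j + 1 + 1} \<in> M"
        by (rule closed_2[OF M _ out'[unfolded l]]) (use l ja less.prems in linarith)
      then show ?thesis using j ja1 l by (intro exI[of _ a]) (simp add: eval_nat_numeral)
    qed
  qed
qed

text \<open>A pattern found at \<open>i\<close> is rotated to the last four positions. It does not
  wrap around on the way, which gives the bound on \<open>r\<close> that \<open>rot_cat_rot\<close>
  asks for.\<close>

lemma decomp:
  assumes "ok c" "4 \<le> sz c"
  shows "\<exists>w t r. ok w \<and> (t = cA \<or> t = cB) \<and> r \<le> sz w \<and> w \<frown> t = rot r c"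
proof -
  let ?n = "sz c"
  have M: "mat ?n (edges c)" using assms by (simp add: ok_def')
  have "\<forall>p q. {p, q} \<in> edges c \<longrightarrow> 0 \<le> p \<longrightarrow> p < 0 + ?n \<longrightarrow> 0 \<le> q \<and> q < 0 + ?n"
    using ok_bd[OF assms(1)] by (auto simp: bd_def)
  have "\<exists>i. i + 4 \<le> 0 + ?n \<and> (({i, i + 1} \<in> edges c \<and> {i + 2, i + 3} \<in> edges c) \<or> ({i, i + 3} \<in> edges c \<and> {i + 1, i + 2} \<in> edges c))"
    by (rule pattern_exists[OF M _ assms(2)]) (simp, fact)
  then obtain i where i: "i + 4 \<le> 0 + ?n"
    "({i, i + 1} \<in> edges c \<and> {i + 2, i + 3} \<in> edges c) \<or> ({i, i + 3} \<in> edges c \<and> {i + 1, i + 2} \<in> edges c)"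
    by blast
  have sw: "{x, y} \<in> E \<Longrightarrow> {y, x} \<in> E" for x y :: nat and E by (simp add: insert_commute)
  define r where "r = ?n - 4 - i"
  define s where "s = ?n - 4"
  let ?d = "rot r c"
  have m: "(i + k + r) mod ?n = s + k" if "k < 4" for k
    using that i(1) by (simp add: r_def s_def)
  have e: "{i + k, i + l} \<in> edges c \<Longrightarrow> {s + k, s + l} \<in> edges ?d" if "k < 4" "l < 4" for k l
    using edge_rot[of "i + k" "i + l" c r] m[of k] m[of l] that by simp
  have d: "({s + 0, s + 1} \<in> edges ?d \<and> {s + 2, s + 3} \<in> edges ?d) \<or> ({s + 0, s + 3} \<in> edges ?d \<and> {s + 1, s + 2} \<in> edges ?d)"
    using i(2) e[of 0 1] e[of 2 3] e[of 0 3] e[of 1 2] by auto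
  have sn: "?n = s + 4" using assms(2) by (simp add: s_def)
  have okd: "ok ?d" using assms(1) by simp
  have D: "mat (s + 4) (edges ?d)" using okd sn by (simp add: ok_def')
  have "\<forall>p q. {p, q} \<in> edges ?d \<longrightarrow> s \<le> p \<longrightarrow> s \<le> q"
  proof (intro allI impI)
    fix p q assume pq: "{p, q} \<in> edges ?d" "s \<le> p"
    show "s \<le> q"
    proof (rule mat_closed[OF D _ pq])
      fix p assume "s \<le> p" "p < s + 4"
      then consider "p = s + 0" | "p = s + 1" | "p = s + 2" | "p = s + 3" by linarith
      moreover have "{s + 0, s + 1} \<in> edges ?d \<and> {s + 1, s + 0} \<in> edges ?d \<and> {s + 2, s + 3} \<in> edges ?d \<and> {s + 3, s + 2} \<in> edges ?d \<or>
        {s + 0, s + 3} \<in> edges ?d \<and> {s + 3, s + 0} \<in> edges ?d \<and> {s + 1, s + 2} \<in> edges ?d \<and> {s + 2, s + 1} \<in> edges ?d"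
        using d sw by blast
      ultimately show "\<exists>q\<ge>s. {p, q} \<in> edges ?d"
        by (metis le_add1)
    qed
  qed
  then obtain w y where wy: "ok w" "ok y" "sz w = s" "sz y = 4" "?d = w \<frown> y"
    using cat_splitE[OF okd, of s 4] sn by auto
  have "r \<le> sz w" using wy(3) by (simp add: r_def s_def)
  moreover have "y = cA \<or> y = cB" by (rule ok_4) fact+
  ultimately show ?thesis using wy(1) wy(5)[symmetric]
    by (intro exI[of _ w] exI[of _ y] exI[of _ r] conjI)
qed

lemma ok_0: "ok c \<Longrightarrow> sz c = 0 \<Longrightarrow> c = Conf 0 {}"
  using mat_edge[of 0 "edges c"] by (intro conf_eqI) (auto simp: ok_def')

lemma ex_adj_AB: "t = cA \<or> t = cB \<Longrightarrow> \<exists>t'. (t' = cA \<or> t' = cB) \<and> adj t t'"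
  using adj_AB adj_BA by blast

text \<open>Peel off a quadrangle and flip it, moving the rest by induction. The induction can start
  at size 0 because the empty configuration is its own neighbour.\<close>

lemma ex_adj: "ok c \<Longrightarrow> 4 dvd sz c \<Longrightarrow> \<exists>d. adj c d"
proof (induction "sz c" arbitrary: c rule: less_induct)
  case less
  show ?case
  proof (cases "sz c = 0")
    case True
    then have "c = Conf 0 {}" using ok_0 less.prems by blast
    then have "adj c c" by (simp add: adj_def mat_def compat_def)
    then show ?thesis by blast
  next
    case False
    then have "4 \<le> sz c" using less.prems(2) by (auto dest: dvd_imp_le)
    then obtain w t r where w: "ok w" "t = cA \<or> t = cB" "w \<frown> t = rot r c"
      using decomp[OF less.prems(1)] by blast
    have "sz c = sz w + sz t" using arg_cong[OF w(3), of sz] by simp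
    moreover have "sz t = 4" using w(2) by auto
    ultimately have s: "sz w < sz c" "4 dvd sz w" using less.prems(2) by (auto simp: dvd_add_left_iff)
    obtain w' where "adj w w'" using less.hyps[OF s(1) w(1) s(2)] by blast
    moreover obtain t' where "adj t t'" using ex_adj_AB[OF w(2)] by blast
    ultimately have "adj (rot r c) (w' \<frown> t')" using adj_cat w(3) by metis
    then show ?thesis using adj_rot_iff less.prems(1) by (meson ok_bd)
  qed
qed

section \<open>Chains\<close>

text \<open>The entries of the word are the rotations between successive attachments of \<open>t\<close>, the last
  one first.\<close>

fun ch :: "conf \<Rightarrow> conf \<Rightarrow> nat list \<Rightarrow> conf" where
  "ch t b [] = b"
| "ch t b (c # cs) = rot c (ch t b cs \<frown> t)"

lemma ok_ch [simp]: "ok t \<Longrightarrow> ok b \<Longrightarrow> ok (ch t b cs)"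
  by (induction cs) auto

lemma sz_ch [simp]: "sz (ch t b cs) = sz b + length cs * sz t"
  by (induction cs) auto

lemma deg_ch_B [simp]: "ok b \<Longrightarrow> deg (ch cB b cs) = deg b"
  by (induction cs) auto

lemma adj_ch: "adj b b' \<Longrightarrow> adj t t' \<Longrightarrow> adj (ch t b cs) (ch t' b' cs)"
  by (induction cs) (auto intro: adj_rot adj_cat)

text \<open>The same chain grown outwards, with the part already built as accumulator; this order
  suits the induction in \<open>rch_reverse\<close>.\<close>

fun rch :: "conf \<Rightarrow> conf \<Rightarrow> nat list \<Rightarrow> conf" where
  "rch t b [] = b \<frown> t"
| "rch t b (c # cs) = rch t (rot c (b \<frown> t)) cs"

lemma rch_snoc: "rch t b (cs @ [c]) = rot c (rch t b cs) \<frown> t"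
  by (induction cs arbitrary: b) auto

lemma ch_eq_rch: "ch t b cs \<frown> t = rch t b (rev cs)"
  by (induction cs) (auto simp: rch_snoc)

text \<open>What is inserted into a quadrangle can also be regarded as the body to which that
  quadrangle is attached. As \<open>c\<close> is odd, this change of view turns \<open>t\<close>
  into \<open>rot 1 t\<close> and the gap \<open>c\<close> into \<open>4 - c\<close>; the last
  quadrangle of the chain becomes the base of an arm at \<open>x\<close>.\<close>

lemma rch_reverse:
  assumes "t = cA \<or> t = cB" "set cs \<subseteq> {1, 3}" "bd x"
  shows "\<exists>p. rch t x cs = rot p (x \<frown> ch (rot 1 t) t (map (\<lambda>c. 4 - c) cs))"
  using assms(2,3)
proof (induction cs arbitrary: x)
  case Nil
  then show ?case using assms(1) by (intro exI[of _ 0]) auto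
next
  case (Cons c cs)
  let ?t' = "rot 1 t" and ?Z = "ch (rot 1 t) t (map (\<lambda>c. 4 - c) cs)"
  have c: "c = 1 \<or> c = 3" using Cons.prems by simp
  have ok: "ok t" "ok ?t'" "ok ?Z" "sz t = 4" using assms(1) by auto
  have tc: "rot c t = ?t'" using c assms(1) by (auto simp: rot_cA rot_cB)
  obtain p where p: "rch t (rot c (x \<frown> t)) cs = rot p (rot c (x \<frown> t) \<frown> ?Z)"
    using Cons.IH[of "rot c (x \<frown> t)"] Cons.prems ok by auto
  have "rot c (x \<frown> t) \<frown> ?Z = rot c (x \<frown> rot (4 + sz ?Z - c) (?t' \<frown> ?Z))"
    using cat_rot_cat[of x t ?Z c] Cons.prems ok c tc by auto
  also have "?t' \<frown> ?Z = rot 4 (?Z \<frown> ?t')" using cat_swap[of ?Z ?t'] ok by simp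
  also have "rot (4 + sz ?Z - c) (rot 4 (?Z \<frown> ?t')) = rot (4 - c) (?Z \<frown> ?t')"
  proof -
    have e: "4 + (4 + sz ?Z - c) = (4 - c) + (sz ?Z + 4)" using c by auto
    show ?thesis
      unfolding rot_rot
    proof (rule rot_cong[of _ "sz ?Z + 4"])
      show "(4 + (4 + sz ?Z - c)) mod (sz ?Z + 4) = (4 - c) mod (sz ?Z + 4)"
        unfolding e by (rule mod_add_self2)
    qed (use ok in simp_all)
  qed
  finally have "rch t x (c # cs) = rot (c + p) (x \<frown> ch ?t' t (map (\<lambda>c. 4 - c) (c # cs)))"
    using p by (simp add: rot_rot)
  then show ?case by blast
qed

definition valid :: "nat list \<Rightarrow> bool" where "valid cs \<longleftrightarrow> set cs \<subseteq> {1, 3}"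

lemma valid_simps [simp]: "valid []" "valid (c # cs) \<longleftrightarrow> (c = 1 \<or> c = 3) \<and> valid cs"
  by (auto simp: valid_def)

text \<open>The word of a chain when it is read from its other end, see
  \<open>ch_reverse\<close>.\<close>

definition rv :: "nat list \<Rightarrow> nat list" where "rv cs = map (\<lambda>c. 4 - c) (rev cs)"

lemma valid_rv [simp]: "valid cs \<Longrightarrow> valid (rv cs)"
  by (auto simp: valid_def rv_def)

lemma length_rv [simp]: "length (rv cs) = length cs" by (simp add: rv_def)

lemma rv_rv: "valid cs \<Longrightarrow> rv (rv cs) = cs"
  by (auto simp: valid_def rv_def rev_map intro!: map_idI)

lemma ch_reverse:
  assumes "t = cA \<or> t = cB" "valid cs" "bd x"
  shows "\<exists>p. ch t x cs \<frown> t = rot p (x \<frown> ch (rot 1 t) t (rv cs))"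
  using rch_reverse[OF assms(1), of "rev cs" x] assms(2,3)
  by (simp add: ch_eq_rch rv_def valid_def)

text \<open>A quadrangle with a \<open>cB\<close> in both gaps between its two edges.\<close>

definition ST :: conf where "ST = rot 6 (cA \<frown> cB) \<frown> cB"

text \<open>An insertion beside the newest \<open>cB\<close> or under its inner edge produces
  \<open>BB\<close>. A deeper one commutes with the newest \<open>cB\<close> and reduces to the
  shorter chain. The only new situation is a gap 1 or 3 there: the newest \<open>cB\<close> already
  fills the other of these two gaps, and \<open>ST\<close> arises. Insertions into the base are left
  to \<open>hbase\<close>. \<open>K\<close> stays open because it is used for \<open>oct\<close> and
  for \<open>split\<close>.\<close>

lemma chain_insert:
  fixes K :: "conf \<Rightarrow> bool"
  assumes K_rot: "\<And>x p. K x \<Longrightarrow> K (rot p x)" and K_B: "\<And>x. K x \<Longrightarrow> K (x \<frown> cB)"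
    and b: "ok b"
    and hBB: "\<And>cs p. valid cs \<Longrightarrow> K (ch cB b cs \<frown> rot p BB)"
    and hST: "\<And>cs p. valid cs \<Longrightarrow> K (ch cB b cs \<frown> rot p ST)"
    and hbase: "\<And>j. 0 < j \<Longrightarrow> j < sz b \<Longrightarrow> K (rot (4 + j) (b \<frown> cB) \<frown> cB)"
    and "valid cs" "p < sz b + length cs * 4 + 4" "p \<noteq> 1" "p \<noteq> 3"
  shows "K (rot p (ch cB b cs \<frown> cB) \<frown> cB)"
  using assms(7-)
proof (induction cs arbitrary: p)
  have gen: "K (rot p (x \<frown> cB) \<frown> cB)"
    if x: "x = ch cB b cs" "valid cs" and p: "p < sz x + 4" "p \<noteq> 1" "p \<noteq> 3"
      and big: "\<And>j. 0 < j \<Longrightarrow> j < sz x \<Longrightarrow> K (rot (4 + j) (x \<frown> cB) \<frown> cB)" for cs x p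
  proof -
    have okx: "ok x" using x b by simp
    have xBB: "K (x \<frown> rot q BB)" for q using hBB x by blast
    consider "p = 0" | "p = 2" | "p = 4" | "p > 4" using p by linarith
    then show ?thesis
    proof cases
      case 1
      then show ?thesis using xBB[of 0] okx by (simp add: cat_assoc BB_def)
    next
      case 2
      have "rot 2 (x \<frown> cB) \<frown> cB = rot 2 (x \<frown> rot 6 BB)"
        using cat_rot_cat[of x cB cB 2] okx by (simp add: rot_cB BB_def)
      then show ?thesis using K_rot[OF xBB[of 6], of 2] 2 by simp
    next
      case 3
      have "rot 4 (x \<frown> cB) \<frown> cB = rot 4 (rot (sz x + 4) (x \<frown> cB) \<frown> cB)"
        using cat_rot_cat2[of x cB cB 0] okx by simp
      also have "rot (sz x + 4) (x \<frown> cB) = x \<frown> cB" using rot_sz[of "x \<frown> cB"] okx by simp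
      finally show ?thesis using K_rot[OF xBB[of 0], of 4] 3 okx by (simp add: cat_assoc BB_def)
    next
      case 4
      then show ?thesis using big[of "p - 4"] p by simp
    qed
  qed
  {
    case Nil
    then show ?case using gen[of b "[]" p] hbase by simp
  next
    case (Cons c cs)
    let ?y = "ch cB b cs" and ?n = "sz b + length cs * 4 + 4"
    let ?x = "rot c (?y \<frown> cB)"
    have c: "c = 1 \<or> c = 3" "valid cs" using Cons.prems by auto
    have oky: "ok ?y" "ok ?x" and szx: "sz ?x = ?n" using b by auto
    have "K (rot (4 + j) (?x \<frown> cB) \<frown> cB)" if j: "0 < j" "j < ?n" for j
    proof -
      have I: "rot (4 + j) (?x \<frown> cB) \<frown> cB = rot (4 + j) (rot (?n + 4 - j) (rot (c + j) (?y \<frown> cB) \<frown> cB) \<frown> cB)"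
        using cat_rot_cat2[of ?x cB cB j] oky szx j by (simp add: rot_rot)
      define p' where "p' = (c + j) mod ?n"
      have p': "rot (c + j) (?y \<frown> cB) = rot p' (?y \<frown> cB)"
        using rot_mod[of "c + j" "?y \<frown> cB"] by (simp add: p'_def)
      show ?thesis
      proof (cases "p' = 1 \<or> p' = 3")
        case False
        then have "K (rot p' (?y \<frown> cB) \<frown> cB)" using Cons.IH[of p'] c by (simp add: p'_def)
        then show ?thesis using I p' K_rot K_B by metis
      next
        case True
        have "c + j < ?n + ?n" using c j by auto
        then have p'2: "p' = (if c + j < ?n then c + j else c + j - ?n)" unfolding p'_def by (rule mod2)
        \<comment> \<open>Equality of \<open>p'\<close> and \<open>c\<close> would need
          \<open>j = 0\<close> or \<open>j = ?n\<close>, so the two insertions use different gaps of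
          the same \<open>cB\<close>.\<close>
        have alt: "(c = 1 \<and> j = 2 \<and> p' = 3) \<or> (c = 3 \<and> j = ?n - 2 \<and> p' = 1)"
          using True c j p'2 by (auto split: if_splits)
        have inner: "rot p' (?y \<frown> cB) \<frown> cB = rot p' (?y \<frown> rot (8 - p') (cA \<frown> cB))"
          using cat_rot_cat[of ?y cB cB p'] oky True by (auto simp: rot_cB)
        \<comment> \<open>The value of \<open>p' + (?n + 4 - j)\<close> modulo \<open>?n + 4\<close>
          in the two cases of \<open>alt\<close>.\<close>
        define q where "q = (if c = 1 then 1 else 7 :: nat)"
        let ?Y = "rot (8 - p') (cA \<frown> cB)"
        have "rot (?n + 4 - j) (rot p' (?y \<frown> ?Y)) = rot q (?y \<frown> ?Y)"
        proof -
          have "p' + (?n + 4 - j) = q + (?n + 4) \<or> p' + (?n + 4 - j) = q"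
            using alt j by (auto simp: q_def)
          then have e: "(p' + (?n + 4 - j)) mod (?n + 4) = q mod (?n + 4)" by (metis mod_add_self2)
          show ?thesis unfolding rot_rot
            by (rule rot_cong[OF _ _ e]) (use oky in simp_all)
        qed
        then have "rot (4 + j) (?x \<frown> cB) \<frown> cB = rot (4 + j) (rot q (?y \<frown> ?Y) \<frown> cB)"
          using I p' inner by simp
        also have "rot q (?y \<frown> ?Y) \<frown> cB = rot q (?y \<frown> rot (12 - q) (rot q ?Y \<frown> cB))"
          using cat_rot_cat[of ?y ?Y cB q] oky by (auto simp: q_def)
        also have "rot q ?Y = rot 6 (cA \<frown> cB)"
        proof -
          have "rot 14 (cA \<frown> cB) = rot 6 (cA \<frown> cB)" by (rule rot_cong[of _ 8]) auto
          then show ?thesis using alt by (auto simp: q_def rot_rot)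
        qed
        finally show ?thesis using hST[OF c(2)] K_rot by (simp flip: ST_def)
      qed
    qed
    then show ?case using gen[of ?x "c # cs" p] Cons.prems szx by simp
  }
qed

section \<open>Walks\<close>

definition reach :: "conf \<Rightarrow> conf \<Rightarrow> bool" where "reach = adj\<^sup>*\<^sup>*"

text \<open>In a concatenation both parts move at every step, so the reachable pairs are governed by the
  parity of walk lengths.\<close>

definition ev :: "conf \<Rightarrow> conf \<Rightarrow> bool" where "ev = (adj OO adj)\<^sup>*\<^sup>*"
definition od :: "conf \<Rightarrow> conf \<Rightarrow> bool" where "od x y \<longleftrightarrow> (\<exists>z. adj x z \<and> ev z y)"

lemma ev_refl [simp]: "ev x x" by (simp add: ev_def)
lemma ev_trans: "ev x y \<Longrightarrow> ev y z \<Longrightarrow> ev x z" unfolding ev_def by (rule rtranclp_trans)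
lemma ev_2: "adj x y \<Longrightarrow> adj y z \<Longrightarrow> ev x z" unfolding ev_def by blast
lemma od_1: "adj x y \<Longrightarrow> od x y" unfolding od_def using ev_refl by blast
lemma adj_ev: "adj x y \<Longrightarrow> ev y z \<Longrightarrow> od x z" unfolding od_def by blast
lemma adj_od: "adj x y \<Longrightarrow> od y z \<Longrightarrow> ev x z" unfolding od_def using ev_2 ev_trans by blast
lemma ev_adj: "ev x y \<Longrightarrow> adj y z \<Longrightarrow> od x z"
  unfolding ev_def
proof (induction rule: converse_rtranclp_induct)
  case base then show ?case by (rule od_1)
next
  case (step x w)
  then obtain v where "adj x v" "adj v w" by blast
  then show ?case using step adj_od adj_ev by blast
qed

lemma od_adj: "od x y \<Longrightarrow> adj y z \<Longrightarrow> ev x z"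
  unfolding od_def[of x y] using ev_adj adj_od by blast

lemma od_od: "od x y \<Longrightarrow> od y z \<Longrightarrow> ev x z"
  unfolding od_def[of y z] using od_adj ev_trans by blast

lemma ev_sym: "ev x y \<Longrightarrow> ev y x"
  unfolding ev_def
proof (induction rule: rtranclp_induct)
  case (step y z)
  then have "ev z y" using adj_sym ev_2 by blast
  then show ?case using step by (metis ev_def rtranclp_trans)
qed simp

lemma od_sym: "od x y \<Longrightarrow> od y x"
  unfolding od_def[of x y] using ev_sym ev_adj adj_sym by blast

lemma reach_refl [simp]: "reach x x" by (simp add: reach_def)
lemma reach_trans: "reach x y \<Longrightarrow> reach y z \<Longrightarrow> reach x z" unfolding reach_def by (rule rtranclp_trans)
lemma adj_reach: "adj x y \<Longrightarrow> reach x y" unfolding reach_def by (rule r_into_rtranclp)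

lemma ev_reach: "ev x y \<Longrightarrow> reach x y"
  unfolding ev_def
proof (induction rule: rtranclp_induct)
  case (step y z) then show ?case using adj_reach reach_trans by blast
qed simp

lemma od_reach: "od x y \<Longrightarrow> reach x y"
  unfolding od_def using adj_reach ev_reach reach_trans by blast

lemma reach_cases: "reach x y \<Longrightarrow> ev x y \<or> od x y"
  unfolding reach_def
proof (induction rule: rtranclp_induct)
  case (step y z) then show ?case using ev_adj od_adj by blast
qed simp

lemma reach_sym: "reach x y \<Longrightarrow> reach y x"
  using reach_cases ev_sym od_sym ev_reach od_reach by blast

lemma ev_rot: "ev x y \<Longrightarrow> ev (rot p x) (rot p y)"
  unfolding ev_def
proof (induction rule: rtranclp_induct)
  case (step y z)
  then have "ev (rot p y) (rot p z)" using adj_rot ev_2 by blast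
  then show ?case using step by (metis ev_def rtranclp_trans)
qed simp

lemma od_rot: "od x y \<Longrightarrow> od (rot p x) (rot p y)"
  unfolding od_def using adj_rot ev_rot by blast

lemma reach_rot: "reach x y \<Longrightarrow> reach (rot p x) (rot p y)"
  using reach_cases ev_rot od_rot ev_reach od_reach by blast

lemma ev_cat_left: "ev x y \<Longrightarrow> adj t t' \<Longrightarrow> ev (x \<frown> t) (y \<frown> t)"
  unfolding ev_def
proof (induction rule: rtranclp_induct)
  case (step y z)
  then obtain v where "adj y v" "adj v z" by blast
  then have "ev (y \<frown> t) (z \<frown> t)" using adj_cat adj_sym step.prems ev_2 by meson
  then show ?case using step by (metis ev_def rtranclp_trans)
qed simp

lemma ev_cat_right: "ev x y \<Longrightarrow> adj t t' \<Longrightarrow> ev (t \<frown> x) (t \<frown> y)"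
  unfolding ev_def
proof (induction rule: rtranclp_induct)
  case (step y z)
  then obtain v where "adj y v" "adj v z" by blast
  then have "ev (t \<frown> y) (t \<frown> z)" using adj_cat adj_sym step.prems ev_2 by meson
  then show ?case using step by (metis ev_def rtranclp_trans)
qed simp

lemma od_cat_left: "od x y \<Longrightarrow> adj t t' \<Longrightarrow> od (x \<frown> t) (y \<frown> t')"
  unfolding od_def[of x y] using adj_cat adj_ev adj_sym ev_cat_left by meson

lemma ev_ok: "ev x y \<Longrightarrow> ok x \<Longrightarrow> ok y \<and> sz y = sz x"
  unfolding ev_def
proof (induction rule: rtranclp_induct)
  case (step y z)
  then obtain v where "adj y v" "adj v z" by blast
  then have "ok z" "sz z = sz y" using adj_ok(2) adj_sz[of y v] adj_sz[of v z] by auto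
  then show ?case using step by simp
qed simp

lemma od_ok: "od x y \<Longrightarrow> ok x \<and> ok y \<and> sz y = sz x"
proof -
  assume "od x y"
  then obtain z where z: "adj x z" "ev z y" unfolding od_def by blast
  then show ?thesis using adj_ok[OF z(1)] adj_sz[OF z(1)] ev_ok[OF z(2)] by simp
qed

lemma reach_ok: "reach x y \<Longrightarrow> ok x \<Longrightarrow> ok y \<and> sz y = sz x"
  using reach_cases ev_ok od_ok by blast

text \<open>While one part walks, the other goes back and forth along some edge; this is why both
  parts must have a neighbour.\<close>

lemma ev_cat: "ev x x' \<Longrightarrow> ev y y' \<Longrightarrow> adj x v \<Longrightarrow> adj y w \<Longrightarrow> ev (x \<frown> y) (x' \<frown> y')"
proof -
  assume a: "ev x x'" "ev y y'" "adj x v" "adj y w"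
  have "od v x'" by (rule adj_ev[OF adj_sym[OF a(3)] a(1)])
  then obtain v' where "adj x' v'" using od_sym unfolding od_def by blast
  then show ?thesis using ev_cat_left[OF a(1,4)] ev_cat_right[OF a(2)] ev_trans by blast
qed

lemma od_od_cat: "od x x' \<Longrightarrow> od y y' \<Longrightarrow> od (x \<frown> y) (x' \<frown> y')"
  unfolding od_def[of x x'] od_def[of y y'] using ev_cat adj_cat adj_ev adj_sym by meson

lemma reach_cat_AB:
  assumes "reach x y" "t = cA \<or> t = cB"
  shows "\<exists>t'. (t' = cA \<or> t' = cB) \<and> reach (x \<frown> t) (y \<frown> t')"
proof -
  obtain t' where t': "t' = cA \<or> t' = cB" "adj t t'" using ex_adj_AB[OF assms(2)] by blast
  from reach_cases[OF assms(1)] show ?thesis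
  proof
    assume "ev x y"
    then have "reach (x \<frown> t) (y \<frown> t)" by (intro ev_reach ev_cat_left[OF _ t'(2)])
    with assms(2) show ?thesis by (intro exI conjI)
  next
    assume "od x y"
    then have "reach (x \<frown> t) (y \<frown> t')" by (intro od_reach od_cat_left[OF _ t'(2)])
    with t'(1) show ?thesis by (intro exI conjI)
  qed
qed

section \<open>Configurations containing an octagon\<close>

text \<open>Closure under moves makes this a property of whole components; closure under rotation
  and attachment lets quadrangles be inserted anywhere.\<close>

inductive oct :: "conf \<Rightarrow> bool" where
  oct_R0: "oct R0"
| oct_rot: "oct x \<Longrightarrow> oct (rot p x)"
| oct_adj: "oct x \<Longrightarrow> adj x y \<Longrightarrow> oct y"
| oct_A: "oct x \<Longrightarrow> oct (x \<frown> cA)"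
| oct_B: "oct x \<Longrightarrow> oct (x \<frown> cB)"

lemma oct_ok: "oct x \<Longrightarrow> ok x \<and> 4 dvd sz x \<and> 8 \<le> sz x"
  by (induction rule: oct.induct) (auto dest: adj_ok adj_sz)

lemma oct_unrot: "oct (rot p x) \<Longrightarrow> bd x \<Longrightarrow> oct x"
  by (metis oct_rot rot_back)

text \<open>By \<open>decomp\<close>, \<open>y\<close> is emptied quadrangle by quadrangle, and
  \<open>rot_cat_rot\<close> performs each removal inside \<open>x \<frown> y\<close>.\<close>

lemma oct_cat_right: "oct x \<Longrightarrow> ok y \<Longrightarrow> 4 dvd sz y \<Longrightarrow> oct (x \<frown> y)"
proof (induction "sz y" arbitrary: y rule: less_induct)
  case less
  show ?case
  proof (cases "sz y = 0")
    case True
    then have "y = Conf 0 {}" using ok_0 less.prems by blast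
    then have "x \<frown> y = x" by (intro conf_eqI) (simp_all add: cat_def img_def)
    then show ?thesis using less.prems by simp
  next
    case False
    then have "4 \<le> sz y" using less.prems(3) by (auto dest: dvd_imp_le)
    then obtain w t r where w: "ok w" "t = cA \<or> t = cB" "r \<le> sz w" "w \<frown> t = rot r y"
      using decomp[OF less.prems(2)] by blast
    have t: "ok t" "sz t = 4" using w(2) by auto
    have "sz y = sz w + 4" using arg_cong[OF w(4), of sz] t by simp
    then have s: "sz w < sz y" "4 dvd sz w" using less.prems(3) by (auto simp: dvd_add_left_iff)
    have okx: "ok x" using less.prems oct_ok by blast
    have eq: "rot r (x \<frown> y) = rot r (x \<frown> rot (sz w - r) w) \<frown> t"
      using rot_cat_rot[OF _ _ _ _ w(4,3)] okx less.prems w(1) t by simp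
    have "oct (x \<frown> rot (sz w - r) w)" using less.hyps[of "rot (sz w - r) w"] s w less.prems by simp
    then have "oct (rot r (x \<frown> rot (sz w - r) w) \<frown> t)" using w(2) oct_rot oct_A oct_B by blast
    then show ?thesis using oct_unrot[of r "x \<frown> y"] eq okx less.prems by simp
  qed
qed

lemma oct_cat_left: "oct y \<Longrightarrow> ok x \<Longrightarrow> 4 dvd sz x \<Longrightarrow> oct (x \<frown> y)"
  using oct_cat_right[of y x] oct_ok[of y] oct_rot cat_swap[of y x] by simp

lemma oct_BB: "oct BB" using oct_R0 adj_R0_BB oct_adj by blast

text \<open>Six boundary edges in a row are regrouped: instead of an octagon and a quadrangle, two
  hexagons may flip.\<close>

lemma cat_R0_cA: "R0 \<frown> cA = T0 \<frown> T0"
  by (simp add: R0_def T0_def cA_def cat_assoc)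

lemmas edges_simps = cat_def rot_def edges_leaf edges_cA edges_cB edges_T0 edges_T1 edges_R0 edges_R1
  edges_BB in_img_doubleton

lemma edges_ST: "edges ST = {{6, 7}, {0, 1}, {2, 5}, {3, 4}, {8, 11}, {9, 10}}"
  by (simp add: ST_def edges_simps del: One_nat_def) (simp add: set_eq_subset doubleton_eq_iff)

lemma edges_T1T1: "edges (rot 1 (T1 \<frown> T1)) = {{1, 6}, {2, 3}, {4, 5}, {0, 7}, {8, 9}, {10, 11}}"
  by (simp add: edges_simps del: One_nat_def) (simp add: set_eq_subset doubleton_eq_iff)

lemma sz_ST [simp]: "sz ST = 12" by (simp add: ST_def)
lemma ok_ST [simp]: "ok ST" by (simp add: ST_def)

text \<open>After the rotation, the long edges of the two copies of \<open>T1\<close> span the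
  quadrangle 0, 1, 6, 7, which flips together with the quadrangles 2 to 5 and 8 to 11.\<close>

lemma adj_ST: "adj (rot 1 (T1 \<frown> T1)) ST"
proof -
  have "compat (edges (rot 1 (T1 \<frown> T1))) (edges ST)" "edges (rot 1 (T1 \<frown> T1)) \<inter> edges ST = {}"
    unfolding edges_ST edges_T1T1 by (simp_all add: compat_def crosses_iff doubleton_eq_iff)
  then show ?thesis by (simp add: adj_def)
qed

lemma oct_ST: "oct ST"
proof -
  have "oct (T0 \<frown> T0)" using oct_A[OF oct_R0] by (simp add: cat_R0_cA)
  then have "oct (T1 \<frown> T1)" using adj_cat[OF adj_T01 adj_T01] oct_adj by blast
  then show ?thesis using oct_rot adj_ST oct_adj by blast
qed

text \<open>The single quadrangles are listed apart because the general form keeps a last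
  \<open>cB\<close> visible and hence has at least two quadrangles.\<close>

definition small_conf :: "conf \<Rightarrow> bool" where
  "small_conf x \<longleftrightarrow> x = cA \<or> x = cB \<or> (\<exists>p cs. valid cs \<and> x = rot p (ch cB cA cs \<frown> cB))"

lemma deg_1: "adj x y \<Longrightarrow> deg x = 1 \<Longrightarrow> adj x z \<Longrightarrow> z = y"
  unfolding deg_def by (metis card_1_singletonE mem_Collect_eq singletonD)

lemma deg_cA: "deg cA = 1" and deg_cB: "deg cB = 1"
proof -
  have "{d. adj cA d} = {cB}" "{d. adj cB d} = {cA}" using adj_4 adj_AB adj_BA by blast+
  then show "deg cA = 1" "deg cB = 1" by (simp_all add: deg_def)
qed

text \<open>The only move of a chain of \<open>cB\<close> over \<open>cA\<close> leads to a chain of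
  \<open>cA\<close> over \<open>cB\<close>, which by \<open>ch_reverse\<close> is a chain of the
  first kind read from its other end.\<close>

lemma small_conf_adj:
  assumes "small_conf x" "adj x y" shows "small_conf y"
proof -
  have "small_conf y" if x: "valid cs" "x = rot p (ch cB cA cs \<frown> cB)" for p cs
  proof -
    have d: "deg x = 1" using x deg_cA by simp
    have "adj (ch cB cA cs \<frown> cB) (ch cA cB cs \<frown> cA)" by (intro adj_cat adj_ch adj_AB adj_BA)
    then have "adj x (rot p (ch cA cB cs \<frown> cA))" using x adj_rot by blast
    then have y: "y = rot p (ch cA cB cs \<frown> cA)" using deg_1 d assms(2) by blast
    obtain q where "ch cA cB cs \<frown> cA = rot q (cB \<frown> ch cB cA (rv cs))"
      using ch_reverse[of cA cs cB] x(1) by (auto simp: rot_cA)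
    also have "cB \<frown> ch cB cA (rv cs) = rot 4 (ch cB cA (rv cs) \<frown> cB)" by (subst cat_swap) auto
    finally have "y = rot (4 + q + p) (ch cB cA (rv cs) \<frown> cB)" using y by (simp add: rot_rot)
    then show ?thesis unfolding small_conf_def using x(1) valid_rv by blast
  qed
  moreover have "small_conf y" if "x = cA \<or> x = cB" using that assms(2) adj_4 unfolding small_conf_def by blast
  ultimately show ?thesis using assms(1) unfolding small_conf_def[of x] by blast
qed

lemma small_conf_deg: "small_conf x \<Longrightarrow> deg x = 1"
  unfolding small_conf_def using deg_cA deg_cB by auto

lemma small_conf_ok: "small_conf x \<Longrightarrow> ok x"
  unfolding small_conf_def by auto

lemma small_conf_rot: "small_conf x \<Longrightarrow> small_conf (rot p x)"
proof -
  assume "small_conf x"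
  then consider "x = cA \<or> x = cB" | q cs where "valid cs" "x = rot q (ch cB cA cs \<frown> cB)"
    unfolding small_conf_def by blast
  then show ?thesis
  proof cases
    case 1
    then have "rot p x = cA \<or> rot p x = cB" by (auto simp: rot_cA rot_cB)
    then show ?thesis unfolding small_conf_def by blast
  next
    case 2
    then have "rot p x = rot (q + p) (ch cB cA cs \<frown> cB)" by (simp add: rot_rot)
    then show ?thesis using 2(1) unfolding small_conf_def by blast
  qed
qed

lemma small_conf_insert_B: assumes "small_conf x" shows "small_conf (x \<frown> cB) \<or> oct (x \<frown> cB)"
proof -
  have 1: "small_conf (cA \<frown> cB)" unfolding small_conf_def
    by (intro disjI2 exI[of _ 0] exI[of _ "[]"]) simp
  have "small_conf (x \<frown> cB) \<or> oct (x \<frown> cB)" if x: "valid cs" "x = rot p (ch cB cA cs \<frown> cB)" for p cs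
  proof -
    let ?n = "4 + length cs * 4 + 4"
    define q where "q = p mod ?n"
    have xq: "x = rot q (ch cB cA cs \<frown> cB)"
      using rot_mod[of p "ch cB cA cs \<frown> cB"] x(2) by (simp add: q_def)
    show ?thesis
    proof (cases "q = 1 \<or> q = 3")
      case True
      then have "valid (q # cs)" "x \<frown> cB = rot 0 (ch cB cA (q # cs) \<frown> cB)" using xq x(1) by auto
      then show ?thesis unfolding small_conf_def by blast
    next
      case False
      have "oct (rot q (ch cB cA cs \<frown> cB) \<frown> cB)"
      proof (rule chain_insert[where K = oct])
        fix j :: nat assume j: "0 < j" "j < sz cA"
        \<comment> \<open>For \<open>j = 2\<close> the new \<open>cB\<close> lies between the two
          edges of \<open>cA\<close>, on the side opposite to the old one. An odd \<open>j\<close>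
          means a gap under an edge of \<open>cA\<close>, where the quadrangle reads as
          \<open>cB\<close>.\<close>
        then consider "j = 2" | "j = 1 \<or> j = 3" by fastforce
        then show "oct (rot (4 + j) (cA \<frown> cB) \<frown> cB)"
        proof cases
          case 1 then show ?thesis using oct_ST by (simp add: ST_def)
        next
          case 2
          then have "rot (4 + j) (cA \<frown> cB) \<frown> cB = rot (4 + j) (rot (8 - j) BB \<frown> cB)"
            using cat_rot_cat2[of cA cB cB j] j by (auto simp: rot_cA BB_def)
          then show ?thesis using oct_BB oct_rot oct_B by metis
        qed
      next
        fix cs p assume "valid cs"
        show "oct (ch cB cA cs \<frown> rot p BB)" "oct (ch cB cA cs \<frown> rot p ST)"
          by (intro oct_cat_left oct_rot oct_BB oct_ST; simp)+
      qed (use False x(1) in \<open>auto intro: oct_rot oct_B simp: q_def\<close>)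
      then show ?thesis using xq by simp
    qed
  qed
  moreover have "oct (cB \<frown> cB)" using oct_BB by (simp add: BB_def)
  ultimately show ?thesis using assms 1 unfolding small_conf_def[of x] by blast
qed

lemma small_conf_or_oct: "ok x \<Longrightarrow> 4 dvd sz x \<Longrightarrow> sz x > 0 \<Longrightarrow> small_conf x \<or> oct x"
proof (induction "sz x" arbitrary: x rule: less_induct)
  case less
  then have "4 \<le> sz x" by (auto dest: dvd_imp_le)
  then obtain w t r where w: "ok w" "t = cA \<or> t = cB" "w \<frown> t = rot r x"
    using decomp[OF less.prems(1)] by blast
  have t: "ok t" "sz t = 4" using w(2) by auto
  have s: "sz x = sz w + 4" using arg_cong[OF w(3), of sz] t by simp
  obtain q where q: "x = rot q (w \<frown> t)" using w(3) rot_back less.prems(1) by (metis ok_bd)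
  have "small_conf (w \<frown> t) \<or> oct (w \<frown> t)"
  proof (cases "sz w = 0")
    case True
    then have "sz (w \<frown> t) = 4" "ok (w \<frown> t)" using w(1) t by auto
    then show ?thesis using ok_4 unfolding small_conf_def by blast
  next
    case False
    then have IH: "small_conf w \<or> oct w" using less.hyps[of w] w(1) s less.prems(2) by (auto simp: dvd_add_left_iff)
    have "4 dvd sz w" using s less.prems(2) by (auto simp: dvd_add_left_iff)
    then obtain w' where w': "adj w w'" using ex_adj w(1) by blast
    show ?thesis
    proof (cases "oct w")
      case True
      then show ?thesis using w(2) oct_A oct_B by blast
    next
      case False
      then have Sw: "small_conf w" using IH by blast
      then have "small_conf w'" using small_conf_adj w' by blast
      \<comment> \<open>An attached \<open>cA\<close> is treated through the neighbour
        \<open>w' \<frown> cB\<close>, since both properties are invariant under moves.\<close>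
      then have "small_conf (w' \<frown> cB) \<or> oct (w' \<frown> cB)" by (rule small_conf_insert_B)
      moreover have "adj (w' \<frown> cB) (w \<frown> cA)" using adj_cat adj_sym w' adj_BA by blast
      ultimately have "small_conf (w \<frown> cA) \<or> oct (w \<frown> cA)" using small_conf_adj oct_adj by blast
      then show ?thesis using w(2) small_conf_insert_B[OF Sw] by blast
    qed
  qed
  then show ?case using q small_conf_rot oct_rot by blast
qed

section \<open>Splitting\<close>

text \<open>A closure of the same kind as \<open>oct\<close>; that an actual concatenation of two
  \<open>oct\<close> parts can be reached again is shown in \<open>split_decomp\<close>.\<close>

inductive split :: "conf \<Rightarrow> bool" where
  split_cat: "oct x \<Longrightarrow> oct y \<Longrightarrow> split (x \<frown> y)"
| split_rot: "split x \<Longrightarrow> split (rot p x)"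
| split_adj: "split x \<Longrightarrow> adj x y \<Longrightarrow> split y"
| split_A: "split x \<Longrightarrow> split (x \<frown> cA)"
| split_B: "split x \<Longrightarrow> split (x \<frown> cB)"

lemma split_reach: "reach x y \<Longrightarrow> split x \<Longrightarrow> split y"
  unfolding reach_def by (induction rule: rtranclp_induct) (auto intro: split_adj)

text \<open>\<open>L5\<close> and \<open>L6\<close> are boundary matchings of the 10-gon and the
  12-gon.\<close>

definition L5 :: conf where "L5 = R0 \<frown> leaf"
definition L6 :: conf where "L6 = T0 \<frown> T0"

lemma sz_L [simp]: "sz L5 = 10" "sz L6 = 12" by (simp_all add: L5_def L6_def)
lemma ok_L [simp]: "ok L5" "ok L6" by (simp_all add: L5_def L6_def)

lemma L6_L5: "L6 = L5 \<frown> leaf"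
  by (simp add: L6_def L5_def R0_def T0_def cA_def cat_assoc)

lemma edges_L5: "edges L5 = {{0, 1}, {2, 3}, {4, 5}, {6, 7}, {8, 9}}"
  by (simp add: L5_def edges_simps del: One_nat_def) (simp add: set_eq_subset doubleton_eq_iff)
lemma edges_L5': "edges (rot 1 L5) = {{1, 2}, {3, 4}, {5, 6}, {7, 8}, {0, 9}}"
  by (simp add: rot_def edges_L5 in_img_doubleton del: One_nat_def) (simp add: set_eq_subset doubleton_eq_iff)
lemma edges_L6: "edges L6 = {{0, 1}, {2, 3}, {4, 5}, {6, 7}, {8, 9}, {10, 11}}"
  by (simp add: L6_def edges_simps del: One_nat_def) (simp add: set_eq_subset doubleton_eq_iff)
lemma edges_L6': "edges (rot 1 L6) = {{1, 2}, {3, 4}, {5, 6}, {7, 8}, {9, 10}, {0, 11}}"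
  by (simp add: rot_def edges_L6 in_img_doubleton del: One_nat_def) (simp add: set_eq_subset doubleton_eq_iff)

lemma adj_L5: "adj L5 (rot 1 L5)"
proof -
  have "compat (edges L5) (edges (rot 1 L5))" "edges L5 \<inter> edges (rot 1 L5) = {}"
    unfolding edges_L5 edges_L5' by (simp_all add: compat_def crosses_iff doubleton_eq_iff)
  then show ?thesis by (simp add: adj_def)
qed

lemma adj_L6: "adj L6 (rot 1 L6)"
proof -
  have "compat (edges L6) (edges (rot 1 L6))" "edges L6 \<inter> edges (rot 1 L6) = {}"
    unfolding edges_L6 edges_L6' by (simp_all add: compat_def crosses_iff doubleton_eq_iff)
  then show ?thesis by (simp add: adj_def)
qed

lemma oct_R1: "oct R1" using oct_rot[OF oct_R0, of 1] by (simp add: R1_def)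

text \<open>After one move of both parts, the spanning edge of \<open>rot 1 L5\<close> and the three
  edges of \<open>T0\<close> form an octagon, and the other four edges of the 10-gon form a second
  one.\<close>

lemma split_L5_T1: "split (L5 \<frown> T1)"
proof -
  have "rot 1 L5 \<frown> T0 = rot 1 (R0 \<frown> rot 7 (leaf \<frown> T0))"
    using cat_rot_cat[of R0 leaf T0 1] by (simp add: L5_def)
  also have "leaf \<frown> T0 = R0" by (simp add: R0_def T0_def cA_def cat_assoc)
  finally have "split (rot 1 L5 \<frown> T0)" using split_cat[OF oct_R0 oct_R1] split_rot by (simp add: rot_R0)
  moreover have "adj (rot 1 L5 \<frown> T0) (L5 \<frown> T1)" using adj_cat adj_sym adj_L5 adj_T01 by blast
  ultimately show ?thesis using split_adj by blast
qed

text \<open>Two of the four matchings regroup into forms already known to split; one move from each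
  of them covers the other two.\<close>

lemma split_L6:
  assumes "y = L6 \<or> y = rot 1 L6" "t = cA \<or> t = cB" shows "split (y \<frown> t)"
proof -
  have 1: "split (rot 1 L6 \<frown> cA)"
    using split_rot[OF split_L5_T1, of 1] cap_cat_A[of L5] by (simp add: cap_def flip: L6_L5)
  have "adj (rot 1 L6 \<frown> cA) (L6 \<frown> cB)" using adj_cat adj_sym adj_L6 adj_AB by blast
  then have 2: "split (L6 \<frown> cB)" using 1 split_adj by blast
  have "L6 \<frown> cA = R0 \<frown> R0" by (simp add: L6_def R0_def T0_def cA_def cat_assoc)
  then have 3: "split (L6 \<frown> cA)" using split_cat oct_R0 by simp
  have "adj (L6 \<frown> cA) (rot 1 L6 \<frown> cB)" using adj_cat adj_L6 adj_AB by blast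
  then have "split (rot 1 L6 \<frown> cB)" using 3 split_adj by blast
  then show ?thesis using 1 2 3 assms by blast
qed

lemma rot_2_L6: "rot 2 L6 = L6"
proof -
  have "leaf \<frown> L5 = L6" by (simp add: L6_def L5_def R0_def T0_def cA_def cat_assoc)
  then show ?thesis using cat_swap[of L5 leaf] by (simp add: L6_L5)
qed

lemma rot_L6: "rot p L6 = (if even p then L6 else rot 1 L6)"
  by (rule rot_parity[OF rot_2_L6]) simp

lemma reach_L6_ev:
  assumes "reach L6 y" shows "ev L6 y \<or> ev (rot 1 L6) y"
  using reach_cases[OF assms] adj_od adj_sym[OF adj_L6] by blast

text \<open>The only rotations of \<open>L6\<close> are \<open>L6\<close> and its neighbour
  \<open>rot 1 L6\<close>. Hence wherever the quadrangle is inserted, an even walk of the 12-gon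
  part leads back to \<open>split_L6\<close>.\<close>

lemma split_insert_L6:
  assumes "reach L6 y" "t = cA \<or> t = cB" shows "split (rot p y \<frown> t)"
proof -
  obtain z where z: "z = L6 \<or> z = rot 1 L6" "ev z y" using reach_L6_ev[OF assms(1)] by blast
  have "rot p z = L6 \<or> rot p z = rot 1 L6"
    using z(1) rot_L6[of p] rot_L6[of "1 + p"] rot_rot[of p 1 L6] by metis
  then have "split (rot p z \<frown> t)" using split_L6 assms(2) by blast
  moreover have "ev (rot p z \<frown> t) (rot p y \<frown> t)"
    using ex_adj_AB[OF assms(2)] ev_cat_left ev_rot[OF z(2)] by blast
  ultimately show ?thesis using ev_reach split_reach by blast
qed

text \<open>Two \<open>cB\<close> inserted at distance 2 around the octagon. The walk has two moves;
  the equations between them regroup the same edges so that hexagons become visible.\<close>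

lemma split_X2: "split (rot 6 (R0 \<frown> cB) \<frown> cB)"
proof -
  have 1: "adj (rot 6 (R0 \<frown> cB) \<frown> cB) (rot 6 (rot 2 BB \<frown> cA) \<frown> cA)"
    by (intro adj_cat adj_rot adj_BA adj_R0_rot_BB)
  have "rot 6 (rot 2 BB \<frown> cA) \<frown> cA = rot 1 (T1 \<frown> rot 1 (cB \<frown> T0))"
    by (rule conf_eqI, simp, simp add: edges_simps del: One_nat_def) (simp add: set_eq_subset doubleton_eq_iff)
  moreover have "adj (rot 1 (T1 \<frown> rot 1 (cB \<frown> T0))) (rot 1 (T0 \<frown> rot 1 (cA \<frown> T1)))"
    by (intro adj_cat adj_rot adj_T01 adj_T10 adj_BA)
  moreover have "rot 1 (T0 \<frown> rot 1 (cA \<frown> T1)) = rot 13 (L5 \<frown> T1)"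
    by (rule conf_eqI, simp, simp add: edges_simps edges_L5 del: One_nat_def) (simp add: set_eq_subset doubleton_eq_iff)
  ultimately show ?thesis using 1 split_rot[OF split_L5_T1, of 13] split_adj adj_sym by metis
qed

text \<open>Two \<open>cB\<close> inserted at opposite gaps of the octagon, again with a walk of two
  moves that ends in two octagons.\<close>

lemma split_X4: "split (rot 8 (R0 \<frown> cB) \<frown> cB)"
proof -
  have 1: "adj (rot 8 (R0 \<frown> cB) \<frown> cB) (rot 8 (R1 \<frown> cA) \<frown> cA)"
    by (intro adj_cat adj_rot adj_BA adj_R01)
  have "rot 8 (R1 \<frown> cA) \<frown> cA = rot 11 (T1 \<frown> rot 2 (T1 \<frown> cA))"
    by (rule conf_eqI, simp, simp add: edges_simps del: One_nat_def) (simp add: set_eq_subset doubleton_eq_iff)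
  moreover have "adj (rot 11 (T1 \<frown> rot 2 (T1 \<frown> cA))) (rot 11 (T0 \<frown> rot 2 (T0 \<frown> cB)))"
    by (intro adj_cat adj_rot adj_T10 adj_AB)
  moreover have "rot 11 (T0 \<frown> rot 2 (T0 \<frown> cB)) = rot 2 (R1 \<frown> R1)"
    by (rule conf_eqI, simp, simp add: edges_simps del: One_nat_def) (simp add: set_eq_subset doubleton_eq_iff)
  ultimately show ?thesis using 1 split_rot[OF split_cat[OF oct_R1 oct_R1], of 2] split_adj adj_sym by metis
qed

lemma split_R0_base: assumes "0 < j" "j < 8" shows "split (rot (4 + j) (R0 \<frown> cB) \<frown> cB)"
proof (cases "even j")
  case False
  \<comment> \<open>An odd gap lies under an edge of the ring, which from there reads as
    \<open>R1\<close>; and \<open>R1 \<frown> cB\<close> is a neighbour of the 12-gon ring.\<close>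
  have eq: "rot (4 + j) (R0 \<frown> cB) \<frown> cB = rot (4 + j) (rot (12 - j) (R1 \<frown> cB) \<frown> cB)"
    using cat_rot_cat2[of R0 cB cB j] assms False by (simp add: rot_R0)
  have "adj L6 (R1 \<frown> cB)" using adj_cat[OF adj_R01 adj_AB] cat_R0_cA by (simp add: L6_def)
  then have "split (rot (12 - j) (R1 \<frown> cB) \<frown> cB)" by (intro split_insert_L6 adj_reach) auto
  then show ?thesis using eq split_rot by simp
next
  case True
  then have "j = 2 \<or> j = 4 \<or> j = 6" using assms by presburger
  \<comment> \<open>Distance 6 around the octagon is distance 2 with the two \<open>cB\<close>
    exchanged.\<close>
  moreover have "rot 10 (R0 \<frown> cB) \<frown> cB = rot 10 (rot 6 (R0 \<frown> cB) \<frown> cB)"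
    using cat_rot_cat2[of R0 cB cB 6] by (simp add: rot_R0)
  ultimately show ?thesis using split_X2 split_X4 split_rot[OF split_X2, of 10] by auto
qed

section \<open>Medium components\<close>

text \<open>The last quadrangle of an arm at \<open>x\<close> can be appended to \<open>x\<close>
  instead, which leaves a shorter arm; all inductions along arms use this step.\<close>

lemma arm_unfold:
  assumes "t = cA \<or> t = cB" "c = 1 \<or> c = 3" "bd x" "bd b" "bd t"
  shows "rot (4 - c) (x \<frown> rot 1 t) \<frown> b = rot (4 - c) (x \<frown> rot c (b \<frown> t))"
proof -
  have t: "sz t = 4" "ok t" using assms by auto
  have r: "rot (4 - c) (rot 1 t) = t" using assms(1,2) by (auto simp: rot_cA rot_cB)
  have "rot (4 - c) (x \<frown> rot 1 t) \<frown> b = rot (4 - c) (x \<frown> rot (4 + sz b - (4 - c)) (t \<frown> b))"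
    using cat_rot_cat[of x "rot 1 t" b "4 - c"] assms t r by simp
  also have "t \<frown> b = rot 4 (b \<frown> t)" using cat_swap[of b t] assms t by simp
  also have "rot (4 + sz b - (4 - c)) (rot 4 (b \<frown> t)) = rot c (b \<frown> t)"
  proof -
    have e: "4 + (4 + sz b - (4 - c)) = c + (sz b + 4)" using assms(2) by auto
    show ?thesis
      unfolding rot_rot
    proof (rule rot_cong[of _ "sz b + 4"])
      show "(4 + (4 + sz b - (4 - c))) mod (sz b + 4) = c mod (sz b + 4)" unfolding e by (rule mod_add_self2)
    qed (use assms t in simp_all)
  qed
  finally show ?thesis .
qed

text \<open>\<open>Y cs\<close> and \<open>Y' cs\<close> are an arm in its two states. By
  \<open>arm_unfold\<close>, attaching \<open>Y'\<close> amounts to attaching a sequence of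
  \<open>cB\<close>, and attaching \<open>Y\<close> to attaching a sequence of
  \<open>cA\<close>.\<close>

abbreviation Y :: "nat list \<Rightarrow> conf" where "Y cs \<equiv> ch cB cA cs"
abbreviation Y' :: "nat list \<Rightarrow> conf" where "Y' cs \<equiv> ch cA cB cs"

lemma adj_Y: "adj (Y cs) (Y' cs)" by (intro adj_ch adj_AB adj_BA)
lemma adj_Y': "adj (Y' cs) (Y cs)" by (intro adj_ch adj_AB adj_BA)

lemma deg_Y [simp]: "deg (Y cs) = 1" using deg_cA by simp

text \<open>Unfolded, \<open>Y'\<close> consists of attached \<open>cB\<close>, none of which has a
  choice in a move; only \<open>x\<close> has.\<close>

lemma adj_arm:
  "valid cs \<Longrightarrow> ok x \<Longrightarrow> adj (x \<frown> Y' cs) d \<longleftrightarrow> (\<exists>z. adj x z \<and> d = z \<frown> Y cs)"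
proof (induction cs arbitrary: x d)
  case Nil then show ?case by (simp add: adj_cat_B_iff)
next
  case (Cons c cs)
  have c: "c = 1 \<or> c = 3" "valid cs" using Cons.prems by auto
  have e1: "rot (4 - c) (x \<frown> Y' (c # cs)) = rot (4 - c) (x \<frown> cB) \<frown> Y' cs"
    using arm_unfold[of cA c x "Y' cs"] c Cons.prems by (simp add: rot_cA)
  have e2: "rot (4 - c) (z \<frown> Y (c # cs)) = rot (4 - c) (z \<frown> cA) \<frown> Y cs" if "ok z" for z
    using arm_unfold[of cB c z "Y cs"] c that by (simp add: rot_cB)
  show ?case
  proof
    assume a: "adj (x \<frown> Y' (c # cs)) d"
    have okd: "ok d" using adj_ok(2)[OF a] .
    have "adj (rot (4 - c) (x \<frown> cB) \<frown> Y' cs) (rot (4 - c) d)" using adj_rot[OF a, of "4 - c"] e1 by simp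
    then obtain u where u: "adj (rot (4 - c) (x \<frown> cB)) u" "rot (4 - c) d = u \<frown> Y cs"
      using Cons.IH c Cons.prems by (meson ok_cat ok_rot ok_small(2))
    then obtain v where v: "adj (x \<frown> cB) v" "u = rot (4 - c) v"
      using adj_rot_iff[of "x \<frown> cB"] Cons.prems by (meson ok_bd ok_cat ok_small(2))
    then obtain z where z: "adj x z" "v = z \<frown> cA" using adj_cat_B_iff Cons.prems by blast
    have okz: "ok z" using adj_ok(2)[OF z(1)] .
    have "rot (4 - c) d = rot (4 - c) (z \<frown> Y (c # cs))" using u(2) v(2) z(2) e2[OF okz] by simp
    then have "d = z \<frown> Y (c # cs)" using rot_inj[OF ok_bd[OF okd]] okz by simp
    then show "\<exists>z. adj x z \<and> d = z \<frown> Y (c # cs)" using z by blast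
  next
    assume "\<exists>z. adj x z \<and> d = z \<frown> Y (c # cs)"
    then show "adj (x \<frown> Y' (c # cs)) d" using adj_cat adj_Y' by blast
  qed
qed

lemma deg_arm: "valid cs \<Longrightarrow> ok x \<Longrightarrow> deg (x \<frown> Y' cs) = deg x"
proof (induction cs arbitrary: x)
  case (Cons c cs)
  have c: "c = 1 \<or> c = 3" "valid cs" using Cons.prems by auto
  have e1: "rot (4 - c) (x \<frown> Y' (c # cs)) = rot (4 - c) (x \<frown> cB) \<frown> Y' cs"
    using arm_unfold[of cA c x "Y' cs"] c Cons.prems by (simp add: rot_cA)
  have "deg (x \<frown> Y' (c # cs)) = deg (rot (4 - c) (x \<frown> Y' (c # cs)))" using Cons.prems by simp
  also have "\<dots> = deg (rot (4 - c) (x \<frown> cB))" unfolding e1 using Cons.IH c Cons.prems by simp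
  also have "\<dots> = deg x" using Cons.prems by simp
  finally show ?case .
qed simp

lemma deg_swap: "ok x \<Longrightarrow> ok y \<Longrightarrow> deg (x \<frown> y) = deg (y \<frown> x)"
  by (simp add: cat_swap[of x y])

lemma adj_arm_left:
  assumes "valid cs" "ok x"
  shows "adj (Y' cs \<frown> x) d \<longleftrightarrow> (\<exists>z. adj x z \<and> d = Y cs \<frown> z)"
proof
  assume a: "adj (Y' cs \<frown> x) d"
  have eq: "Y' cs \<frown> x = rot (sz (Y' cs)) (x \<frown> Y' cs)" by (rule cat_swap) (use assms in simp_all)
  have bd: "bd (x \<frown> Y' cs)" using assms by simp
  obtain e where e: "adj (x \<frown> Y' cs) e" "d = rot (sz (Y' cs)) e"
    using a unfolding eq adj_rot_iff[OF bd] by blast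
  obtain z where z: "adj x z" "e = z \<frown> Y cs" using e(1) adj_arm[OF assms] by blast
  have "d = Y cs \<frown> z" using e(2) z(2) adj_ok(2)[OF z(1)] cat_swap[of z "Y cs"] by simp
  then show "\<exists>z. adj x z \<and> d = Y cs \<frown> z" using z by blast
qed (use adj_cat adj_Y' in blast)

lemma deg_arm_left: "valid cs \<Longrightarrow> ok x \<Longrightarrow> deg (Y' cs \<frown> x) = deg x"
  using deg_swap[of "Y' cs" x] deg_arm by simp

lemma arm_move:
  assumes "valid ds" "c = 1 \<or> c = 3" "ok z"
  shows "rot c (z \<frown> cA) \<frown> Y ds = rot c (z \<frown> Y ((4 - c) # ds))"
  using arm_unfold[of cB "4 - c" z "Y ds"] assms by (auto simp: rot_cB)

text \<open>The starting value for \<open>deg_cap_cat_A\<close>: with \<open>leaf\<close> as the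
  \<open>cap\<close> of nothing, it yields the degree of \<open>T0\<close>.\<close>

lemma deg_empty: "deg (Conf 0 {}) = 1"
proof -
  have "adj (Conf 0 {}) (Conf 0 {})" by (simp add: adj_def mat_def compat_def)
  then have "{d. adj (Conf 0 {}) d} = {Conf 0 {}}" using adj_ok(2) adj_sz ok_0 by fastforce
  then show ?thesis by (simp add: deg_def)
qed

lemma deg_leaf: "deg leaf = 0"
proof -
  have "\<not> adj leaf d" for d
  proof
    assume a: "adj leaf d"
    have M: "mat 2 (edges d)" using adj_ok(2)[OF a] adj_sz[OF a] by (simp add: ok_def')
    obtain q where "q < 2" "q \<noteq> 0" "{0, q} \<in> edges d" using mat_partner[OF M, of 0] by auto
    then have "{0, 1} \<in> edges d" by (simp add: less_2_cases_iff)
    then show False using adj_notin[OF a, of "{0, 1}"] by (simp add: edges_leaf)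
  qed
  then show ?thesis by (simp add: deg_def)
qed

lemma cap_empty: "cap (Conf 0 {}) = leaf"
proof -
  have "Conf 0 {} \<frown> leaf = leaf" by (rule conf_eqI) (auto simp: cat_def img_def)
  then show ?thesis by (simp add: cap_def)
qed

lemma deg_T0: "deg T0 = 1"
proof -
  have "ok (Conf 0 {})" by (simp add: mat_def)
  from deg_cap_cat_A[OF this] show ?thesis by (simp add: cap_empty leaf_cat_cA deg_leaf deg_empty)
qed

text \<open>By \<open>decomp\<close>, every matching of the octagon is a rotation of two quadrangles
  side by side; what remains is a finite search for edges shared with \<open>R0\<close>.\<close>

lemma adj_R0_cases: assumes "adj R0 d" shows "d = R1 \<or> d = BB \<or> d = rot 2 BB"
proof -
  have d: "ok d" "sz d = 8" using adj_ok(2)[OF assms] adj_sz[OF assms] by auto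
  obtain w t r where w: "ok w" "t = cA \<or> t = cB" "r \<le> sz w" "w \<frown> t = rot r d"
    using decomp[OF d(1)] d(2) by auto
  have "sz w = 4" using arg_cong[OF w(4), of sz] w(2) d(2) by auto
  then have w4: "w = cA \<or> w = cB" using ok_4 w(1) by blast
  define q where "q = 8 - r"
  have q: "q = 8 \<or> q = 7 \<or> q = 6 \<or> q = 5 \<or> q = 4"
    using w(3) \<open>sz w = 4\<close> by (simp add: q_def) linarith
  have dq: "d = rot q (w \<frown> t)"
    using rot_inverse[of d r] d w(3) \<open>sz w = 4\<close> by (simp add: w(4) q_def)
  have BB: "rot 8 BB = BB" "rot 6 BB = rot 2 BB" "rot 4 BB = BB"
    using rot_sz[of BB] rot_rot[of 2 4 BB] by (simp_all add: rot_4_BB)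
  have disj: "edges R0 \<inter> edges d = {}" using assms by (simp add: adj_def)
  consider "w = cA" "t = cA" | "w = cB" "t = cB" | "w = cA" "t = cB" | "w = cB" "t = cA" using w4 w(2) by blast
  then show ?thesis
  proof cases
    case 1
    have "d = rot q R0" unfolding dq 1 R0_def by (rule refl)
    then have "d = R0 \<or> d = R1" by (simp add: rot_R0)
    then show ?thesis using disj by (auto simp: edges_R0)
  next
    case 2
    have d: "d = rot q BB" unfolding dq 2 BB_def by (rule refl)
    have "edges R0 \<inter> edges (rot 7 BB) \<noteq> {}" "edges R0 \<inter> edges (rot 5 BB) \<noteq> {}"
      by (simp_all add: rot_def edges_BB edges_R0 in_img_doubleton doubleton_eq_iff del: One_nat_def)
    then have "q \<noteq> 7" "q \<noteq> 5" using disj d by metis+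
    then have "q = 8 \<or> q = 6 \<or> q = 4" using q by blast
    then show ?thesis using d BB by metis
  next
    case 3
    have "False" using q disj unfolding dq 3
      by (elim disjE) (simp_all add: edges_simps doubleton_eq_iff del: One_nat_def)
    then show ?thesis ..
  next
    case 4
    have "False" using q disj unfolding dq 4
      by (elim disjE) (simp_all add: edges_simps doubleton_eq_iff del: One_nat_def)
    then show ?thesis ..
  qed
qed

lemma edges_rot_BB: "edges (rot 1 BB) = {{1, 4}, {2, 3}, {0, 5}, {6, 7}}"
  "edges (rot 2 BB) = {{2, 5}, {3, 4}, {1, 6}, {0, 7}}"
  "edges (rot 3 BB) = {{3, 6}, {4, 5}, {2, 7}, {0, 1}}"
  by (simp_all add: rot_def edges_BB in_img_doubleton set_eq_subset doubleton_eq_iff del: One_nat_def)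

text \<open>The octagon component is a double star with centres \<open>R0\<close> and
  \<open>R1\<close>. \<open>Uo\<close> and \<open>Vo\<close> are its colour classes, each consisting
  of one centre and the two leaves at the other.\<close>

definition Uo :: "conf set" where "Uo = {R0, rot 1 BB, rot 3 BB}"
definition Vo :: "conf set" where "Vo = {R1, BB, rot 2 BB}"

lemma adj_R0_iff: "adj R0 d \<longleftrightarrow> d \<in> Vo"
  using adj_R0_cases adj_R01 adj_R0_BB adj_R0_rot_BB by (auto simp: Vo_def)

lemma adj_R1_iff: "adj R1 d \<longleftrightarrow> d \<in> Uo"
proof -
  have "adj R1 d \<longleftrightarrow> (\<exists>y. y \<in> Vo \<and> d = rot 1 y)"
    using adj_rot_iff[of R0 1 d] by (simp add: R1_def adj_R0_iff)
  also have "\<dots> \<longleftrightarrow> d \<in> Uo" by (auto simp: Vo_def Uo_def rot_R1 rot_rot eval_nat_numeral)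
  finally show ?thesis .
qed

lemma deg_BB: "deg BB = 1" using deg_cB by (simp add: BB_def)

lemma conf_ne: "edges x \<noteq> edges y \<Longrightarrow> x \<noteq> y" by auto

lemma card_Vo: "card Vo = 3" and card_Uo: "card Uo = 3"
proof -
  have "R1 \<noteq> BB" "R1 \<noteq> rot 2 BB" "BB \<noteq> rot 2 BB" "R0 \<noteq> rot 1 BB" "R0 \<noteq> rot 3 BB" "rot 1 BB \<noteq> rot 3 BB"
    by (rule conf_ne, simp add: edges_R0 edges_R1 edges_BB edges_rot_BB set_eq_subset doubleton_eq_iff del: One_nat_def)+
  then show "card Vo = 3" "card Uo = 3" by (simp_all add: Vo_def Uo_def)
qed

lemma deg_R0: "deg R0 = 3" and deg_R1: "deg R1 = 3"
  using card_Vo card_Uo by (simp_all add: deg_def adj_R0_iff adj_R1_iff)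

lemma Uo_cases: "x \<in> Uo \<Longrightarrow> x = R0 \<or> (deg x = 1 \<and> adj x R1)"
  using adj_sym adj_R1_iff[of x] deg_BB by (auto simp: Uo_def)
lemma Vo_cases: "x \<in> Vo \<Longrightarrow> x = R1 \<or> (deg x = 1 \<and> adj x R0)"
  using adj_sym adj_R0_iff[of x] deg_BB by (auto simp: Vo_def)

lemma Uo_ok: "x \<in> Uo \<Longrightarrow> ok x \<and> sz x = 8" by (auto simp: Uo_def)
lemma Vo_ok: "x \<in> Vo \<Longrightarrow> ok x \<and> sz x = 8" by (auto simp: Vo_def)

lemma adj_Uo: "x \<in> Uo \<Longrightarrow> adj x d \<Longrightarrow> d \<in> Vo"
proof -
  assume x: "x \<in> Uo" "adj x d"
  show ?thesis
  proof (cases "x = R0")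
    case True then show ?thesis using x adj_R0_iff by blast
  next
    case False
    then have "d = R1" using Uo_cases x deg_1 by blast
    then show ?thesis by (simp add: Vo_def)
  qed
qed

lemma adj_Vo: "x \<in> Vo \<Longrightarrow> adj x d \<Longrightarrow> d \<in> Uo"
proof -
  assume x: "x \<in> Vo" "adj x d"
  show ?thesis
  proof (cases "x = R1")
    case True then show ?thesis using x adj_R1_iff by blast
  next
    case False
    then have "d = R0" using Vo_cases x deg_1 by blast
    then show ?thesis by (simp add: Uo_def)
  qed
qed

text \<open>For the shifts 1 and 3, one edge of the appended \<open>cA\<close> comes to span
  everything else while the other stays beside \<open>z\<close>. So \<open>deg_cap_cat_A\<close>
  applies again at the next attachment.\<close>

lemma cap_leaf_right: "rot 1 (z \<frown> cA) = cap (z \<frown> leaf)"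
  by (simp add: cap_def cA_def cat_assoc)

lemma cap_leaf_left: "bd z \<Longrightarrow> rot 3 (z \<frown> cA) = cap (leaf \<frown> z)"
proof -
  assume z: "bd z"
  have "leaf \<frown> (z \<frown> leaf) = rot 2 ((z \<frown> leaf) \<frown> leaf)" using cat_swap[of "z \<frown> leaf" leaf] z by simp
  then have "cap (leaf \<frown> z) = rot 1 (rot 2 ((z \<frown> leaf) \<frown> leaf))" by (simp add: cap_def cat_assoc)
  then show ?thesis by (simp add: rot_rot cA_def cat_assoc)
qed

lemma leaf_cat: "bd z \<Longrightarrow> leaf \<frown> z = rot 2 (z \<frown> leaf)"
  using cat_swap[of z leaf] by simp

text \<open>The chain remains a \<open>cap\<close> of some \<open>h\<close> of degree 1, so each
  further \<open>cA\<close> raises the degree by one. The invariant is kept because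
  \<open>cap h \<frown> leaf\<close> is a rotation of \<open>h \<frown> cB\<close>.\<close>

lemma deg_R1_chain:
  "valid cs \<Longrightarrow> (\<exists>h. ok h \<and> ch cA R1 cs = cap h \<and> deg h = 1) \<and> deg (ch cA R1 cs \<frown> cA) = length cs + 4"
proof (induction cs)
  case Nil
  have R1: "R1 = cap T0" by (simp add: R1_def R0_def T0_def cA_def cap_def cat_assoc)
  then have "deg (R1 \<frown> cA) = 4" using deg_cap_cat_A[of T0] deg_R1 deg_T0 by simp
  then show ?case using R1 deg_T0 by (intro conjI exI[of _ T0]) simp_all
next
  case (Cons c cs)
  let ?z = "ch cA R1 cs"
  have c: "c = 1 \<or> c = 3" "valid cs" using Cons.prems by auto
  obtain h where h: "ok h" "?z = cap h" "deg h = 1" and d: "deg (?z \<frown> cA) = length cs + 4"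
    using Cons.IH c by blast
  have z: "ok ?z" by simp
  have "deg (?z \<frown> leaf) = 1" using h cap_cat_leaf[of h] by simp
  moreover have "deg (leaf \<frown> ?z) = deg (?z \<frown> leaf)" using z by (simp add: leaf_cat)
  ultimately obtain h' where h': "ok h'" "ch cA R1 (c # cs) = cap h'" "deg h' = 1"
    using c z cap_leaf_right[of ?z] cap_leaf_left[of ?z] by (metis ch.simps(2) ok_bd ok_cat ok_leaf)
  have "deg (ch cA R1 (c # cs)) = length cs + 4" using d z by simp
  then have "deg (cap h') = length cs + 4" unfolding h'(2) .
  then have "deg (ch cA R1 (c # cs) \<frown> cA) = length (c # cs) + 4"
    unfolding h'(2) using deg_cap_cat_A[OF h'(1)] h'(3) by simp
  then show ?case using h' by blast
qed

lemma deg_R1_arm: assumes "valid ds" shows "deg (R1 \<frown> Y ds) = length ds + 4"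
proof -
  obtain p where "ch cA R1 (rv ds) \<frown> cA = rot p (R1 \<frown> Y ds)"
    using ch_reverse[of cA "rv ds" R1] assms rv_rv by (auto simp: rot_cA)
  then show ?thesis using deg_R1_chain[of "rv ds"] assms by (metis deg_rot length_rv ok_bd ok_cat ok_ch ok_small valid_rv)
qed

lemma deg_leaf_arm: assumes "x = BB \<or> x = rot 2 BB" shows "deg (x \<frown> Y ds) = 1"
  using assms
proof
  assume "x = BB"
  then have "x \<frown> Y ds = cB \<frown> (cB \<frown> Y ds)" by (simp add: BB_def cat_assoc)
  then show ?thesis by simp
next
  assume "x = rot 2 BB"
  then have "x \<frown> Y ds = rot 2 (cB \<frown> rot (4 + sz (Y ds) - 2) (cB \<frown> Y ds))"
    using cat_rot_cat[of cB cB "Y ds" 2] by (simp add: BB_def rot_cB)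
  then show ?thesis by simp
qed

section \<open>Explicit vertices of the components of order \<open>6 * l - 6\<close>\<close>

text \<open>\<open>X1 cs\<close> is the common vertex at which the hexagon flips of all hubs arrive
  (\<open>adj_Hb_X1\<close>); its rotation by 2 comes from two nested uses of \<open>cap\<close>.
  Its neighbour \<open>a1 cs\<close> will be the second representative in the component
  (\<open>a1_rep\<close>).\<close>

definition a1 :: "nat list \<Rightarrow> conf" where "a1 cs = rot 2 (Y' cs \<frown> R0)"
definition X1 :: "nat list \<Rightarrow> conf" where "X1 cs = rot 2 (Y cs \<frown> R1)"

text \<open>\<open>UU cs\<close> and \<open>VV cs\<close> below will be the two colour classes of the component of \<open>ch cB R0 cs \<frown> cB\<close>,
  and \<open>US cs\<close>, \<open>VS cs\<close> those of \<open>ch cB R0 cs\<close>. The hubs \<open>h\<close> in \<open>Hb cs\<close> are the elements of \<open>VS cs\<close>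
  for which \<open>h \<frown> cA\<close> is also adjacent to \<open>X1 cs\<close>.\<close>

fun Hb :: "nat list \<Rightarrow> conf set" where
  "Hb [] = {R1}"
| "Hb (c # cs) = rot c ` ((\<lambda>x. x \<frown> cA) ` Hb cs \<union> {a1 cs})"

text \<open>The remaining elements \<open>x\<close> of \<open>VS cs\<close>: for these
  \<open>x \<frown> cA\<close> has a single neighbour (\<open>deg_Lf_A\<close>).\<close>

fun Lf :: "nat list \<Rightarrow> conf set" where
  "Lf [] = {BB, rot 2 BB}"
| "Lf (c # cs) = rot c ` ((\<lambda>x. x \<frown> cA) ` Lf cs \<union> (\<lambda>o'. rot 2 (Y' cs \<frown> o')) ` {rot 1 BB, rot 3 BB})"

fun US :: "nat list \<Rightarrow> conf set" where
  "US [] = Uo"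
| "US (c # cs) = rot c ` ((\<lambda>x. x \<frown> cB) ` US cs \<union> (\<lambda>o'. rot 2 (Y cs \<frown> o')) ` Vo)"

definition VS :: "nat list \<Rightarrow> conf set" where "VS cs = Hb cs \<union> Lf cs"
definition UU :: "nat list \<Rightarrow> conf set" where
  "UU cs = (\<lambda>x. x \<frown> cB) ` US cs \<union> (\<lambda>o'. rot 2 (Y cs \<frown> o')) ` Vo"
definition VV :: "nat list \<Rightarrow> conf set" where
  "VV cs = (\<lambda>x. x \<frown> cA) ` VS cs \<union> (\<lambda>o'. rot 2 (Y' cs \<frown> o')) ` Uo"

lemma US_Cons: "US (c # cs) = rot c ` UU cs" by (simp add: UU_def)

lemma VS_Nil: "VS [] = Vo" by (auto simp: VS_def Vo_def)
lemma VS_Cons: "VS (c # cs) = rot c ` VV cs"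
  by (auto simp: VS_def VV_def a1_def Uo_def image_Un)

lemma US_ok: "x \<in> US cs \<Longrightarrow> ok x \<and> sz x = 8 + 4 * length cs"
proof (induction cs arbitrary: x)
  case (Cons c cs)
  then show ?case using Vo_ok by fastforce
qed (use Uo_ok in auto)

lemma Hb_ok: "x \<in> Hb cs \<Longrightarrow> ok x \<and> sz x = 8 + 4 * length cs"
proof (induction cs arbitrary: x)
  case (Cons c cs)
  then show ?case by (fastforce simp: a1_def)
qed auto

lemma Lf_ok: "x \<in> Lf cs \<Longrightarrow> ok x \<and> sz x = 8 + 4 * length cs"
proof (induction cs arbitrary: x)
  case (Cons c cs)
  then show ?case by fastforce
qed auto

lemma VS_ok: "x \<in> VS cs \<Longrightarrow> ok x \<and> sz x = 8 + 4 * length cs"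
  using Hb_ok Lf_ok by (auto simp: VS_def)

text \<open>By \<open>c \<le> 6\<close> the arm \<open>Y ds\<close> is inserted into the octagon
  \<open>o'\<close>, and the arm \<open>Y' cs\<close> on the other side does not affect
  degrees.\<close>

lemma arm_oct:
  assumes "valid cs" "c \<le> 6" "ok o'" "sz o' = 8"
  shows "deg (rot c (rot 2 (Y' cs \<frown> o')) \<frown> Y ds) = deg (rot (c + 2) o' \<frown> Y ds)"
proof -
  have "rot c (rot 2 (Y' cs \<frown> o')) \<frown> Y ds
    = rot (c + 2) (Y' cs \<frown> rot (8 + sz (Y ds) - (c + 2)) (rot (c + 2) o' \<frown> Y ds))"
    using cat_rot_cat[of "Y' cs" o' "Y ds" "c + 2"] assms by (simp add: rot_rot add.commute)
  then show ?thesis using assms deg_arm_left by simp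
qed

text \<open>All arms \<open>Y ds\<close> have to be treated at once, because \<open>arm_move\<close>
  turns an attached \<open>cA\<close> into a longer arm on a smaller element.\<close>

lemma deg_Lf_arm: "valid cs \<Longrightarrow> x \<in> Lf cs \<Longrightarrow> valid ds \<Longrightarrow> deg (x \<frown> Y ds) = 1"
proof (induction cs arbitrary: x ds)
  case Nil then show ?case using deg_leaf_arm by auto
next
  case (Cons c cs)
  have c: "c = 1 \<or> c = 3" "valid cs" using Cons.prems by auto
  consider z where "z \<in> Lf cs" "x = rot c (z \<frown> cA)"
    | o' where "o' = rot 1 BB \<or> o' = rot 3 BB" "x = rot c (rot 2 (Y' cs \<frown> o'))"
    using Cons.prems(2) by auto
  then show ?case
  proof cases
    case 1
    have "deg (x \<frown> Y ds) = deg (z \<frown> Y ((4 - c) # ds))"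
      using 1 arm_move[of ds c z] Lf_ok[OF 1(1)] c Cons.prems by simp
    also have "\<dots> = 1" using Cons.IH[OF c(2) 1(1), of "(4 - c) # ds"] c Cons.prems by auto
    finally show ?thesis .
  next
    case 2
    have "rot (c + 2) o' = BB \<or> rot (c + 2) o' = rot 2 BB"
    proof -
      have "rot 8 BB = BB" "rot 6 BB = rot 2 BB" "rot 4 BB = BB"
        using rot_sz[of BB] rot_rot[of 2 4 BB] by (simp_all add: rot_4_BB)
      then show ?thesis using 2(1) c(1) by (elim disjE) (simp_all add: rot_rot del: One_nat_def)
    qed
    then show ?thesis using 2 arm_oct[of cs c o' ds] c deg_leaf_arm by auto
  qed
qed

lemma deg_Hb_arm: "valid cs \<Longrightarrow> x \<in> Hb cs \<Longrightarrow> 3 \<le> deg x \<and> (\<forall>ds. valid ds \<longrightarrow> deg (x \<frown> Y ds) = deg x + length ds + 1)"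
proof (induction cs arbitrary: x)
  case Nil then show ?case using deg_R1_arm deg_R1 by auto
next
  case (Cons c cs)
  have c: "c = 1 \<or> c = 3" "valid cs" using Cons.prems by auto
  consider z where "z \<in> Hb cs" "x = rot c (z \<frown> cA)" | "x = rot c (a1 cs)"
    using Cons.prems(2) by auto
  then show ?case
  proof cases
    case 1
    have z: "ok z" using Hb_ok[OF 1(1)] by simp
    have IH: "3 \<le> deg z" "valid ds \<Longrightarrow> deg (z \<frown> Y ds) = deg z + length ds + 1" for ds
      using Cons.IH[OF c(2) 1(1)] by auto
    have dx: "deg x = deg z + 1" using IH(2)[of "[]"] 1 z by simp
    have "deg (x \<frown> Y ds) = deg x + length ds + 1" if "valid ds" for ds
    proof -
      have "deg (x \<frown> Y ds) = deg (z \<frown> Y ((4 - c) # ds))"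
        using 1 arm_move[of ds c z] z c that by simp
      also have "\<dots> = deg z + (length ds + 1) + 1" using IH(2)[of "(4 - c) # ds"] c that by auto
      finally show ?thesis using dx by simp
    qed
    then show ?thesis using IH dx by simp
  next
    case 2
    have dx: "deg x = 3" using 2 deg_arm_left c(2) deg_R0 by (simp add: a1_def)
    have "deg (x \<frown> Y ds) = deg (R1 \<frown> Y ds)" for ds
      using arm_oct[of cs c R0 ds] c by (auto simp: 2 a1_def rot_R0)
    then show ?thesis using dx deg_R1_arm by simp
  qed
qed

lemma cap_Y_Cons:
  assumes "c = 1 \<or> c = 3" shows "cap (Y (c # cs)) = rot (c + 1) (Y cs \<frown> T1)"
proof -
  have "rot c (Y cs \<frown> cB) \<frown> leaf = rot c (Y cs \<frown> rot (6 - c) (cA \<frown> leaf))"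
    using cat_rot_cat[of "Y cs" cB leaf c] assms by (auto simp: rot_cB)
  also have "rot (6 - c) (cA \<frown> leaf) = T1" using assms by (auto simp: rot_T0 simp flip: T0_def)
  finally show ?thesis by (simp add: cap_def rot_rot)
qed

text \<open>Being a \<open>cap\<close>, a hub admits a hexagon flip once \<open>cA\<close> is
  attached. That the inside can move to \<open>cap (Y cs)\<close>, whatever the hub, makes all these
  flips end in the same matching.\<close>

lemma Hb_cap:
  "valid cs \<Longrightarrow> x \<in> Hb cs \<Longrightarrow> \<exists>h. x = cap h \<and> adj h (cap (Y cs))"
proof (induction cs arbitrary: x)
  case Nil
  have "R1 = cap T0" "T1 = cap cA" by (simp_all add: R1_def R0_def T0_def T1_def cA_def cap_def cat_assoc)
  then show ?case using Nil adj_T01 by auto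
next
  case (Cons c cs)
  have c: "c = 1 \<or> c = 3" "valid cs" using Cons.prems by auto
  have T: "leaf \<frown> cA = T0" "cA \<frown> leaf = T0" "T0 \<frown> leaf = R0" by (simp_all add: T0_def R0_def cA_def cat_assoc)
  consider z where "z \<in> Hb cs" "x = rot c (z \<frown> cA)" | "x = rot c (a1 cs)"
    using Cons.prems(2) by auto
  then show ?case
  proof cases
    case 1
    obtain h where h: "z = cap h" "adj h (cap (Y cs))" using Cons.IH c 1 by blast
    have okh: "ok h" "ok z" using adj_ok h by auto
    have "adj (z \<frown> leaf) (rot 1 (cap (Y cs) \<frown> cA))"
      using okh h by (simp add: cap_cat_leaf adj_rot adj_cat adj_BA)
    moreover have "rot 1 (cap (Y cs) \<frown> cA) = rot 2 (Y cs \<frown> T1)"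
      by (simp add: cap_cat_A rot_rot del: One_nat_def)
    ultimately have a: "adj (z \<frown> leaf) (rot 2 (Y cs \<frown> T1))" by simp
    then have "adj (leaf \<frown> z) (rot 2 (rot 2 (Y cs \<frown> T1)))" using okh leaf_cat adj_rot by simp
    then have b: "adj (leaf \<frown> z) (rot 4 (Y cs \<frown> T1))" by (simp add: rot_rot)
    show ?thesis using c(1)
    proof
      assume "c = 1"
      then have "x = cap (z \<frown> leaf)" "cap (Y (c # cs)) = rot 2 (Y cs \<frown> T1)"
        using 1 cap_leaf_right[of z] cap_Y_Cons[OF c(1), of cs] by (simp_all del: One_nat_def ch.simps)
      then show ?thesis using a by metis
    next
      assume "c = 3"
      then have "x = cap (leaf \<frown> z)" "cap (Y (c # cs)) = rot 4 (Y cs \<frown> T1)"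
        using 1 cap_leaf_left[of z] okh cap_Y_Cons[OF c(1), of cs] by (simp_all del: One_nat_def ch.simps)
      then show ?thesis using b by metis
    qed
  next
    case 2
    have a: "adj (rot q (Y' cs \<frown> T0)) (rot q (Y cs \<frown> T1))" for q
      by (intro adj_rot adj_cat adj_Y' adj_T01)
    show ?thesis using c(1)
    proof
      assume c1: "c = 1"
      have "x = rot 1 (rot 2 ((Y' cs \<frown> T0) \<frown> leaf))" using 2 c1 by (simp add: a1_def rot_rot cat_assoc T)
      also have "rot 2 ((Y' cs \<frown> T0) \<frown> leaf) = leaf \<frown> (Y' cs \<frown> cA) \<frown> leaf"
        by (subst leaf_cat[symmetric]) (simp_all add: cat_assoc T)
      finally have "x = cap (leaf \<frown> (Y' cs \<frown> cA))" by (simp add: cap_def)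
      moreover have "leaf \<frown> (Y' cs \<frown> cA) = rot 2 (Y' cs \<frown> T0)" by (simp add: leaf_cat cat_assoc T)
      moreover have "cap (Y (c # cs)) = rot 2 (Y cs \<frown> T1)"
        using c1 cap_Y_Cons[OF c(1), of cs] by (simp del: One_nat_def ch.simps)
      ultimately show ?thesis using a[of 2] by metis
    next
      assume c3: "c = 3"
      have "x = rot 1 (rot 4 ((Y' cs \<frown> cA) \<frown> cA))" using 2 c3 by (simp add: a1_def rot_rot cat_assoc R0_def)
      also have "rot 4 ((Y' cs \<frown> cA) \<frown> cA) = cA \<frown> (Y' cs \<frown> cA)" using cat_swap[of "Y' cs \<frown> cA" cA] by simp
      also have "cA \<frown> (Y' cs \<frown> cA) = cA \<frown> (Y' cs \<frown> leaf) \<frown> leaf" by (simp add: cA_def cat_assoc)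
      finally have "x = cap (cA \<frown> (Y' cs \<frown> leaf))" by (simp add: cap_def)
      moreover have "cA \<frown> (Y' cs \<frown> leaf) = rot 4 (Y' cs \<frown> T0)"
        using cat_swap[of "Y' cs \<frown> leaf" cA] by (simp add: cat_assoc T)
      moreover have "cap (Y (c # cs)) = rot 4 (Y cs \<frown> T1)"
        using c3 cap_Y_Cons[OF c(1), of cs] by (simp del: One_nat_def ch.simps)
      ultimately show ?thesis using a[of 4] by metis
    qed
  qed
qed

text \<open>The flip turns \<open>T1\<close> into \<open>T0\<close>, and the spanning edge of
  \<open>cap (Y cs)\<close> completes \<open>T0\<close> to the octagon \<open>R1\<close>.\<close>

lemma adj_Hb_X1: assumes "valid cs" "x \<in> Hb cs" shows "adj (x \<frown> cA) (X1 cs)"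
proof -
  obtain h where h: "x = cap h" "adj h (cap (Y cs))" using Hb_cap assms by blast
  have "x \<frown> cA = rot 1 (h \<frown> T1)" using h adj_ok[OF h(2)] by (simp add: cap_cat_A)
  moreover have "adj (rot 1 (h \<frown> T1)) (rot 1 (cap (Y cs) \<frown> T0))" by (intro adj_rot adj_cat h(2) adj_T10)
  moreover have "cap (Y cs) \<frown> T0 = rot 1 (Y cs \<frown> rot 7 (leaf \<frown> T0))"
    using cat_rot_cat[of "Y cs" leaf T0 1] by (simp add: cap_def)
  moreover have "leaf \<frown> T0 = R0" by (simp add: R0_def T0_def cA_def cat_assoc)
  ultimately show ?thesis by (simp add: X1_def rot_rot rot_R0 del: One_nat_def)
qed

lemma ne_partner:
  assumes "ok x" "{p, q} \<in> edges x" "{p, r} \<in> edges y" "q \<noteq> r" shows "x \<noteq> y"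
  using mat_unique2[of "sz x" "edges x" p q r] assms by (auto simp: ok_def')

text \<open>The point \<open>8 + 4 * length cs\<close> is the first of an appended quadrangle. Its
  partner separates \<open>X1 cs\<close> from every \<open>y \<frown> cA\<close> and
  \<open>y \<frown> cB\<close>, and \<open>a1 cs\<close> from every
  \<open>y \<frown> cB\<close>.\<close>

lemma X1_edge: "{7 + 4 * length cs, 8 + 4 * length cs} \<in> edges (X1 cs)"
proof -
  have "{sz (Y cs) + 1, sz (Y cs) + 2} \<in> edges (Y cs \<frown> R1)" by (rule edge_cat_right) (simp add: edges_R1)
  from edge_rot[OF this, of 2] show ?thesis by (simp add: X1_def algebra_simps)
qed

lemma a1_edge: "{8 + 4 * length cs, 9 + 4 * length cs} \<in> edges (a1 cs)"
proof -
  have "{sz (Y' cs) + 2, sz (Y' cs) + 3} \<in> edges (Y' cs \<frown> R0)" by (rule edge_cat_right) (simp add: edges_R0)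
  from edge_rot[OF this, of 2] show ?thesis by (simp add: a1_def algebra_simps)
qed

lemma cat_A_edge: "{sz x, sz x + 1} \<in> edges (x \<frown> cA)"
  using edge_cat_right[of 0 1 cA x] by (simp add: edges_cA)
lemma cat_B_edge: "{sz x, sz x + 3} \<in> edges (x \<frown> cB)"
  using edge_cat_right[of 0 3 cB x] by (simp add: edges_cB)

lemma ok_X1 [simp]: "ok (X1 cs)" and ok_a1 [simp]: "ok (a1 cs)" by (simp_all add: X1_def a1_def)

lemma X1_ne_A: "sz y = 8 + 4 * length cs \<Longrightarrow> X1 cs \<noteq> y \<frown> cA"
  using X1_edge[of cs] cat_A_edge[of y]
  by (intro ne_partner[of _ "8 + 4 * length cs" "7 + 4 * length cs" "9 + 4 * length cs"]) (simp_all add: insert_commute)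
lemma X1_ne_B: "sz y = 8 + 4 * length cs \<Longrightarrow> X1 cs \<noteq> y \<frown> cB"
  using X1_edge[of cs] cat_B_edge[of y]
  by (intro ne_partner[of _ "8 + 4 * length cs" "7 + 4 * length cs" "11 + 4 * length cs"]) (simp_all add: insert_commute algebra_simps)
lemma a1_ne_B: "sz y = 8 + 4 * length cs \<Longrightarrow> a1 cs \<noteq> y \<frown> cB"
  using a1_edge[of cs] cat_B_edge[of y]
  by (intro ne_partner[of _ "8 + 4 * length cs" "9 + 4 * length cs" "11 + 4 * length cs"]) (simp_all add: insert_commute algebra_simps)

lemma deg_a1: "valid cs \<Longrightarrow> deg (a1 cs) = 3"
  by (simp add: a1_def deg_arm_left deg_R0)

lemma deg_X1: "valid cs \<Longrightarrow> deg (X1 cs) = length cs + 4"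
  using deg_swap[of "Y cs" R1] deg_R1_arm by (simp add: X1_def)

lemma deg_Hb_A: "valid cs \<Longrightarrow> h \<in> Hb cs \<Longrightarrow> deg (h \<frown> cA) = deg h + 1 \<and> 3 \<le> deg h"
  using deg_Hb_arm[of cs h] by (metis One_nat_def add_0_right ch.simps(1) list.size(3) valid_simps(1))
lemma deg_Lf_A: "valid cs \<Longrightarrow> x \<in> Lf cs \<Longrightarrow> deg (x \<frown> cA) = 1"
  using deg_Lf_arm[of cs x "[]"] by simp

lemma deg_VS_A: "valid cs \<Longrightarrow> x \<in> VS cs \<Longrightarrow> deg (x \<frown> cA) \<noteq> 3"
  using deg_Hb_A[of cs x] deg_Lf_A[of cs x] by (auto simp: VS_def)

text \<open>Here the partner of the first appended point agrees, so the degree has to decide: it is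
  3 on one side, and 1 or at least 4 on the other.\<close>

lemma a1_ne_A: "valid cs \<Longrightarrow> x \<in> VS cs \<Longrightarrow> a1 cs \<noteq> x \<frown> cA"
  using deg_VS_A[of cs x] deg_a1[of cs] by auto

lemma finite_Hb [simp]: "finite (Hb cs)" by (induction cs) auto
lemma finite_Lf [simp]: "finite (Lf cs)" by (induction cs) auto
lemma finite_Vo [simp]: "finite Vo" and finite_Uo [simp]: "finite Uo" by (simp_all add: Vo_def Uo_def)
lemma finite_US [simp]: "finite (US cs)" by (induction cs) auto
lemma finite_VS [simp]: "finite (VS cs)" by (simp add: VS_def)

lemma inj_cat_right: "ok t \<Longrightarrow> (\<And>x. x \<in> S \<Longrightarrow> ok x) \<Longrightarrow> inj_on (\<lambda>x. x \<frown> t) S"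
  by (rule inj_onI) (use cat_inj_ok in blast)
lemma inj_cat_left: "ok t \<Longrightarrow> (\<And>x. x \<in> S \<Longrightarrow> ok x) \<Longrightarrow> inj_on (\<lambda>x. rot p (t \<frown> x)) S"
proof (rule inj_onI)
  fix x y assume a: "ok t" "\<And>x. x \<in> S \<Longrightarrow> ok x" "x \<in> S" "y \<in> S" "rot p (t \<frown> x) = rot p (t \<frown> y)"
  then have "t \<frown> x = t \<frown> y" using rot_inj[OF _ _ a(5)] by simp
  then show "x = y" using cat_inj_ok[of t x t y] a by simp
qed
lemma inj_rot: "(\<And>x. x \<in> S \<Longrightarrow> ok x) \<Longrightarrow> inj_on (rot p) S"
  by (rule inj_onI) (use rot_inj in \<open>blast intro: ok_bd\<close>)

text \<open>Needed in \<open>closed_step_U\<close>: the hubs and the three matchings from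
  \<open>Uo\<close> have to add up to the degree of \<open>X1 cs\<close>.\<close>

lemma card_Hb: "valid cs \<Longrightarrow> card (Hb cs) = length cs + 1"
proof (induction cs)
  case (Cons c cs)
  have v: "valid cs" using Cons.prems by simp
  have "a1 cs \<notin> (\<lambda>x. x \<frown> cA) ` Hb cs" using a1_ne_A[OF v] by (auto simp: VS_def)
  moreover have "card ((\<lambda>x. x \<frown> cA) ` Hb cs) = length cs + 1"
    using Cons.IH[OF v] Hb_ok by (subst card_image) (auto intro!: inj_cat_right)
  ultimately have "card ((\<lambda>x. x \<frown> cA) ` Hb cs \<union> {a1 cs}) = length cs + 2" by simp
  moreover have "inj_on (rot c) ((\<lambda>x. x \<frown> cA) ` Hb cs \<union> {a1 cs})"
    by (rule inj_rot) (use Hb_ok in auto)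
  ultimately show ?case by (simp only: Hb.simps card_image) simp
qed simp

lemma adj_R1_Uo: "o' \<in> Uo \<Longrightarrow> adj R1 o'" using adj_R1_iff by blast
lemma adj_R0_Vo: "o' \<in> Vo \<Longrightarrow> adj R0 o'" using adj_R0_iff by blast

lemma adj_X1_E: "o' \<in> Uo \<Longrightarrow> adj (X1 cs) (rot 2 (Y' cs \<frown> o'))"
  unfolding X1_def by (intro adj_rot adj_cat adj_Y adj_R1_Uo)
lemma adj_a1_E: "o' \<in> Vo \<Longrightarrow> adj (a1 cs) (rot 2 (Y cs \<frown> o'))"
  unfolding a1_def by (intro adj_rot adj_cat adj_Y' adj_R0_Vo)

lemma a1_VV: "a1 cs \<in> VV cs" by (simp add: VV_def a1_def Uo_def)
lemma X1_UU: "X1 cs \<in> UU cs" by (simp add: UU_def X1_def Vo_def)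

definition closed :: "nat list \<Rightarrow> bool" where
  "closed cs \<longleftrightarrow> (\<forall>u\<in>US cs. \<forall>d. adj u d \<longrightarrow> d \<in> VS cs) \<and> (\<forall>v\<in>VS cs. \<forall>d. adj v d \<longrightarrow> d \<in> US cs)"

lemma deg_pos_ex: "0 < deg x \<Longrightarrow> \<exists>d. adj x d"
  unfolding deg_def by (metis card_gt_0_iff empty_Collect_eq)

lemma ex_adj8: "ok x \<Longrightarrow> sz x = 8 + 4 * m \<Longrightarrow> \<exists>d. adj x d"
  by (rule ex_adj) (simp_all add: dvd_add)

text \<open>Enough neighbours are known by construction, and the degree shows that there are no
  others; vertices with an arm \<open>Y'\<close> are handled by \<open>adj_arm_left\<close>.\<close>

lemma closed_step_V:
  assumes "valid cs" "closed cs" "v \<in> VV cs" "adj v d" shows "d \<in> UU cs"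
proof -
  consider x where "x \<in> Lf cs" "v = x \<frown> cA" | h where "h \<in> Hb cs" "v = h \<frown> cA"
    | o' where "o' \<in> Uo" "v = rot 2 (Y' cs \<frown> o')"
    using assms(3) by (auto simp: VV_def VS_def)
  then show ?thesis
  proof cases
    case 1
    have x: "x \<in> VS cs" using 1 by (simp add: VS_def)
    obtain y where y: "adj x y" using ex_adj8 VS_ok[OF x] by blast
    then have "y \<in> US cs" using assms(2) x by (simp add: closed_def)
    moreover have "d = y \<frown> cB"
      using deg_1[OF _ deg_Lf_A[OF assms(1) 1(1)]] adj_cat[OF y adj_AB] assms(4) 1(2) by blast
    ultimately show ?thesis by (simp add: UU_def)
  next
    case 2
    have h: "h \<in> VS cs" using 2 by (simp add: VS_def)
    have okh: "ok h" "sz h = 8 + 4 * length cs" using VS_ok[OF h] by auto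
    \<comment> \<open>By \<open>deg_Hb_A\<close>, a hub with \<open>cA\<close> attached has exactly
      one neighbour more than the hub itself, and this one is \<open>X1 cs\<close>.\<close>
    let ?S = "insert (X1 cs) ((\<lambda>y. y \<frown> cB) ` {y. adj h y})"
    have "X1 cs \<notin> (\<lambda>y. y \<frown> cB) ` {y. adj h y}" using X1_ne_B adj_sz okh by auto
    moreover have "inj_on (\<lambda>y. y \<frown> cB) {y. adj h y}" by (rule inj_cat_right) (use adj_ok(2) in auto)
    ultimately have "card ?S = deg h + 1"
      using card_insert_disjoint[of "(\<lambda>y. y \<frown> cB) ` {y. adj h y}" "X1 cs"]
      by (simp add: deg_def card_image del: card_insert_disjoint)
    then have c: "card ?S = card {y. adj v y}" using deg_Hb_A[OF assms(1) 2(1)] 2(2) by (simp add: deg_def)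
    have "?S \<subseteq> {y. adj v y}" using adj_Hb_X1[OF assms(1) 2(1)] adj_cat[OF _ adj_AB] 2(2) by auto
    then have "?S = {y. adj v y}" using c by (intro card_subset_eq) auto
    then have "d \<in> ?S" using assms(4) by blast
    then consider "d = X1 cs" | y where "adj h y" "d = y \<frown> cB" by blast
    then show ?thesis
    proof cases
      case 1 then show ?thesis using X1_UU by simp
    next
      case 2 then have "y \<in> US cs" using assms(2) h by (simp add: closed_def)
      then show ?thesis using 2 by (simp add: UU_def)
    qed
  next
    case 3
    have ok: "ok o'" using Uo_ok 3 by blast
    obtain e where e: "adj (Y' cs \<frown> o') e" "d = rot 2 e"
      using assms(4) adj_rot_iff[of "Y' cs \<frown> o'"] ok unfolding 3(2) by (metis ok_bd ok_cat ok_ch ok_small(1) ok_small(2))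
    then obtain z where "adj o' z" "e = Y cs \<frown> z" using adj_arm_left[OF assms(1) ok] by blast
    then show ?thesis using adj_Uo[OF 3(1)] e by (auto simp: UU_def)
  qed
qed

text \<open>The choice \<open>R0\<close> is excluded by \<open>a1_ne_A\<close>. Otherwise both sides
  have degree 1, and their neighbours \<open>y \<frown> cB\<close> and \<open>X1 cs\<close>
  differ.\<close>

lemma E_A_disjoint:
  assumes "valid cs" "closed cs" "x \<in> VS cs" "o' \<in> Uo" shows "x \<frown> cA \<noteq> rot 2 (Y' cs \<frown> o')"
proof
  assume eq: "x \<frown> cA = rot 2 (Y' cs \<frown> o')"
  have "o' \<noteq> R0" using a1_ne_A[OF assms(1,3)] eq by (auto simp: a1_def)
  then have d: "deg o' = 1" using Uo_cases[OF assms(4)] by blast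
  then have "deg (x \<frown> cA) = 1" using eq deg_arm_left[OF assms(1)] Uo_ok[OF assms(4)] by simp
  obtain y where y: "adj x y" using ex_adj8 VS_ok[OF assms(3)] by blast
  have "y \<frown> cB = X1 cs"
    using deg_1[OF _ \<open>deg (x \<frown> cA) = 1\<close>] adj_cat[OF y adj_AB] adj_sym[OF adj_X1_E[OF assms(4)]] eq by metis
  then show False using X1_ne_B[of y cs] adj_sz[OF y] VS_ok[OF assms(3)] by simp
qed

lemma closed_step_U:
  assumes "valid cs" "closed cs" "u \<in> UU cs" "adj u d" shows "d \<in> VV cs"
proof -
  consider x where "x \<in> US cs" "u = x \<frown> cB" | "u = X1 cs"
    | o' where "o' = BB \<or> o' = rot 2 BB" "u = rot 2 (Y cs \<frown> o')"
    using assms(3) by (auto simp: UU_def Vo_def X1_def)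
  then show ?thesis
  proof cases
    case 1
    then obtain y where "adj x y" "d = y \<frown> cA" using adj_cat_B_iff US_ok assms(4) by blast
    then show ?thesis using assms(2) 1 by (auto simp: closed_def VV_def)
  next
    case 2
    let ?E = "(\<lambda>o'. rot 2 (Y' cs \<frown> o')) ` Uo" and ?H = "(\<lambda>x. x \<frown> cA) ` Hb cs"
    have "card ?E = 3" using Uo_ok card_Uo by (subst card_image[OF inj_cat_left]) auto
    moreover have "card ?H = length cs + 1" using Hb_ok card_Hb[OF assms(1)] by (subst card_image[OF inj_cat_right]) auto
    moreover have "?E \<inter> ?H = {}" using E_A_disjoint[OF assms(1,2)] by (fastforce simp: VS_def)
    ultimately have "card (?E \<union> ?H) = length cs + 4" by (subst card_Un_disjoint) auto
    then have c: "card (?E \<union> ?H) = card {y. adj u y}" using deg_X1[OF assms(1)] 2 by (simp add: deg_def)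
    have "?E \<union> ?H \<subseteq> {y. adj u y}"
      using adj_X1_E adj_sym[OF adj_Hb_X1[OF assms(1)]] 2 by auto
    then have "?E \<union> ?H = {y. adj u y}" using c by (intro card_subset_eq) auto
    then show ?thesis using assms(4) by (auto simp: VV_def VS_def)
  next
    case 3
    have "deg u = 1" using 3 deg_leaf_arm[OF 3(1), of cs] deg_swap[of "Y cs" o'] by auto
    moreover have "adj u (a1 cs)" using adj_sym[OF adj_a1_E] 3 by (auto simp: Vo_def)
    ultimately have "d = a1 cs" using deg_1 assms(4) by blast
    then show ?thesis using a1_VV by simp
  qed
qed

lemma UU_ok: "x \<in> UU cs \<Longrightarrow> ok x \<and> sz x = 12 + 4 * length cs"
  using US_ok Vo_ok by (fastforce simp: UU_def)
lemma VV_ok: "x \<in> VV cs \<Longrightarrow> ok x \<and> sz x = 12 + 4 * length cs"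
  using VS_ok Uo_ok by (fastforce simp: VV_def)

lemma closed_valid: "valid cs \<Longrightarrow> closed cs"
proof (induction cs)
  case Nil
  then show ?case using adj_Uo adj_Vo by (auto simp: closed_def VS_Nil)
next
  case (Cons c cs)
  have v: "valid cs" and IH: "closed cs" using Cons by auto
  have "d \<in> VS (c # cs)" if u: "u \<in> US (c # cs)" "adj u d" for u d
  proof -
    obtain w where w: "w \<in> UU cs" "u = rot c w" using u US_Cons by auto
    then obtain e where "adj w e" "d = rot c e" using u(2) adj_rot_iff[of w c d] UU_ok[OF w(1)] by auto
    then show ?thesis using closed_step_U[OF v IH w(1)] VS_Cons by auto
  qed
  moreover have "d \<in> US (c # cs)" if u: "u \<in> VS (c # cs)" "adj u d" for u d
  proof -
    obtain w where w: "w \<in> VV cs" "u = rot c w" using u VS_Cons by auto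
    then obtain e where "adj w e" "d = rot c e" using u(2) adj_rot_iff[of w c d] VV_ok[OF w(1)] by auto
    then show ?thesis using closed_step_V[OF v IH w(1)] US_Cons by auto
  qed
  ultimately show ?case unfolding closed_def by blast
qed

abbreviation Nc :: "nat list \<Rightarrow> conf" where "Nc cs \<equiv> ch cB R0 cs"

lemma Hb_nonempty: "\<exists>h. h \<in> Hb cs" by (cases cs) auto

text \<open>A hub, \<open>X1 cs\<close> and \<open>a1 cs\<close> form the bridge from the inherited
  vertices to the new octagon part. Parities are recorded because only a walk of known parity
  survives a further attachment in a definite form.\<close>

lemma connected_step:
  assumes "valid cs" "\<forall>x\<in>US cs. ev (Nc cs) x" "\<forall>x\<in>VS cs. od (Nc cs) x"
  shows "(\<forall>x\<in>UU cs. ev (Nc cs \<frown> cB) x) \<and> (\<forall>x\<in>VV cs. od (Nc cs \<frown> cB) x)"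
proof -
  let ?r = "Nc cs \<frown> cB"
  have u: "ev ?r (x \<frown> cB)" if "x \<in> US cs" for x using that assms ev_cat_left adj_BA by blast
  have v: "od ?r (x \<frown> cA)" if "x \<in> VS cs" for x using that assms od_cat_left adj_BA by blast
  obtain h where h: "h \<in> Hb cs" using Hb_nonempty by blast
  then have X: "ev ?r (X1 cs)" using v[of h] od_adj adj_Hb_X1[OF assms(1) h] by (auto simp: VS_def)
  have EV: "od ?r (rot 2 (Y' cs \<frown> o'))" if "o' \<in> Uo" for o' using ev_adj[OF X adj_X1_E[OF that]] .
  have "od ?r (a1 cs)" using EV[of R0] by (simp add: a1_def Uo_def)
  then have EU: "ev ?r (rot 2 (Y cs \<frown> o'))" if "o' \<in> Vo" for o' using od_adj adj_a1_E[OF that] by blast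
  show ?thesis using u v EU EV by (auto simp: UU_def VV_def)
qed

lemma connected: "valid cs \<Longrightarrow> (\<forall>x\<in>US cs. ev (Nc cs) x) \<and> (\<forall>x\<in>VS cs. od (Nc cs) x)"
proof (induction cs)
  case Nil
  have "ev R0 x" if "x \<in> Uo" for x using ev_2 adj_R01 adj_R1_Uo[OF that] by blast
  moreover have "od R0 x" if "x \<in> Vo" for x using od_1 adj_R0_Vo[OF that] by blast
  ultimately show ?case by (simp add: VS_Nil)
next
  case (Cons c cs)
  then show ?case using connected_step[of cs] ev_rot od_rot US_Cons VS_Cons by auto
qed

lemma connected_K:
  assumes "valid cs" shows "\<forall>x\<in>UU cs. ev (Nc cs \<frown> cB) x" "\<forall>x\<in>VV cs. od (Nc cs \<frown> cB) x"
  using connected_step[OF assms] connected[OF assms] by blast+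

definition component :: "conf \<Rightarrow> conf set" where "component x = {y. reach x y}"

lemma Nc_US: "Nc cs \<in> US cs"
  by (induction cs) (auto simp: Uo_def)

lemma component_rep: assumes "valid cs" shows "component (Nc cs \<frown> cB) = UU cs \<union> VV cs"
proof
  show "UU cs \<union> VV cs \<subseteq> component (Nc cs \<frown> cB)"
    using connected_K[OF assms] ev_reach od_reach by (auto simp: component_def)
  have "y \<in> UU cs \<union> VV cs" if "reach (Nc cs \<frown> cB) y" for y
    using that unfolding reach_def
  proof (induction rule: rtranclp_induct)
    case base then show ?case using Nc_US by (auto simp: UU_def)
  next
    case (step y z)
    then show ?case using closed_step_U closed_step_V closed_valid assms by blast
  qed
  then show "component (Nc cs \<frown> cB) \<subseteq> UU cs \<union> VV cs" by (auto simp: component_def)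
qed

lemma UU_disj:
  assumes "valid cs" "x \<in> US cs" "o' \<in> Vo" shows "x \<frown> cB \<noteq> rot 2 (Y cs \<frown> o')"
proof
  assume "x \<frown> cB = rot 2 (Y cs \<frown> o')"
  then have "adj (x \<frown> cB) (a1 cs)" using adj_sym[OF adj_a1_E[OF assms(3)]] by simp
  then obtain y where "adj x y" "a1 cs = y \<frown> cA" using adj_cat_B_iff US_ok[OF assms(2)] by blast
  then show False using a1_ne_A[OF assms(1)] closed_valid[OF assms(1)] assms(2) by (auto simp: closed_def)
qed

lemma card_UU: "valid cs \<Longrightarrow> card (UU cs) = card (US cs) + 3"
proof -
  assume v: "valid cs"
  have "card ((\<lambda>x. x \<frown> cB) ` US cs) = card (US cs)"
    by (rule card_image, rule inj_cat_right) (use US_ok in auto)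
  moreover have "card ((\<lambda>o'. rot 2 (Y cs \<frown> o')) ` Vo) = 3"
    using Vo_ok card_Vo by (subst card_image[OF inj_cat_left]) auto
  moreover have "(\<lambda>x. x \<frown> cB) ` US cs \<inter> (\<lambda>o'. rot 2 (Y cs \<frown> o')) ` Vo = {}" using UU_disj[OF v] by blast
  ultimately show ?thesis unfolding UU_def by (subst card_Un_disjoint) auto
qed

lemma card_VV: "valid cs \<Longrightarrow> card (VV cs) = card (VS cs) + 3"
proof -
  assume v: "valid cs"
  have "card ((\<lambda>x. x \<frown> cA) ` VS cs) = card (VS cs)"
    by (rule card_image, rule inj_cat_right) (use VS_ok in auto)
  moreover have "card ((\<lambda>o'. rot 2 (Y' cs \<frown> o')) ` Uo) = 3"
    using Uo_ok card_Uo by (subst card_image[OF inj_cat_left]) auto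
  moreover have "(\<lambda>x. x \<frown> cA) ` VS cs \<inter> (\<lambda>o'. rot 2 (Y' cs \<frown> o')) ` Uo = {}"
    using E_A_disjoint[OF v closed_valid[OF v]] by blast
  ultimately show ?thesis unfolding VV_def by (subst card_Un_disjoint) auto
qed

lemma card_US: "valid cs \<Longrightarrow> card (US cs) = 3 * (length cs + 1)"
proof (induction cs)
  case (Cons c cs)
  have "card (US (c # cs)) = card (UU cs)" unfolding US_Cons
    by (rule card_image, rule inj_rot) (use UU_ok in blast)
  then show ?case using Cons card_UU[of cs] by simp
qed (simp add: card_Uo)

lemma card_VS: "valid cs \<Longrightarrow> card (VS cs) = 3 * (length cs + 1)"
proof (induction cs)
  case (Cons c cs)
  have "card (VS (c # cs)) = card (VV cs)" unfolding VS_Cons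
    by (rule card_image, rule inj_rot) (use VV_ok in blast)
  then show ?case using Cons card_VV[of cs] by simp
qed (simp add: VS_Nil card_Vo)

lemma not_adj_self: "adj x x \<Longrightarrow> sz x = 0"
proof (rule ccontr)
  assume a: "adj x x" "sz x \<noteq> 0"
  then obtain q where "{0, q} \<in> edges x"
    using mat_partner[of "sz x" "edges x" 0] adj_ok(1)[OF a(1)] by (auto simp: ok_def')
  then show False using adj_notin[OF a(1)] by blast
qed

text \<open>Each class has two shapes, which leaves four coincidences. They are refuted by
  uniqueness of concatenation or by a neighbour that one shape has and the other cannot
  have.\<close>

lemma UU_VV_disj: assumes "valid cs" shows "UU cs \<inter> VV cs = {}"
proof -
  have 1: "x \<frown> cB \<noteq> y \<frown> cA" if "x \<in> US cs" "y \<in> VS cs" for x y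
  proof
    assume "x \<frown> cB = y \<frown> cA"
    then have "cB = cA" using cat_inj_ok[of x cB y cA] US_ok[OF that(1)] VS_ok[OF that(2)] by simp
    then show False using not_adj_self[of cA] adj_AB by simp
  qed
  have 2: "x \<frown> cB \<noteq> rot 2 (Y' cs \<frown> o')" if x: "x \<in> US cs" "o' \<in> Uo" for x o'
  proof
    assume "x \<frown> cB = rot 2 (Y' cs \<frown> o')"
    then have "adj (x \<frown> cB) (X1 cs)" using adj_sym[OF adj_X1_E[OF x(2)]] by simp
    then obtain y where y: "adj x y" "X1 cs = y \<frown> cA" using adj_cat_B_iff US_ok[OF x(1)] by blast
    then show False using X1_ne_A[of y cs] adj_sz[OF y(1)] US_ok[OF x(1)] by simp
  qed
  have 3: "y \<frown> cA \<noteq> rot 2 (Y cs \<frown> o')" if y: "y \<in> VS cs" "o' \<in> Vo" for y o'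
  proof
    assume eq: "y \<frown> cA = rot 2 (Y cs \<frown> o')"
    obtain z where z: "adj y z" using ex_adj8 VS_ok[OF y(1)] by blast
    have o1: "o' \<noteq> R1" using X1_ne_A[of y cs] VS_ok[OF y(1)] eq by (auto simp: X1_def)
    then have "o' = BB \<or> o' = rot 2 BB" using y(2) by (simp add: Vo_def)
    then have "deg (y \<frown> cA) = 1" using eq deg_leaf_arm[of o' cs] deg_swap[of "Y cs" o'] by auto
    then have "z \<frown> cB = a1 cs"
      using deg_1 adj_cat[OF z adj_AB] adj_sym[OF adj_a1_E[OF y(2)]] eq by metis
    then show False using a1_ne_B[of z cs] adj_sz[OF z] VS_ok[OF y(1)] by simp
  qed
  have 4: "rot 2 (Y cs \<frown> p) \<noteq> rot 2 (Y' cs \<frown> q)" if "p \<in> Vo" "q \<in> Uo" for p q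
  proof
    assume "rot 2 (Y cs \<frown> p) = rot 2 (Y' cs \<frown> q)"
    then have "Y cs \<frown> p = Y' cs \<frown> q" using rot_inj Vo_ok[OF that(1)] Uo_ok[OF that(2)]
      by (metis ok_bd ok_cat ok_ch ok_small(1) ok_small(2))
    then have "Y cs = Y' cs" using cat_inj_ok[of "Y cs" p "Y' cs" q] Vo_ok[OF that(1)] Uo_ok[OF that(2)] by simp
    then show False using adj_Y[of cs] not_adj_self[of "Y cs"] by simp
  qed
  show ?thesis
  proof (rule equals0I)
    fix z assume "z \<in> UU cs \<inter> VV cs"
    then have "(\<exists>x\<in>US cs. z = x \<frown> cB) \<or> (\<exists>o'\<in>Vo. z = rot 2 (Y cs \<frown> o'))"
      "(\<exists>x\<in>VS cs. z = x \<frown> cA) \<or> (\<exists>o'\<in>Uo. z = rot 2 (Y' cs \<frown> o'))"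
      by (auto simp: UU_def VV_def)
    then show False using 1 2 3 4 by (elim disjE bexE) metis+
  qed
qed

text \<open>The octagon contributes 6, and each of the \<open>length cs + 1\<close> attachments of
  \<open>cB\<close> adds three vertices to either colour class.\<close>

lemma card_component_rep: assumes "valid cs" shows "card (component (Nc cs \<frown> cB)) = 6 * (length cs + 2)"
proof -
  have f: "finite (UU cs)" "finite (VV cs)" by (simp_all add: UU_def VV_def)
  show ?thesis
    unfolding component_rep[OF assms] card_Un_disjoint[OF f UU_VV_disj[OF assms]]
    using card_UU card_VV card_US card_VS assms by simp
qed

lemma filter_image: "(\<And>u. u \<in> S \<Longrightarrow> g (f u) = g u) \<Longrightarrow> {u \<in> f ` S. g u = a} = f ` {u \<in> S. g u = a}"
  by auto

text \<open>The degree 3, inherited from \<open>R0\<close>, singles out the representative in its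
  colour class; this is how representatives are counted later.\<close>

lemma deg_3_US: "valid cs \<Longrightarrow> {u \<in> US cs. deg u = 3} = {Nc cs}"
  and deg_3_UU: "valid cs \<Longrightarrow> {u \<in> UU cs. deg u = 3} = {Nc cs \<frown> cB}"
proof -
  have step: "{u \<in> UU cs. deg u = 3} = {Nc cs \<frown> cB}" if v: "valid cs" and IH: "{u \<in> US cs. deg u = 3} = {Nc cs}" for cs
  proof -
    have n1: "deg (rot 2 (Y cs \<frown> o')) \<noteq> 3" if "o' \<in> Vo" for o'
    proof (cases "o' = R1")
      case True then show ?thesis using deg_X1[OF v] by (simp add: X1_def)
    next
      case False
      then have "deg (Y cs \<frown> o') = 1" using that deg_leaf_arm[of o' cs] deg_swap[of "Y cs" o'] by (auto simp: Vo_def)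
      then show ?thesis using Vo_ok[OF that] by simp
    qed
    have n2: "deg (x \<frown> cB) = 3 \<longleftrightarrow> x = Nc cs" if x: "x \<in> US cs" for x
    proof -
      have "x \<in> {u \<in> US cs. deg u = 3} \<longleftrightarrow> x = Nc cs" unfolding IH by simp
      then show ?thesis using x US_ok[OF x] by simp
    qed
    show ?thesis
    proof (intro equalityI subsetI)
      fix u assume "u \<in> {u \<in> UU cs. deg u = 3}"
      then obtain x where "x \<in> US cs" "u = x \<frown> cB" "deg u = 3" using n1 unfolding UU_def by blast
      then show "u \<in> {Nc cs \<frown> cB}" using n2 by blast
    next
      fix u assume "u \<in> {Nc cs \<frown> cB}"
      then show "u \<in> {u \<in> UU cs. deg u = 3}" using n2[OF Nc_US] Nc_US unfolding UU_def by blast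
    qed
  qed
  show US: "{u \<in> US cs. deg u = 3} = {Nc cs}" if "valid cs" for cs
    using that
  proof (induction cs)
    case Nil
    have "deg u = 3 \<longleftrightarrow> u = R0" if "u \<in> Uo" for u using Uo_cases[OF that] deg_R0 by auto
    then show ?case by (auto simp: Uo_def)
  next
    case (Cons c cs)
    have "deg (rot c u) = deg u" if "u \<in> UU cs" for u using UU_ok[OF that] by simp
    then have "{u \<in> US (c # cs). deg u = 3} = rot c ` {u \<in> UU cs. deg u = 3}"
      unfolding US_Cons by (rule filter_image)
    then show ?case using step[of cs] Cons by simp
  qed
  show "{u \<in> UU cs. deg u = 3} = {Nc cs \<frown> cB}" if "valid cs" using step[OF that US[OF that]] .
qed

lemma deg_3_VV: assumes "valid cs" shows "{v \<in> VV cs. deg v = 3} = {a1 cs}"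
proof -
  have "deg (x \<frown> cA) \<noteq> 3" if "x \<in> VS cs" for x using deg_VS_A assms that by blast
  moreover have "deg (rot 2 (Y' cs \<frown> o')) = 3 \<longleftrightarrow> o' = R0" if "o' \<in> Uo" for o'
    using Uo_cases[OF that] Uo_ok[OF that] deg_arm_left[OF assms] deg_R0 by auto
  ultimately have n: "x \<in> VS cs \<Longrightarrow> deg (x \<frown> cA) \<noteq> 3"
    "o' \<in> Uo \<Longrightarrow> deg (rot 2 (Y' cs \<frown> o')) = 3 \<Longrightarrow> o' = R0" for x o' by blast+
  show ?thesis
  proof (intro equalityI subsetI)
    fix v assume v: "v \<in> {v \<in> VV cs. deg v = 3}"
    then obtain o' where "o' \<in> Uo" "v = rot 2 (Y' cs \<frown> o')" using n(1) unfolding VV_def by blast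
    then have "v = rot 2 (Y' cs \<frown> R0)" using n(2) v by blast
    then show "v \<in> {a1 cs}" by (simp add: a1_def)
  next
    fix v assume "v \<in> {a1 cs}"
    then show "v \<in> {v \<in> VV cs. deg v = 3}" using a1_VV deg_a1[OF assms] by simp
  qed
qed

text \<open>Read from its other end, the arm \<open>Y' cs\<close> beside \<open>R0\<close> is a
  chain of \<open>cB\<close> over \<open>R0\<close>.\<close>

lemma a1_rep: assumes "valid cs" shows "\<exists>p. a1 cs = rot p (Nc (rv cs) \<frown> cB)"
proof -
  obtain p where p: "Nc (rv cs) \<frown> cB = rot p (R0 \<frown> Y' cs)"
    using ch_reverse[of cB "rv cs" R0] assms by (auto simp: rot_cB rv_rv)
  obtain q where "rot q (rot p (R0 \<frown> Y' cs)) = R0 \<frown> Y' cs"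
    using rot_back[of "sz (R0 \<frown> Y' cs)" p] by (metis ok_bd ok_cat ok_ch ok_small(1) ok_small(2) ok_small(5))
  then have "R0 \<frown> Y' cs = rot q (Nc (rv cs) \<frown> cB)" using p by simp
  moreover have "Y' cs \<frown> R0 = rot (sz (Y' cs)) (R0 \<frown> Y' cs)" by (rule cat_swap) simp_all
  ultimately have "a1 cs = rot (q + sz (Y' cs) + 2) (Nc (rv cs) \<frown> cB)" by (simp add: a1_def rot_rot)
  then show ?thesis by blast
qed

section \<open>Lower bounds on component orders\<close>

lemma oct_Nc: "oct (Nc cs)"
  by (induction cs) (auto intro: oct.intros)

lemma reach_rot_R0: "reach R0 (rot p R0)"
  using adj_reach[OF adj_R01] by (simp add: rot_R0)

lemma oct_8: "oct x \<Longrightarrow> sz x = 8 \<Longrightarrow> reach R0 x"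
proof (induction rule: oct.induct)
  case (oct_rot x p)
  then show ?case using reach_rot[of R0 x p] reach_rot_R0 reach_trans by (metis sz_rot)
next
  case (oct_adj x y)
  then show ?case using adj_sz adj_reach reach_trans by metis
qed (auto dest: oct_ok)

text \<open>The last attachment in the derivation of \<open>oct x\<close> is undone; an attached
  \<open>cA\<close> becomes a \<open>cB\<close> by one move.\<close>

lemma oct_decomp: "oct x \<Longrightarrow> 12 \<le> sz x \<Longrightarrow> \<exists>p y. oct y \<and> sz x = sz y + 4 \<and> reach (rot p (y \<frown> cB)) x"
proof (induction rule: oct.induct)
  case (oct_rot x q)
  then obtain p y where "oct y" "sz x = sz y + 4" "reach (rot p (y \<frown> cB)) x" by auto
  then have "reach (rot (p + q) (y \<frown> cB)) (rot q x)" using reach_rot[of _ x q] rot_rot by metis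
  then show ?case using \<open>oct y\<close> \<open>sz x = sz y + 4\<close> by auto
next
  case (oct_adj x z)
  then have "sz z = sz x" using adj_sz by blast
  then show ?case using oct_adj adj_reach reach_trans by metis
next
  case (oct_A x)
  obtain y where y: "adj x y" using ex_adj oct_ok[OF oct_A.hyps] by blast
  then have "oct y" "sz y = sz x" using oct.oct_adj oct_A.hyps adj_sz by blast+
  moreover have "adj (y \<frown> cB) (x \<frown> cA)" using adj_cat[OF adj_sym[OF y] adj_BA] .
  then have "reach (rot 0 (y \<frown> cB)) (x \<frown> cA)" using adj_reach adj_ok(1) by fastforce
  ultimately show ?case by (metis sz_cat sz_small(2))
next
  case (oct_B x)
  have "reach (rot 0 (x \<frown> cB)) (x \<frown> cB)" using oct_ok[OF oct_B.hyps] by simp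
  then show ?case using oct_B.hyps by (metis sz_cat sz_small(3))
qed simp

definition medium :: "conf \<Rightarrow> bool" where
  "medium x \<longleftrightarrow> (\<exists>p cs. valid cs \<and> reach (rot p (Nc cs \<frown> cB)) x)"

text \<open>If the distance from one representative is odd, change to the other:
  \<open>a1 cs\<close> is at odd distance from it and is itself a representative, with word
  \<open>rv cs\<close>.\<close>

lemma medium_ev: assumes "medium y" shows "\<exists>q cs. valid cs \<and> ev (rot q (Nc cs \<frown> cB)) y"
proof -
  obtain p cs where r: "valid cs" "reach (rot p (Nc cs \<frown> cB)) y" using assms by (auto simp: medium_def)
  from reach_cases[OF r(2)] show ?thesis
  proof
    assume o: "od (rot p (Nc cs \<frown> cB)) y"
    have "od (Nc cs \<frown> cB) (a1 cs)" using connected_K(2)[OF r(1)] a1_VV by blast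
    then have "od (rot p (a1 cs)) (rot p (Nc cs \<frown> cB))" using od_rot od_sym by blast
    then have e: "ev (rot p (a1 cs)) y" using od_od o by blast
    obtain q where "a1 cs = rot q (Nc (rv cs) \<frown> cB)" using a1_rep[OF r(1)] by blast
    then have "ev (rot (q + p) (Nc (rv cs) \<frown> cB)) y" using e by (simp add: rot_rot)
    then show ?thesis using r(1) valid_rv by blast
  qed (use r in blast)
qed

text \<open>The two outcomes correspond to the parity of the walk from \<open>R0\<close> to the
  octagon part that carries the attached \<open>cB\<close>.\<close>

lemma oct_12: assumes "oct x" "sz x = 12" shows "medium x \<or> reach L6 x"
proof -
  obtain p y where y: "oct y" "sz y = 8" "reach (rot p (y \<frown> cB)) x"
    using oct_decomp[OF assms(1)] assms(2) by auto
  have R: "reach R0 y" using oct_8 y by blast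
  from reach_cases[OF R] show ?thesis
  proof
    assume "ev R0 y"
    then have "reach (rot p (Nc [] \<frown> cB)) (rot p (y \<frown> cB))"
      using ev_cat_left[OF _ adj_BA] ev_reach reach_rot by simp
    then have "reach (rot p (Nc [] \<frown> cB)) x" using y(3) reach_trans by blast
    then show ?thesis unfolding medium_def using valid_simps(1) by blast
  next
    assume "od R0 y"
    then have "od L6 (y \<frown> cB)" using od_cat_left[OF _ adj_AB, of R0 y] cat_R0_cA by (simp add: L6_def)
    then have "reach (rot p L6) x" using od_rot od_reach y(3) reach_trans by blast
    moreover have "reach L6 (rot p L6)" using adj_reach[OF adj_L6] rot_L6[of p] by (metis reach_refl)
    ultimately show ?thesis using reach_trans by blast
  qed
qed

lemma medium_insert_B: assumes "valid cs" shows "medium (rot q (Nc cs \<frown> cB) \<frown> cB) \<or> split (rot q (Nc cs \<frown> cB) \<frown> cB)"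
proof -
  let ?n = "8 + length cs * 4 + 4"
  define p where "p = q mod ?n"
  have pq: "rot q (Nc cs \<frown> cB) = rot p (Nc cs \<frown> cB)"
    using rot_mod[of q "Nc cs \<frown> cB"] by (simp add: p_def)
  show ?thesis
  proof (cases "p = 1 \<or> p = 3")
    case True
    then have "valid (p # cs)" using assms by auto
    moreover have "rot q (Nc cs \<frown> cB) \<frown> cB = rot 0 (Nc (p # cs) \<frown> cB)" using pq by simp
    ultimately show ?thesis unfolding medium_def using reach_refl by metis
  next
    case False
    have "split (rot p (Nc cs \<frown> cB) \<frown> cB)"
    proof (rule chain_insert[where K = split])
      fix cs p
      show "split (Nc cs \<frown> rot p BB)" "split (Nc cs \<frown> rot p ST)"
        by (intro split_cat oct_Nc oct_rot oct_BB oct_ST)+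
    next
      fix j :: nat assume "0 < j" "j < sz R0"
      then show "split (rot (4 + j) (R0 \<frown> cB) \<frown> cB)" using split_R0_base by simp
    qed (use False assms in \<open>auto intro: split_rot split_B simp: p_def\<close>)
    then show ?thesis using pq by simp
  qed
qed

text \<open>From 16 points on, the 12-gon ring is no longer a case of its own, since attaching a
  quadrangle to it gives \<open>split\<close>. Attaching to a \<open>medium\<close> matching is
  decided by the gap, after an even walk to a representative.\<close>

lemma oct_16: "oct x \<Longrightarrow> 16 \<le> sz x \<Longrightarrow> medium x \<or> split x"
proof (induction "sz x" arbitrary: x rule: less_induct)
  case less
  obtain p y where y: "oct y" "sz x = sz y + 4" "reach (rot p (y \<frown> cB)) x"
    using oct_decomp[OF less.prems(1)] less.prems(2) by auto
  have spl: ?case if "split (y \<frown> cB)"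
    by (intro disjI2 split_reach[OF y(3)] split_rot[OF that])
  have "medium y \<or> split (y \<frown> cB)"
  proof (cases "16 \<le> sz y")
    case True then show ?thesis using less.hyps[of y] y split_B by auto
  next
    case False
    then have "sz y = 12" using y less.prems oct_ok[OF y(1)] by (auto elim!: dvdE)
    then have "medium y \<or> reach L6 y" using oct_12 y by blast
    then show ?thesis using split_insert_L6[of y cB 0] oct_ok[OF y(1)] by auto
  qed
  then show ?case
  proof
    assume "medium y"
    then obtain q cs where q: "valid cs" "ev (rot q (Nc cs \<frown> cB)) y" using medium_ev by blast
    have r: "reach (rot q (Nc cs \<frown> cB) \<frown> cB) (y \<frown> cB)"
      by (rule ev_reach[OF ev_cat_left[OF q(2) adj_BA]])
    from medium_insert_B[OF q(1), of q] show ?case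
    proof
      assume "medium (rot q (Nc cs \<frown> cB) \<frown> cB)"
      then obtain p' ds where d: "valid ds" "reach (rot p' (Nc ds \<frown> cB)) (rot q (Nc cs \<frown> cB) \<frown> cB)"
        by (auto simp: medium_def)
      have "reach (rot p' (Nc ds \<frown> cB)) (y \<frown> cB)" using d(2) r reach_trans by blast
      then have "reach (rot (p' + p) (Nc ds \<frown> cB)) (rot p (y \<frown> cB))" using reach_rot rot_rot by metis
      then show ?case unfolding medium_def using d(1) y(3) reach_trans by blast
    next
      assume "split (rot q (Nc cs \<frown> cB) \<frown> cB)"
      then show ?case using split_reach[OF r] spl by blast
    qed
  qed (rule spl)
qed

lemma component_eq: "reach x y \<Longrightarrow> component x = component y"
  unfolding component_def using reach_sym reach_trans by blast

lemma self_component [simp]: "x \<in> component x" by (simp add: component_def)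

lemma component_ok: "ok x \<Longrightarrow> y \<in> component x \<Longrightarrow> ok y \<and> sz y = sz x"
  using reach_ok by (auto simp: component_def)

lemma finite_confs: "finite {x. ok x \<and> sz x = n}"
proof (rule finite_subset)
  show "{x. ok x \<and> sz x = n} \<subseteq> Conf n ` Pow (Pow {..<n})"
  proof
    fix d assume "d \<in> {x. ok x \<and> sz x = n}"
    then have "sz d = n" "bd d" by auto
    then show "d \<in> Conf n ` Pow (Pow {..<n})" by (cases d) (auto simp: bd_def)
  qed
qed simp

lemma finite_component: "ok x \<Longrightarrow> finite (component x)"
proof -
  assume x: "ok x"
  have "component x \<subseteq> {y. ok y \<and> sz y = sz x}" using component_ok[OF x] by blast
  then show ?thesis using finite_confs finite_subset by blast
qed

lemma component_rot: assumes "ok x" shows "component (rot p x) = rot p ` component x"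
proof
  show "rot p ` component x \<subseteq> component (rot p x)" using reach_rot by (auto simp: component_def)
  show "component (rot p x) \<subseteq> rot p ` component x"
  proof
    fix y assume y: "y \<in> component (rot p x)"
    obtain q where q: "\<And>z. bd z \<Longrightarrow> sz z = sz x \<Longrightarrow> rot q (rot p z) = z \<and> rot p (rot q z) = z"
      using rot_back by metis
    have "ok y" "sz y = sz x" using component_ok[OF _ y] assms by auto
    moreover have "reach x (rot q y)" using reach_rot[of "rot p x" y q] y q[of x] assms by (simp add: component_def)
    ultimately show "y \<in> rot p ` component x" using q[of y] by (metis component_def imageI mem_Collect_eq ok_bd)
  qed
qed

lemma card_component_rot: "ok x \<Longrightarrow> card (component (rot p x)) = card (component x)"
proof -
  assume x: "ok x"
  have "inj_on (rot p) (component x)" by (rule inj_rot) (use component_ok[OF x] in blast)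
  then show ?thesis unfolding component_rot[OF x] by (rule card_image)
qed

text \<open>The six octagon vertices, three of either colour, persist under attachments. The two
  parities are kept apart so that they can be combined with walks in a second part.\<close>

lemma oct_parity:
  "oct x \<Longrightarrow> \<exists>E F. E \<inter> F = {} \<and> card E = 3 \<and> card F = 3 \<and> (\<forall>e\<in>E. ev x e) \<and> (\<forall>f\<in>F. od x f)"
proof (induction rule: oct.induct)
  case oct_R0
  have "Uo \<inter> Vo = {}"
  proof -
    have "R0 \<noteq> R1" "R0 \<noteq> BB" "R0 \<noteq> rot 2 BB" "rot 1 BB \<noteq> R1" "rot 1 BB \<noteq> BB" "rot 1 BB \<noteq> rot 2 BB"
      "rot 3 BB \<noteq> R1" "rot 3 BB \<noteq> BB" "rot 3 BB \<noteq> rot 2 BB"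
      by (rule conf_ne, simp add: edges_R0 edges_R1 edges_BB edges_rot_BB set_eq_subset doubleton_eq_iff del: One_nat_def)+
    then show ?thesis by (auto simp: Uo_def Vo_def)
  qed
  then show ?case using connected[of "[]"] card_Uo card_Vo by (intro exI[of _ Uo] exI[of _ Vo]) (simp add: VS_Nil)
next
  case (oct_rot x p)
  then obtain E F where *: "E \<inter> F = {}" "card E = 3" "card F = 3" "\<forall>e\<in>E. ev x e" "\<forall>f\<in>F. od x f" by blast
  have okE: "ok e" if "e \<in> E \<union> F" for e using that * ev_ok od_ok oct_ok[OF oct_rot.hyps] by blast
  have inj: "inj_on (rot p) (E \<union> F)" by (rule inj_rot) (rule okE)
  have "rot p ` E \<inter> rot p ` F = {}" using inj *(1) by (metis image_Int_subset image_empty inj_on_image_Int sup_ge1 sup_ge2)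
  moreover have "card (rot p ` E) = 3" "card (rot p ` F) = 3"
    using *(2,3) card_image[OF inj_on_subset[OF inj]] by auto
  ultimately show ?case using *(4,5) ev_rot od_rot by (intro exI[of _ "rot p ` E"] exI[of _ "rot p ` F"]) auto
next
  case (oct_adj x y)
  then obtain E F where *: "E \<inter> F = {}" "card E = 3" "card F = 3" "\<forall>e\<in>E. ev x e" "\<forall>f\<in>F. od x f" by blast
  have "\<forall>e\<in>E. od y e" "\<forall>f\<in>F. ev y f" using *(4,5) adj_ev adj_od adj_sym[OF oct_adj.hyps(2)] by blast+
  then show ?case using *(1-3) by (intro exI[of _ F] exI[of _ E]) auto
next
  case (oct_A x)
  then obtain E F where *: "E \<inter> F = {}" "card E = 3" "card F = 3" "\<forall>e\<in>E. ev x e" "\<forall>f\<in>F. od x f" by blast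
  have ok: "ok e" "sz e = sz x" if "e \<in> E \<union> F" for e using that * ev_ok od_ok oct_ok[OF oct_A.hyps] by blast+
  have "e \<frown> cA \<noteq> f \<frown> cB" if "e \<in> E" "f \<in> F" for e f
    using cat_inj_ok[of e cA f cB] ok that *(1) by auto
  then have "(\<lambda>x. x \<frown> cA) ` E \<inter> (\<lambda>x. x \<frown> cB) ` F = {}" by blast
  moreover have "card ((\<lambda>x. x \<frown> cA) ` E) = 3" "card ((\<lambda>x. x \<frown> cB) ` F) = 3"
    using *(2,3) ok by (subst card_image[OF inj_cat_right]; simp)+
  ultimately show ?case using *(4,5) ev_cat_left[OF _ adj_AB] od_cat_left[OF _ adj_AB]
    by (intro exI[of _ "(\<lambda>x. x \<frown> cA) ` E"] exI[of _ "(\<lambda>x. x \<frown> cB) ` F"]) auto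
next
  case (oct_B x)
  then obtain E F where *: "E \<inter> F = {}" "card E = 3" "card F = 3" "\<forall>e\<in>E. ev x e" "\<forall>f\<in>F. od x f" by blast
  have ok: "ok e" "sz e = sz x" if "e \<in> E \<union> F" for e using that * ev_ok od_ok oct_ok[OF oct_B.hyps] by blast+
  have "e \<frown> cB \<noteq> f \<frown> cA" if "e \<in> E" "f \<in> F" for e f
    using cat_inj_ok[of e cB f cA] ok that *(1) by auto
  then have "(\<lambda>x. x \<frown> cB) ` E \<inter> (\<lambda>x. x \<frown> cA) ` F = {}" by blast
  moreover have "card ((\<lambda>x. x \<frown> cB) ` E) = 3" "card ((\<lambda>x. x \<frown> cA) ` F) = 3"
    using *(2,3) ok by (subst card_image[OF inj_cat_right]; simp)+
  ultimately show ?case using *(4,5) ev_cat_left[OF _ adj_BA] od_cat_left[OF _ adj_BA]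
    by (intro exI[of _ "(\<lambda>x. x \<frown> cB) ` E"] exI[of _ "(\<lambda>x. x \<frown> cA) ` F"]) auto
qed

text \<open>Marks the vertices in which two parts are still separate; the strict bound on 16 points
  comes from a vertex that violates it.\<close>

definition cut :: "nat \<Rightarrow> conf \<Rightarrow> bool" where
  "cut n x \<longleftrightarrow> (\<forall>e\<in>edges x. \<forall>i\<in>e. \<forall>j\<in>e. i < n \<longrightarrow> j < n)"

lemma cut_cat: "ok x \<Longrightarrow> cut (sz x) (x \<frown> y)"
  unfolding cut_def
proof (intro ballI impI)
  fix e i j assume x: "ok x" and e: "e \<in> edges (x \<frown> y)" "i \<in> e" "j \<in> e" "i < sz x"
  have "e \<in> edges x \<or> (\<exists>f. e = (\<lambda>i. sz x + i) ` f)"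
    using e(1) unfolding cat_def img_def conf.sel by blast
  then have "e \<in> edges x"
  proof (elim disjE exE)
    fix f assume "e = (\<lambda>i. sz x + i) ` f"
    then show ?thesis using e(2,4) by auto
  qed
  then show "j < sz x" using ok_bd[OF x] e(3) unfolding bd_def by blast
qed

text \<open>Every vertex in the component of \<open>y\<close> can be paired with the three vertices
  of suitable parity on the side of \<open>x\<close>, and distinct pairs give distinct
  concatenations.\<close>

lemma card_component_cat:
  assumes x: "oct x" and y: "oct y"
  shows "3 * card (component y) \<le> card {z \<in> component (x \<frown> y). cut (sz x) z}"
proof -
  obtain E F where *: "E \<inter> F = {}" "card E = 3" "card F = 3" "\<forall>e\<in>E. ev x e" "\<forall>f\<in>F. od x f"
    using oct_parity[OF x] by blast
  have okx: "ok x" "ok y" using oct_ok x y by blast+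
  have ok: "ok e" "sz e = sz x" if "e \<in> E \<union> F" for e using that * ev_ok od_ok okx by blast+
  obtain x' y' where nb: "adj x x'" "adj y y'" using ex_adj oct_ok x y by meson
  define G where "G y' = (if ev y y' then E else F)" for y'
  let ?S = "SIGMA y':component y. G y'"
  have G: "G y' \<subseteq> E \<union> F" "card (G y') = 3" for y' using *(2,3) by (auto simp: G_def)
  have finG: "finite (G y')" for y' using G(2)[of y'] by (metis card.infinite zero_neq_numeral)
  have "card ?S = (\<Sum>y'\<in>component y. card (G y'))"
    using finite_component[OF okx(2)] finG by (simp add: card_SigmaI)
  also have "\<dots> = 3 * card (component y)" using G(2) by simp
  finally have cS: "card ?S = 3 * card (component y)" .
  have inj: "inj_on (\<lambda>(b, a). a \<frown> b) ?S"
  proof (rule inj_onI)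
    fix u v assume uv: "u \<in> ?S" "v \<in> ?S" "(case u of (b, a) \<Rightarrow> a \<frown> b) = (case v of (b, a) \<Rightarrow> a \<frown> b)"
    obtain b a b' a' where ab: "u = (b, a)" "v = (b', a')" by (cases u, cases v) auto
    have m: "a \<in> E \<union> F" "a' \<in> E \<union> F" "b \<in> component y" "b' \<in> component y" using uv(1,2) G(1) ab by blast+
    have "a \<frown> b = a' \<frown> b'" using uv(3) ab by simp
    moreover have "ok a" "ok a'" "sz a = sz x" "sz a' = sz x" using ok m(1,2) by blast+
    moreover have "ok b" "ok b'" using component_ok[OF okx(2)] m(3,4) by blast+
    ultimately have "a = a' \<and> b = b'" using cat_inj_ok[of a b a' b'] by simp
    then show "u = v" using ab by simp
  qed
  have "(\<lambda>(b, a). a \<frown> b) ` ?S \<subseteq> {z \<in> component (x \<frown> y). cut (sz x) z}"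
  proof
    fix z assume "z \<in> (\<lambda>(b, a). a \<frown> b) ` ?S"
    then obtain b a where z: "b \<in> component y" "a \<in> G b" "z = a \<frown> b" by auto
    have "reach (x \<frown> y) (a \<frown> b)"
    proof (cases "ev y b")
      case True
      then have "ev x a" using z(2) *(4) by (simp add: G_def)
      then show ?thesis using ev_cat[OF _ True nb] ev_reach by blast
    next
      case False
      then have "od y b" using z(1) reach_cases by (auto simp: component_def)
      moreover have "od x a" using False z(2) *(5) by (simp add: G_def)
      ultimately show ?thesis using od_od_cat od_reach by blast
    qed
    moreover have a: "ok a" "sz a = sz x" using ok z(2) G(1) by blast+
    moreover have "cut (sz x) (a \<frown> b)" using cut_cat[OF a(1), of b] a(2) by simp
    ultimately show "z \<in> {z \<in> component (x \<frown> y). cut (sz x) z}" using z(3) by (simp add: component_def)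
  qed
  moreover have "finite {z \<in> component (x \<frown> y). cut (sz x) z}" using finite_component[of "x \<frown> y"] okx by simp
  ultimately have "card ((\<lambda>(b, a). a \<frown> b) ` ?S) \<le> card {z \<in> component (x \<frown> y). cut (sz x) z}" by (rule card_mono[rotated])
  then show ?thesis using cS card_image[OF inj] by simp
qed

text \<open>The gap for the new quadrangle lies in one of the two parts. That part stays
  \<open>oct\<close>, and the other is untouched.\<close>

lemma split_decomp_insert:
  assumes "oct x" "oct y" "reach z (rot q (x \<frown> y))" "t = cA \<or> t = cB"
  shows "\<exists>q x y. oct x \<and> oct y \<and> reach (z \<frown> t) (rot q (x \<frown> y))"
proof -
  obtain t' where t': "t' = cA \<or> t' = cB" "reach (z \<frown> t) (rot q (x \<frown> y) \<frown> t')"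
    using reach_cat_AB[OF assms(3,4)] by blast
  have ok: "ok x" "ok y" "ok t'" "sz t' = 4" using assms oct_ok t'(1) by auto
  have app: "oct w \<Longrightarrow> oct (w \<frown> t')" for w using t'(1) oct_A oct_B by blast
  define p where "p = q mod (sz x + sz y)"
  have pq: "rot q (x \<frown> y) = rot p (x \<frown> y)" using rot_mod[of q "x \<frown> y"] by (simp add: p_def)
  have "0 < sz x" using oct_ok[OF assms(1)] by simp
  then have p: "p < sz x + sz y" by (simp add: p_def)
  show ?thesis
  proof (cases "p \<le> sz y")
    case True
    then have "rot p (x \<frown> y) \<frown> t' = rot p (x \<frown> rot (sz y + 4 - p) (rot p y \<frown> t'))"
      using cat_rot_cat[of x y t' p] ok by simp
    moreover have "oct (rot (sz y + 4 - p) (rot p y \<frown> t'))" using oct_rot app assms(2) by blast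
    ultimately show ?thesis using t'(2) pq assms(1) by metis
  next
    case False
    define j where "j = p - sz y"
    have j: "p = sz y + j" "j \<le> sz x" using False p by (auto simp: j_def)
    have "rot p (x \<frown> y) \<frown> t' = rot p (rot (sz x + 4 - j) (rot j x \<frown> t') \<frown> y)"
      using cat_rot_cat2[of x y t' j] ok j by simp
    moreover have "oct (rot (sz x + 4 - j) (rot j x \<frown> t'))" using oct_rot app assms(1) by blast
    ultimately show ?thesis using t'(2) pq assms(2) by metis
  qed
qed

lemma split_decomp: "split z \<Longrightarrow> \<exists>q x y. oct x \<and> oct y \<and> reach z (rot q (x \<frown> y))"
proof (induction rule: split.induct)
  case (split_cat x y)
  have "reach (x \<frown> y) (rot 0 (x \<frown> y))" using split_cat oct_ok by simp
  then show ?case using split_cat by blast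
next
  case (split_rot z p)
  then obtain q x y where "oct x" "oct y" "reach z (rot q (x \<frown> y))" by blast
  then show ?case using reach_rot[of z _ p] rot_rot by metis
next
  case (split_adj z w)
  then show ?case using adj_reach adj_sym reach_trans by meson
next
  case (split_A z)
  then show ?case using split_decomp_insert by blast
next
  case (split_B z)
  then show ?case using split_decomp_insert by blast
qed

text \<open>Rotating \<open>L6\<close> stays in its component, so the 12 distinct rotations of its
  neighbour \<open>R1 \<frown> cB\<close> all lie there. With \<open>L6\<close> itself this is one
  more than 12 = 6 * 3 - 6.\<close>

lemma card_L6: "13 \<le> card (component L6)"
proof -
  let ?z = "R1 \<frown> cB"
  have e: "edges ?z = {{1, 2}, {3, 4}, {5, 6}, {0, 7}, {8, 11}, {9, 10}}"
    by (simp add: cat_def edges_R1 edges_cB in_img_doubleton) (simp add: set_eq_subset doubleton_eq_iff)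
  have ne: "rot d ?z \<noteq> ?z" if "0 < d" "d < 12" for d
  proof -
    have "d = 1 \<or> d = 2 \<or> d = 3 \<or> d = 4 \<or> d = 5 \<or> d = 6 \<or> d = 7 \<or> d = 8 \<or> d = 9 \<or> d = 10 \<or> d = 11"
      using that by presburger
    then have "edges (rot d ?z) \<noteq> edges ?z"
      by (elim disjE) (simp_all add: rot_def e in_img_doubleton set_eq_subset doubleton_eq_iff del: One_nat_def)
    then show ?thesis by auto
  qed
  have inj: "inj_on (\<lambda>p. rot p ?z) {..<12}"
  proof (rule linorder_inj_onI)
    fix p q :: nat assume pq: "p < q" "p \<in> {..<12}" "q \<in> {..<12}"
    show "rot p ?z \<noteq> rot q ?z"
    proof
      assume "rot p ?z = rot q ?z"
      then have "rot p (rot (q - p) ?z) = rot p ?z" using pq by (simp add: rot_rot)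
      then have "rot (q - p) ?z = ?z" using rot_inj[of "rot (q - p) ?z" ?z p] by simp
      then show False using ne[of "q - p"] pq by (simp add: less_imp_diff_less)
    qed
  qed auto
  have L: "L6 \<notin> (\<lambda>p. rot p ?z) ` {..<12}"
  proof
    assume "L6 \<in> (\<lambda>p. rot p ?z) ` {..<12}"
    then obtain p where p: "p < 12" "L6 = rot p ?z" by auto
    then have "rot (12 - p) L6 = ?z" using rot_inverse[of ?z p] by simp
    then have "?z = L6 \<or> ?z = rot 1 L6" using rot_L6[of "12 - p"] by metis
    then have "edges ?z = edges L6 \<or> edges ?z = edges (rot 1 L6)" by metis
    then show False unfolding e edges_L6 edges_L6' by (simp add: set_eq_subset doubleton_eq_iff)
  qed
  have "reach L6 (rot p ?z)" for p
  proof -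
    have "adj L6 ?z" using adj_cat[OF adj_R01 adj_AB] cat_R0_cA by (simp add: L6_def)
    then have "reach (rot p L6) (rot p ?z)" using adj_reach adj_rot by blast
    moreover have "reach L6 (rot p L6)" using adj_reach[OF adj_L6] rot_L6[of p] by (metis reach_refl)
    ultimately show ?thesis using reach_trans by blast
  qed
  then have "insert L6 ((\<lambda>p. rot p ?z) ` {..<12}) \<subseteq> component L6" by (auto simp: component_def)
  moreover have "card (insert L6 ((\<lambda>p. rot p ?z) ` {..<12})) = 13" using inj L by (simp add: card_image)
  moreover have "finite (component L6)" using finite_component by simp
  ultimately show ?thesis by (metis card_mono)
qed

lemma medium_component:
  assumes "medium x" shows "12 \<le> sz x \<and> card (component x) + 6 = 6 * (sz x div 4)"
proof -
  obtain p cs where r: "valid cs" "reach (rot p (Nc cs \<frown> cB)) x" using assms by (auto simp: medium_def)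
  have "component x = component (rot p (Nc cs \<frown> cB))" using component_eq[OF r(2)] by simp
  then have "card (component x) = 6 * (length cs + 2)" using card_component_rot card_component_rep[OF r(1)] by simp
  moreover have "sz x = 4 * (length cs + 3)" using reach_ok[OF r(2)] by simp
  ultimately show ?thesis by simp
qed

lemma card_component_6: assumes "oct x" shows "6 \<le> card (component x)"
proof -
  obtain E F where *: "E \<inter> F = {}" "card E = 3" "card F = 3" "\<forall>e\<in>E. ev x e" "\<forall>f\<in>F. od x f"
    using oct_parity[OF assms] by blast
  have "finite E" "finite F" using *(2,3) by (metis card.infinite zero_neq_numeral)+
  then have "card (E \<union> F) = 6" using * by (simp add: card_Un_disjoint)
  moreover have "E \<union> F \<subseteq> component x" using *(4,5) ev_reach od_reach by (auto simp: component_def)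
  ultimately show ?thesis using card_mono[OF finite_component[of x]] oct_ok[OF assms] by metis
qed

text \<open>Edges of both octagons are regrouped, into \<open>L6 \<frown> cA\<close> or into a
  rotation of \<open>rot 1 L5 \<frown> T0\<close>. Moving the larger ring then creates an edge from
  the first eight points to the rest.\<close>

lemma R0_R_not_cut: "\<exists>w. reach (R0 \<frown> R0) w \<and> \<not> cut 8 w" "\<exists>w. reach (R0 \<frown> R1) w \<and> \<not> cut 8 w"
proof -
  have "R0 \<frown> R0 = L6 \<frown> cA" by (simp add: L6_def R0_def T0_def cA_def cat_assoc)
  then have 1: "reach (R0 \<frown> R0) (rot 1 L6 \<frown> cB)" using adj_cat[OF adj_L6 adj_AB] adj_reach by simp
  have "{0, 11} \<in> edges (rot 1 L6 \<frown> cB)" using edge_cat_left[of "{0, 11}" "rot 1 L6" cB] unfolding edges_L6' by simp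
  then have "\<not> cut 8 (rot 1 L6 \<frown> cB)" unfolding cut_def by force
  then show "\<exists>w. reach (R0 \<frown> R0) w \<and> \<not> cut 8 w" using 1 by blast
  have "rot 1 L5 \<frown> T0 = rot 1 (R0 \<frown> rot 7 (leaf \<frown> T0))"
    using cat_rot_cat[of R0 leaf T0 1] by (simp add: L5_def)
  moreover have "leaf \<frown> T0 = R0" by (simp add: R0_def T0_def cA_def cat_assoc)
  moreover have "adj (rot 1 L5 \<frown> T0) (L5 \<frown> T1)" using adj_cat[OF adj_sym[OF adj_L5] adj_T01] .
  ultimately have "adj (rot 1 (R0 \<frown> R1)) (L5 \<frown> T1)" by (simp add: rot_R0)
  then have "adj (rot 15 (rot 1 (R0 \<frown> R1))) (rot 15 (L5 \<frown> T1))" by (rule adj_rot)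
  moreover have "rot 15 (rot 1 (R0 \<frown> R1)) = R0 \<frown> R1" using rot_inverse[of "R0 \<frown> R1" 1] by simp
  ultimately have 2: "reach (R0 \<frown> R1) (rot 15 (L5 \<frown> T1))" using adj_reach by simp
  have "{8, 9} \<in> edges (L5 \<frown> T1)" using edge_cat_left[of "{8, 9}" L5 T1] by (simp add: edges_L5)
  from edge_rot[OF this, of 15] have "{7, 8} \<in> edges (rot 15 (L5 \<frown> T1))" by simp
  then have "\<not> cut 8 (rot 15 (L5 \<frown> T1))" unfolding cut_def by force
  then show "\<exists>w. reach (R0 \<frown> R1) w \<and> \<not> cut 8 w" using 2 by blast
qed

text \<open>The factor 3 gives only 18 vertices satisfying \<open>cut 8\<close>, which ties with 6 *
  4 - 6. One vertex outside them is found by walking to \<open>R0 \<frown> R0\<close> or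
  \<open>R0 \<frown> R1\<close>, depending on the parities of the two parts.\<close>

lemma card_component_16: assumes "oct a" "oct b" "sz a = 8" "sz b = 8" shows "19 \<le> card (component (a \<frown> b))"
proof -
  have ok: "ok a" "ok b" using assms oct_ok by blast+
  obtain a' b' where nb: "adj a a'" "adj b b'" using ex_adj oct_ok assms by meson
  have "reach a R0" "reach b R0" using oct_8 reach_sym assms by blast+
  then consider "ev a R0" "ev b R0" | "od a R0" "od b R0" | "ev a R0" "od b R0" | "od a R0" "ev b R0"
    using reach_cases by blast
  then have "reach (a \<frown> b) (R0 \<frown> R0) \<or> reach (a \<frown> b) (R0 \<frown> R1)"
  proof cases
    case 1 then show ?thesis using ev_cat[OF _ _ nb] ev_reach by blast
  next
    case 2 then show ?thesis using od_od_cat od_reach by blast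
  next
    case 3
    then have "ev b R1" using od_adj adj_R01 by blast
    then show ?thesis using 3 ev_cat[OF _ _ nb] ev_reach by blast
  next
    case 4
    then have "od b R1" using ev_adj adj_R01 by blast
    then show ?thesis using 4 od_od_cat od_reach by blast
  qed
  then obtain w where w: "reach (a \<frown> b) w" "\<not> cut 8 w" using R0_R_not_cut reach_trans by blast
  let ?S = "{z \<in> component (a \<frown> b). cut 8 z}"
  have fin: "finite (component (a \<frown> b))" using finite_component ok by simp
  have "18 \<le> card ?S" using card_component_cat[OF assms(1,2)] card_component_6[OF assms(2)] assms(3) by simp
  then have "19 \<le> card (insert w ?S)" using fin w by simp
  also have "\<dots> \<le> card (component (a \<frown> b))" using w fin by (intro card_mono) (auto simp: component_def)
  finally show ?thesis .
qed

lemma oct_lower: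
  "oct x \<Longrightarrow> 6 * (sz x div 4) \<le> card (component x) + 6 \<and> (12 \<le> sz x \<longrightarrow> \<not> medium x \<longrightarrow> 6 * (sz x div 4) < card (component x) + 6)"
proof (induction "sz x" arbitrary: x rule: less_induct)
  case less
  obtain m where m: "sz x = 4 * m" "2 \<le> m" using oct_ok[OF less.prems] by (auto elim!: dvdE)
  show ?case
  proof (cases "medium x")
    case True then show ?thesis using medium_component[OF True] by simp
  next
    case nM: False
    consider "m = 2" | "m = 3" | "4 \<le> m" using m(2) by linarith
    then show ?thesis
    proof cases
      case 1 then show ?thesis using card_component_6[OF less.prems] m by simp
    next
      case 2
      then have "reach L6 x" using oct_12[OF less.prems] nM m by simp
      then have "13 \<le> card (component x)" using card_L6 component_eq by metis
      then show ?thesis using m 2 by simp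
    next
      case 3
      then have "split x" using oct_16[OF less.prems] nM m by simp
      then obtain q a b where ab: "oct a" "oct b" "reach x (rot q (a \<frown> b))" using split_decomp by blast
      have ok: "ok a" "ok b" using ab oct_ok by blast+
      have c: "card (component x) = card (component (a \<frown> b))"
        using component_eq[OF ab(3)] card_component_rot[of "a \<frown> b" q] ok by simp
      have c': "card (component (a \<frown> b)) = card (component (b \<frown> a))"
        using cat_swap[of b a] card_component_rot[of "b \<frown> a"] ok by simp
      have s: "sz x = sz a + sz b" using reach_ok[OF ab(3)] oct_ok[OF less.prems] by simp
      obtain i where i: "sz a = 4 * i" "2 \<le> i" using oct_ok[OF ab(1)] by (auto elim!: dvdE)
      obtain j where j: "sz b = 4 * j" "2 \<le> j" using oct_ok[OF ab(2)] by (auto elim!: dvdE)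
      have fin: "finite (component (a \<frown> b))" "finite (component (b \<frown> a))" using finite_component ok by simp_all
      have "3 * card (component b) \<le> card (component (a \<frown> b))"
        using card_component_cat[OF ab(1,2)] card_mono[OF fin(1), of "{z \<in> component (a \<frown> b). cut (sz a) z}"] by auto
      moreover have "3 * card (component a) \<le> card (component (b \<frown> a))"
        using card_component_cat[OF ab(2,1)] card_mono[OF fin(2), of "{z \<in> component (b \<frown> a). cut (sz b) z}"] by auto
      moreover have "6 * i \<le> card (component a) + 6" using less.hyps[of a] ab(1) i j s by simp
      moreover have "6 * j \<le> card (component b) + 6" using less.hyps[of b] ab(2) i j s by simp
      moreover have ij: "m = i + j" using m s i j by simp
      moreover have "19 \<le> card (component (a \<frown> b))" if "m = 4"
        using card_component_16[OF ab(1,2)] i j ij that by simp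
      \<comment> \<open>Adding the bounds from both parts gives
        \<open>18 * m - 36 \<le> 2 * card (component x)\<close>. This is strictly enough from
        \<open>m = 5\<close> on, while \<open>m = 4\<close> is the case of
        \<open>card_component_16\<close>.\<close>
      ultimately have "6 * m < card (component x) + 6" using c c' 3 by (cases "m = 4") linarith+
      then show ?thesis using m by simp
    qed
  qed
qed

section \<open>Counting\<close>

text \<open>Positions are read modulo the size, so that the notion follows rotations.\<close>

definition nested_at :: "conf \<Rightarrow> nat \<Rightarrow> bool" where
  "nested_at x i \<longleftrightarrow> {i mod sz x, (i + 3) mod sz x} \<in> edges x \<and> {(i + 1) mod sz x, (i + 2) mod sz x} \<in> edges x"

lemma nested_at_mod: "nested_at x (i mod sz x) = nested_at x i"
  by (simp only: nested_at_def mod_add_left_eq mod_mod_trivial)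

lemma nested_at_rot: "nested_at x i \<Longrightarrow> nested_at (rot p x) (i + p)"
proof -
  have e: "{a mod sz x, b mod sz x} \<in> edges x \<Longrightarrow> {(a + p) mod sz x, (b + p) mod sz x} \<in> edges (rot p x)" for a b
    using edge_rot[of "a mod sz x" "b mod sz x" x p] by (simp add: mod_add_left_eq)
  assume "nested_at x i"
  then show ?thesis using e[of i "i + 3"] e[of "i + 1" "i + 2"] by (simp add: nested_at_def ac_simps)
qed

lemma nested_at_cat_B: "nested_at (x \<frown> cB) (sz x)"
  using edge_cat_right[of 0 3 cB x] edge_cat_right[of 1 2 cB x] by (simp add: nested_at_def edges_cB)

text \<open>Only positions without wraparound are tested, since four points across the border are
  separated by the first attached \<open>cB\<close>.\<close>

definition unnested :: "conf \<Rightarrow> bool" where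
  "unnested b \<longleftrightarrow> (\<forall>i. i + 3 < sz b \<longrightarrow> \<not> ({i, i + 3} \<in> edges b \<and> {i + 1, i + 2} \<in> edges b))"

lemma unnested_cA: "unnested cA" and unnested_R0: "unnested R0"
  by (auto simp: unnested_def edges_cA edges_R0 doubleton_eq_iff)

lemma edge_cat_leftD: "{i, j} \<in> edges (x \<frown> y) \<Longrightarrow> i < sz x \<Longrightarrow> {i, j} \<in> edges x"
proof (rule ccontr)
  assume a: "{i, j} \<in> edges (x \<frown> y)" "i < sz x" "{i, j} \<notin> edges x"
  then obtain f where "{i, j} = (\<lambda>i. sz x + i) ` f" unfolding cat_def img_def conf.sel by blast
  then have "i \<in> (\<lambda>i. sz x + i) ` f" by blast
  then show False using a(2) by auto
qed

text \<open>A nested pair elsewhere either overlaps the last \<open>cB\<close>, against uniqueness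
  of partners, or lies inside the shorter chain. There the only candidate is the previous
  \<open>cB\<close>, and its four points are split up by the new one.\<close>

lemma nested_at_unique:
  assumes "ok b" "unnested b" "4 \<le> sz b"
  shows "valid cs \<Longrightarrow> i < sz (ch cB b cs) + 4 \<Longrightarrow> nested_at (ch cB b cs \<frown> cB) i \<Longrightarrow> i = sz (ch cB b cs)"
proof (induction cs arbitrary: i)
  have gen: "i = sz x" if okx: "ok x" "4 \<le> sz x" and i: "i < sz x + 4" "nested_at (x \<frown> cB) i"
    and lin: "i + 3 < sz x \<Longrightarrow> {i, i + 3} \<in> edges x \<Longrightarrow> {i + 1, i + 2} \<in> edges x \<Longrightarrow> False" for x i
  proof (rule ccontr)
    assume ne: "i \<noteq> sz x"
    let ?n = "sz x" and ?E = "edges (x \<frown> cB)"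
    have M: "mat (?n + 4) ?E" using ok_cat[OF okx(1) ok_small(2)] by (simp add: ok_def' del: ok_cat)
    have s: "{?n, ?n + 3} \<in> ?E" "{?n + 1, ?n + 2} \<in> ?E"
      using edge_cat_right[of 0 3 cB x] edge_cat_right[of 1 2 cB x] by (simp_all add: edges_cB)
    have p: "{i mod (?n + 4), (i + 3) mod (?n + 4)} \<in> ?E" "{(i + 1) mod (?n + 4), (i + 2) mod (?n + 4)} \<in> ?E"
      using i(2) by (simp_all add: nested_at_def)
    have u: "{a, b} \<in> ?E \<Longrightarrow> {a, c} \<in> ?E \<Longrightarrow> b = c" "{a, b} \<in> ?E \<Longrightarrow> {c, a} \<in> ?E \<Longrightarrow> b = c" for a b c
      using mat_unique2[OF M] mat_unique3[OF M] by blast+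
    consider "i + 3 < ?n" | "i + 3 = ?n" | "i + 2 = ?n" | "i + 1 = ?n" | "i = ?n + 1" | "i = ?n + 2" | "i = ?n + 3"
      using i(1) ne by linarith
    then show False
    proof cases
      case 1
      then have "{i, i + 3} \<in> edges x" "{i + 1, i + 2} \<in> edges x"
        using p edge_cat_leftD[of i "i + 3" x cB] edge_cat_leftD[of "i + 1" "i + 2" x cB] by simp_all
      then show False using lin 1 by blast
    next
      case 2
      then have "i mod (?n + 4) = i" "(i + 3) mod (?n + 4) = ?n" by simp_all
      then have "{i, ?n} \<in> ?E" using p(1) by metis
      from u(2)[OF s(1) this] show False using 2 by simp
    next
      case 3
      then have "(i + 1) mod (?n + 4) = i + 1" "(i + 2) mod (?n + 4) = ?n" by simp_all
      then have "{i + 1, ?n} \<in> ?E" using p(2) by metis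
      from u(2)[OF s(1) this] show False using 3 by simp
    next
      case 4
      then have "(i + 1) mod (?n + 4) = ?n" "(i + 2) mod (?n + 4) = ?n + 1" by simp_all
      then have "{?n, ?n + 1} \<in> ?E" using p(2) by metis
      from u(1)[OF s(1) this] show False by simp
    next
      case 5
      then have "(i + 1) mod (?n + 4) = ?n + 2" "(i + 2) mod (?n + 4) = ?n + 3" by simp_all
      then have "{?n + 2, ?n + 3} \<in> ?E" using p(2) by metis
      from u(2)[OF this s(2)] show False by simp
    next
      case 6
      then have "i mod (?n + 4) = ?n + 2" "(i + 3) mod (?n + 4) = 1" by (simp_all add: mod2)
      then have "{?n + 2, 1} \<in> ?E" using p(1) by metis
      from u(2)[OF this s(2)] show False using okx(2) by simp
    next
      case 7
      then have "i mod (?n + 4) = ?n + 3" "(i + 3) mod (?n + 4) = 2" by (simp_all add: mod2)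
      then have "{?n + 3, 2} \<in> ?E" using p(1) by metis
      from u(2)[OF this s(1)] show False using okx(2) by simp
    qed
  qed
  {
    case Nil
    then show ?case using gen[of b i] assms by (simp add: unnested_def)
  next
    case (Cons c cs)
    let ?y = "ch cB b cs" and ?z = "ch cB b cs \<frown> cB"
    have c: "c = 1 \<or> c = 3" "valid cs" using Cons.prems(1) by auto
    have z: "ok ?z" "sz ?z = sz ?y + 4" using assms by simp_all
    have nl: "False" if l: "i + 3 < sz (rot c ?z)" "{i, i + 3} \<in> edges (rot c ?z)" "{i + 1, i + 2} \<in> edges (rot c ?z)"
    proof -
      let ?n = "sz ?z"
      have "nested_at (rot c ?z) i" using l by (simp add: nested_at_def)
      then have "nested_at (rot (?n - c) (rot c ?z)) (i + (?n - c))" by (rule nested_at_rot)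
      then have P: "nested_at ?z (i + (?n - c))" using rot_inverse[of ?z c] z c by auto
      define k where "k = (i + (?n - c)) mod ?n"
      have "nested_at ?z k" using P by (simp only: k_def nested_at_mod)
      moreover have "k < sz ?y + 4" using z(2) by (simp add: k_def)
      ultimately have k: "k = sz ?y" using Cons.IH[OF c(2)] by blast
      have "i + (?n - c) < ?n + ?n" using l c by auto
      then have "k = (if i + (?n - c) < ?n then i + (?n - c) else i + (?n - c) - ?n)" unfolding k_def by (rule mod2)
      then have e: "sz ?y = (if i + (?n - c) < ?n then i + (?n - c) else i + (?n - c) - ?n)" by (simp only: k)
      \<comment> \<open>Rotated by 1 or 3, the previous \<open>cB\<close>, which occupied the last
        four positions, lies across the border, so it cannot start at an \<open>i\<close> with
        \<open>i + 3 < N\<close>.\<close>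
      have "False" if Y: "Y = (if i + (N - c) < N then i + (N - c) else i + (N - c) - N)" "N = Y + 4" "i + 3 < N" for Y N
      proof (cases "i + (N - c) < N")
        case True
        then have "Y = i + (N - c)" using Y(1) by (simp only: if_True)
        then show False using Y(2,3) c(1) by linarith
      next
        case False
        then have "Y = i + (N - c) - N" using Y(1) by (simp only: if_False)
        then show False using Y(2,3) c(1) \<open>\<not> i + (N - c) < N\<close> by linarith
      qed
      from this[OF e z(2) l(1)[unfolded sz_rot]] show False .
    qed
    have "i = sz (rot c ?z)"
    proof (rule gen)
      show "ok (rot c ?z)" using z(1) by simp
      show "4 \<le> sz (rot c ?z)" using z(2) by simp
      show "i < sz (rot c ?z) + 4" using Cons.prems(2) by simp
      show "nested_at (rot c ?z \<frown> cB) i" using Cons.prems(3) by simp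
    qed (use nl in blast)
    then show ?case by simp
  }
qed

definition chains :: "conf \<Rightarrow> nat \<Rightarrow> conf set" where
  "chains b m = (\<lambda>(p, cs). rot p (ch cB b cs \<frown> cB)) ` ({..<sz b + 4 * m + 4} \<times> {cs. valid cs \<and> length cs = m})"

lemma card_valid: "card {cs. valid cs \<and> length cs = m} = 2 ^ m"
  using card_lists_length_eq[of "{1, 3 :: nat}" m] by (simp add: valid_def numeral_2_eq_2)

text \<open>The position of the only nested pair reveals the rotation; once that is undone, the last
  \<open>cB\<close> can be cancelled.\<close>

lemma chain_rot_inj:
  assumes b: "ok b" "unnested b" "4 \<le> sz b" and v: "valid cs" "valid ds" "length ds = length cs"
    and pq: "p < sz (ch cB b cs) + 4" "q < sz (ch cB b cs) + 4"
    and eq: "rot p (ch cB b cs \<frown> cB) = rot q (ch cB b ds \<frown> cB)"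
  shows "p = q \<and> ch cB b cs = ch cB b ds"
proof -
  let ?x = "ch cB b cs" and ?y = "ch cB b ds"
  let ?N = "sz ?x + 4"
  have s: "sz ?y = sz ?x" using v by simp
  have ok: "ok ?x" "ok ?y" using b by simp_all
  have "nested_at (rot q (?y \<frown> cB)) (sz ?y + q)" using nested_at_rot nested_at_cat_B by blast
  then have "nested_at (rot (?N - p) (rot p (?x \<frown> cB))) (sz ?x + q + (?N - p))"
    using eq s nested_at_rot by metis
  then have "nested_at (?x \<frown> cB) (sz ?x + q + (?N - p))"
    using rot_inverse[of "?x \<frown> cB" p] ok pq(1) by simp
  then have P: "nested_at (?x \<frown> cB) ((sz ?x + q + (?N - p)) mod ?N)" using nested_at_mod[of "?x \<frown> cB"] by simp
  have "(sz ?x + q + (?N - p)) mod ?N = sz ?x"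
    by (rule nested_at_unique[OF b v(1) _ P]) simp
  moreover have "p \<le> ?N" using pq by simp
  ultimately have "(sz ?x + q + (?N - p) + p) mod ?N = (sz ?x + p) mod ?N" by (metis mod_add_left_eq)
  then have "(sz ?x + q + ?N) mod ?N = (sz ?x + p) mod ?N" using \<open>p \<le> ?N\<close> by (simp add: add.assoc)
  then have "(sz ?x + q) mod ?N = (sz ?x + p) mod ?N" by (simp only: mod_add_self2)
  then have "(q + sz ?x) mod ?N = (p + sz ?x) mod ?N" by (simp only: add.commute[of _ "sz ?x"])
  then have "q mod ?N = p mod ?N" by (metis inj_on_rot[of "sz ?x" ?N, THEN inj_onD] lessThan_iff pq(1) pq(2))
  then have pq': "p = q" using pq by simp
  then have "?x \<frown> cB = ?y \<frown> cB" using rot_inj[OF _ _ eq[unfolded pq']] ok by simp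
  then show ?thesis using cat_inj_ok[of ?x cB ?y cB] ok pq' by simp
qed

lemma ch_inj:
  assumes b: "ok b" "unnested b" "4 \<le> sz b"
  shows "valid cs \<Longrightarrow> valid ds \<Longrightarrow> length ds = length cs \<Longrightarrow> ch cB b cs = ch cB b ds \<Longrightarrow> cs = ds"
proof (induction cs arbitrary: ds)
  case (Cons c cs)
  then obtain d ds' where d: "ds = d # ds'" "length ds' = length cs" by (cases ds) auto
  have v: "valid cs" "valid ds'" "c \<le> 3" "d \<le> 3" using Cons.prems d by auto
  have "c = d \<and> ch cB b cs = ch cB b ds'"
    by (rule chain_rot_inj[OF b v(1,2) d(2)]) (use v Cons.prems(4) d b in auto)
  then show ?case using Cons.IH[OF v(1,2) d(2)] d by simp
qed simp

lemma card_chains: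
  assumes b: "ok b" "unnested b" "4 \<le> sz b"
  shows "card (chains b m) = (sz b + 4 * m + 4) * 2 ^ m"
proof -
  have "inj_on (\<lambda>(p, cs). rot p (ch cB b cs \<frown> cB)) ({..<sz b + 4 * m + 4} \<times> {cs. valid cs \<and> length cs = m})"
  proof (rule inj_onI)
    fix u v assume uv: "u \<in> {..<sz b + 4 * m + 4} \<times> {cs. valid cs \<and> length cs = m}"
      "v \<in> {..<sz b + 4 * m + 4} \<times> {cs. valid cs \<and> length cs = m}"
      "(case u of (p, cs) \<Rightarrow> rot p (ch cB b cs \<frown> cB)) = (case v of (p, cs) \<Rightarrow> rot p (ch cB b cs \<frown> cB))"
    obtain p cs q ds where e: "u = (p, cs)" "v = (q, ds)" by (cases u, cases v) blast
    have l: "valid cs" "valid ds" "length cs = m" "length ds = m" "p < sz b + 4 * m + 4" "q < sz b + 4 * m + 4"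
      using uv e by auto
    have "p = q \<and> ch cB b cs = ch cB b ds"
      by (rule chain_rot_inj[OF b l(1,2)]) (use l uv(3) e in auto)
    then show "u = v" using ch_inj[OF b l(1,2)] l e by simp
  qed
  then show ?thesis unfolding chains_def by (simp add: card_image card_cartesian_product card_valid)
qed

lemma in_chains:
  assumes "ok b" shows "x \<in> chains b m \<longleftrightarrow> (\<exists>p cs. valid cs \<and> length cs = m \<and> x = rot p (ch cB b cs \<frown> cB))"
proof
  assume "\<exists>p cs. valid cs \<and> length cs = m \<and> x = rot p (ch cB b cs \<frown> cB)"
  then obtain p cs where *: "valid cs" "length cs = m" "x = rot p (ch cB b cs \<frown> cB)" by blast
  let ?N = "sz b + 4 * m + 4"
  have "sz (ch cB b cs \<frown> cB) = ?N" using *(2) by simp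
  then have "x = rot (p mod ?N) (ch cB b cs \<frown> cB)" using *(3) rot_mod by metis
  then have "x = (\<lambda>(p, cs). rot p (ch cB b cs \<frown> cB)) (p mod ?N, cs)" by simp
  moreover have "(p mod ?N, cs) \<in> {..<?N} \<times> {cs. valid cs \<and> length cs = m}" using * by simp
  ultimately show "x \<in> chains b m" unfolding chains_def by (rule image_eqI)
qed (auto simp: chains_def)

lemma card_comps:
  assumes "finite X" "\<And>x. x \<in> X \<Longrightarrow> card (component x \<inter> X) = c"
  shows "card (component ` X) * c = card X"
proof -
  have "X = (\<Union>S\<in>component ` X. S \<inter> X)" using self_component by blast
  moreover have "card (\<Union>S\<in>component ` X. S \<inter> X) = (\<Sum>S\<in>component ` X. card (S \<inter> X))"
  proof (rule card_UN_disjoint)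
    show "\<forall>S\<in>component ` X. \<forall>T\<in>component ` X. S \<noteq> T \<longrightarrow> S \<inter> X \<inter> (T \<inter> X) = {}"
    proof (intro ballI impI)
      fix S T assume "S \<in> component ` X" "T \<in> component ` X" "S \<noteq> T"
      then obtain x y where xy: "S = component x" "T = component y" by blast
      have "False" if "z \<in> component x" "z \<in> component y" for z
        using component_eq[of x z] component_eq[of y z] that xy \<open>S \<noteq> T\<close> by (simp add: component_def)
      then show "S \<inter> X \<inter> (T \<inter> X) = {}" using xy by blast
    qed
  qed (use assms(1) in auto)
  moreover have "(\<Sum>S\<in>component ` X. card (S \<inter> X)) = (\<Sum>S\<in>component ` X. c)"
    using assms(2) by (intro sum.cong) auto
  ultimately show ?thesis by simp
qed

lemma small_conf_component: assumes "small_conf x" shows "\<exists>y. adj x y \<and> x \<noteq> y \<and> component x = {x, y}"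
proof -
  obtain y where y: "adj x y" using deg_pos_ex small_conf_deg[OF assms] by fastforce
  have Sy: "small_conf y" using small_conf_adj assms y by blast
  have "z \<in> {x, y}" if "reach x z" for z
    using that unfolding reach_def
  proof (induction rule: rtranclp_induct)
    case (step u w)
    then show ?case using deg_1[OF y small_conf_deg[OF assms]] deg_1[OF adj_sym[OF y] small_conf_deg[OF Sy]] by blast
  qed simp
  then have "component x = {x, y}" using adj_reach[OF y] by (auto simp: component_def)
  moreover have "x \<noteq> y"
  proof
    assume "x = y"
    then have "sz x = 0" using not_adj_self y by simp
    moreover have "4 \<le> sz x" using assms by (auto simp: small_conf_def)
    ultimately show False by simp
  qed
  ultimately show ?thesis using y by blast
qed

lemma card_small_conf: assumes "1 \<le> l" shows "finite {x. small_conf x \<and> sz x = 4 * l} \<and> card {x. small_conf x \<and> sz x = 4 * l} = l * 2 ^ l"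
proof (cases "l = 1")
  case True
  have "{x. small_conf x \<and> sz x = 4 * l} = {cA, cB}"
  proof -
    have "x = cA \<or> x = cB" if "small_conf x" "sz x = 4" for x using that small_conf_ok ok_4 by blast
    then show ?thesis using True by (auto simp: small_conf_def)
  qed
  moreover have "cA \<noteq> cB" using not_adj_self[of cA] adj_AB by auto
  ultimately show ?thesis using True by simp
next
  case False
  \<comment> \<open>A word of length \<open>m\<close> belongs to a chain of \<open>m + 2\<close>
    quadrangles: the base, one per letter, and the last \<open>cB\<close>. The \<open>4 * l\<close>
    rotations times \<open>2 ^ m\<close> words give \<open>l * 2 ^ l\<close>.\<close>
  then obtain m where m: "l = m + 2" using assms by (metis One_nat_def Suc_1 add.commute le_neq_implies_less le_Suc_ex Suc_leI)
  have "{x. small_conf x \<and> sz x = 4 * l} = chains cA m"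
  proof (intro equalityI subsetI)
    fix x assume x: "x \<in> {x. small_conf x \<and> sz x = 4 * l}"
    then obtain p cs where "valid cs" "x = rot p (ch cB cA cs \<frown> cB)" using m by (auto simp: small_conf_def)
    moreover have "length cs = m" using calculation x m by simp
    ultimately show "x \<in> chains cA m" using in_chains[of cA x m] by auto
  next
    fix x assume "x \<in> chains cA m"
    then obtain p cs where "valid cs" "length cs = m" "x = rot p (ch cB cA cs \<frown> cB)" using in_chains[of cA x m] by auto
    moreover have "sz x = 4 * l" using calculation m by simp
    ultimately show "x \<in> {x. small_conf x \<and> sz x = 4 * l}" by (auto simp: small_conf_def)
  qed
  moreover have "card (chains cA m) = (4 * m + 8) * 2 ^ m" using card_chains[of cA m] unnested_cA by simp
  moreover have "finite (chains cA m)" using calculation(2) by (metis card.infinite add_is_0 mult_is_0 power_not_zero zero_neq_numeral)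
  ultimately show ?thesis using m by (simp add: algebra_simps)
qed

text \<open>All elements of \<open>chains R0 m\<close> have degree 3, and by \<open>deg_3_UU\<close>
  and \<open>deg_3_VV\<close> the component has just one such vertex in each colour class; both are
  representatives.\<close>

lemma medium_rep_component:
  assumes "x \<in> chains R0 m" shows "card (component x \<inter> chains R0 m) = 2"
proof -
  obtain p cs where x: "valid cs" "length cs = m" "x = rot p (Nc cs \<frown> cB)" using assms in_chains[of R0 x m] by auto
  have C: "component x = rot p ` (UU cs \<union> VV cs)" using component_rot[of "Nc cs \<frown> cB" p] component_rep[OF x(1)] x(3) by simp
  have d3: "deg y = 3" if "y \<in> chains R0 m" for y
    using that in_chains[of R0 y m] deg_R0 by auto
  have okK: "ok u" if "u \<in> UU cs \<union> VV cs" for u using that UU_ok VV_ok by blast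
  obtain q where q: "a1 cs = rot q (Nc (rv cs) \<frown> cB)" using a1_rep[OF x(1)] by blast
  have "component x \<inter> chains R0 m = {x, rot p (a1 cs)}"
  proof (intro equalityI subsetI)
    fix y assume y: "y \<in> component x \<inter> chains R0 m"
    then obtain u where u: "u \<in> UU cs \<union> VV cs" "y = rot p u" using C by blast
    then have "deg u = 3" using d3[of y] y okK[OF u(1)] by simp
    then have "u \<in> {u \<in> UU cs. deg u = 3} \<union> {u \<in> VV cs. deg u = 3}" using u(1) by blast
    then have "u = Nc cs \<frown> cB \<or> u = a1 cs" unfolding deg_3_UU[OF x(1)] deg_3_VV[OF x(1)] by blast
    then show "y \<in> {x, rot p (a1 cs)}" using u(2) x(3) by blast
  next
    fix y assume "y \<in> {x, rot p (a1 cs)}"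
    moreover have "rot p (a1 cs) \<in> chains R0 m"
      using in_chains[of R0 "rot p (a1 cs)" m] q x(1,2) by (auto simp: rot_rot intro!: exI[of _ "rv cs"])
    moreover have "rot p (a1 cs) \<in> component x" using C a1_VV by blast
    ultimately show "y \<in> component x \<inter> chains R0 m" using assms self_component by blast
  qed
  moreover have "x \<noteq> rot p (a1 cs)"
  proof
    assume "x = rot p (a1 cs)"
    then have "Nc cs \<frown> cB = a1 cs" using rot_inj[of "Nc cs \<frown> cB" "a1 cs" p] x(3) by simp
    moreover have "Nc cs \<frown> cB \<in> UU cs" using Nc_US by (auto simp: UU_def)
    ultimately show False using UU_VV_disj[OF x(1)] a1_VV by fastforce
  qed
  ultimately show ?thesis by simp
qed

lemma medium_chains: "medium x \<longleftrightarrow> (\<exists>r\<in>chains R0 (sz x div 4 - 3). component r = component x) \<and> 12 \<le> sz x" if "ok x"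
proof
  assume "medium x"
  then obtain p cs where r: "valid cs" "reach (rot p (Nc cs \<frown> cB)) x" by (auto simp: medium_def)
  have s: "sz x = 12 + 4 * length cs" using reach_ok[OF r(2)] by simp
  then have "length cs = sz x div 4 - 3" by simp
  then have "rot p (Nc cs \<frown> cB) \<in> chains R0 (sz x div 4 - 3)" using in_chains[of R0] r(1) by auto
  then show "(\<exists>r\<in>chains R0 (sz x div 4 - 3). component r = component x) \<and> 12 \<le> sz x" using component_eq[OF r(2)] s by auto
next
  assume "(\<exists>r\<in>chains R0 (sz x div 4 - 3). component r = component x) \<and> 12 \<le> sz x"
  then obtain p cs where r: "valid cs" "component (rot p (Nc cs \<frown> cB)) = component x" using in_chains[of R0] by auto
  then have "x \<in> component (rot p (Nc cs \<frown> cB))" using self_component[of x] by (simp only:)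
  then have "reach (rot p (Nc cs \<frown> cB)) x" by (simp add: component_def)
  then show "medium x" using r(1) by (auto simp: medium_def)
qed

lemma component_R0: "card (component R0) = 6"
proof -
  have "component R0 \<subseteq> Uo \<union> Vo"
  proof
    fix y assume "y \<in> component R0"
    then have "reach R0 y" by (simp add: component_def)
    then show "y \<in> Uo \<union> Vo" unfolding reach_def
    proof (induction rule: rtranclp_induct)
      case (step u w) then show ?case using adj_Uo adj_Vo by blast
    qed (simp add: Uo_def)
  qed
  then have "card (component R0) \<le> card (Uo \<union> Vo)" by (rule card_mono[rotated]) simp
  also have "\<dots> \<le> 6" using card_Un_le[of Uo Vo] card_Uo card_Vo by simp
  finally show ?thesis using card_component_6[OF oct_R0] by simp
qed

definition confs :: "nat \<Rightarrow> conf set" where "confs n = {x. ok x \<and> sz x = n}"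

lemma ex_small_conf: "1 \<le> l \<Longrightarrow> \<exists>x. small_conf x \<and> sz x = 4 * l"
proof (rule ccontr)
  assume l: "1 \<le> l" and "\<nexists>x. small_conf x \<and> sz x = 4 * l"
  then have "{x. small_conf x \<and> sz x = 4 * l} = {}" by blast
  then have "l * 2 ^ l = card ({} :: conf set)" using card_small_conf[OF l] by metis
  then show False using l by simp
qed

lemma conf_theorem:
  assumes l: "1 \<le> l"
  defines "G \<equiv> component ` confs (4 * l)"
  shows "Min (card ` G) = 2" "card {C \<in> G. card C = 2} = l * 2 ^ (l - 1)"
    "2 \<le> l \<Longrightarrow> Min (card ` G - {2}) = 6 * l - 6"
    "3 \<le> l \<Longrightarrow> card {C \<in> G. card C = 6 * l - 6} = l * 2 ^ (l - 2)"
proof -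
  have fin: "finite G" unfolding G_def confs_def using finite_confs by blast
  have split: "small_conf x \<or> oct x" if "x \<in> confs (4 * l)" for x
    using that small_conf_or_oct l by (simp add: confs_def)
  have c2: "card (component x) = 2" if "small_conf x" for x using small_conf_component[OF that] by auto
  have lo: "6 * l \<le> card (component x) + 6" "3 \<le> l \<Longrightarrow> \<not> medium x \<Longrightarrow> 6 * l < card (component x) + 6" "2 \<le> l"
    if "x \<in> confs (4 * l)" "oct x" for x
    using oct_lower[OF that(2)] oct_ok[OF that(2)] that(1) by (auto simp: confs_def)
  have lo6: "6 \<le> card (component x)" if "oct x" for x using card_component_6[OF that] .
  obtain x0 where x0: "small_conf x0" "sz x0 = 4 * l" using ex_small_conf[OF l] by blast
  have x0G: "component x0 \<in> G" using x0 small_conf_ok by (auto simp: G_def confs_def)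
  have ge2: "2 \<le> card C" if "C \<in> G" for C
    using that split c2 lo6 by (fastforce simp: G_def)
  show "Min (card ` G) = 2"
    using fin ge2 x0G c2[OF x0(1)] by (intro Min_eqI) (auto intro!: image_eqI[of _ card "component x0"])
  have "{C \<in> G. card C = 2} = component ` {x. small_conf x \<and> sz x = 4 * l}"
  proof (intro equalityI subsetI)
    fix C assume "C \<in> {C \<in> G. card C = 2}"
    then obtain x where x: "x \<in> confs (4 * l)" "C = component x" "card C = 2" by (auto simp: G_def)
    then have "small_conf x" using split[OF x(1)] lo6[of x] by auto
    then show "C \<in> component ` {x. small_conf x \<and> sz x = 4 * l}" using x by (auto simp: confs_def)
  next
    fix C assume "C \<in> component ` {x. small_conf x \<and> sz x = 4 * l}"
    then show "C \<in> {C \<in> G. card C = 2}" using c2 small_conf_ok by (auto simp: G_def confs_def)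
  qed
  \<comment> \<open>Both vertices of such a component are counted among the chains, hence the factor
    2.\<close>
  moreover have "card (component ` {x. small_conf x \<and> sz x = 4 * l}) * 2 = l * 2 ^ l"
  proof -
    have "card (component x \<inter> {x. small_conf x \<and> sz x = 4 * l}) = 2" if x: "x \<in> {x. small_conf x \<and> sz x = 4 * l}" for x
    proof -
      obtain y where y: "adj x y" "x \<noteq> y" "component x = {x, y}" using small_conf_component x by blast
      then have "component x \<inter> {x. small_conf x \<and> sz x = 4 * l} = {x, y}" using x small_conf_adj adj_sz[OF y(1)] by auto
      then show ?thesis using y(2) by simp
    qed
    then show ?thesis using card_comps[of "{x. small_conf x \<and> sz x = 4 * l}" 2] card_small_conf[OF l] by simp
  qed
  moreover have "l * 2 ^ l = l * 2 ^ (l - 1) * 2" using l by (cases l) auto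
  ultimately show "card {C \<in> G. card C = 2} = l * 2 ^ (l - 1)" by simp
  show "Min (card ` G - {2}) = 6 * l - 6" if l2: "2 \<le> l"
  proof (rule Min_eqI)
    show "finite (card ` G - {2})" using fin by simp
    show "6 * l - 6 \<le> c" if c: "c \<in> card ` G - {2}" for c
    proof -
      obtain x where x: "x \<in> confs (4 * l)" "c = card (component x)" "c \<noteq> 2" using c by (auto simp: G_def)
      then show ?thesis using split[OF x(1)] c2[of x] lo(1)[OF x(1)] by auto
    qed
    have "\<exists>x\<in>confs (4 * l). card (component x) = 6 * l - 6"
    proof (cases "l = 2")
      case True
      then show ?thesis using component_R0 by (intro bexI[of _ R0]) (auto simp: confs_def)
    next
      case False
      \<comment> \<open>Any valid word of length \<open>l - 3\<close> serves as witness; octagon,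
        letters and last \<open>cB\<close> make up \<open>4 * l\<close> points.\<close>
      define cs where "cs = replicate (l - 3) (1 :: nat)"
      have cs: "valid cs" "length cs = l - 3" by (auto simp: cs_def valid_def)
      have "card (component (Nc cs \<frown> cB)) = 6 * l - 6" using card_component_rep[OF cs(1)] cs(2) False l2 by simp
      moreover have "Nc cs \<frown> cB \<in> confs (4 * l)" using cs(2) False l2 by (simp add: confs_def)
      ultimately show ?thesis by blast
    qed
    then show "6 * l - 6 \<in> card ` G - {2}" using l2 by (force simp: G_def)
  qed
  show "card {C \<in> G. card C = 6 * l - 6} = l * 2 ^ (l - 2)" if l3: "3 \<le> l"
  proof -
    obtain m where m: "l = m + 3" using l3 by (metis add.commute le_Suc_ex)
    have "{C \<in> G. card C = 6 * l - 6} = component ` chains R0 m"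
    proof (intro equalityI subsetI)
      fix C assume "C \<in> {C \<in> G. card C = 6 * l - 6}"
      then obtain x where x: "x \<in> confs (4 * l)" "C = component x" "card C = 6 * l - 6" by (auto simp: G_def)
      have "\<not> small_conf x" using c2[of x] x l3 by auto
      then have "oct x" using split[OF x(1)] by blast
      then have "medium x" using lo(2)[OF x(1)] x l3 by fastforce
      then obtain r where "r \<in> chains R0 m" "component r = component x"
        using medium_chains[of x] x(1) m by (auto simp: confs_def)
      then show "C \<in> component ` chains R0 m" using x(2) by blast
    next
      fix C assume "C \<in> component ` chains R0 m"
      then obtain p cs where r: "valid cs" "length cs = m" "C = component (rot p (Nc cs \<frown> cB))" using in_chains[of R0] by auto
      have "card C = 6 * l - 6" using r card_component_rot[of "Nc cs \<frown> cB" p] card_component_rep[OF r(1)] m by simp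
      moreover have "rot p (Nc cs \<frown> cB) \<in> confs (4 * l)" using r(2) m by (simp add: confs_def)
      ultimately show "C \<in> {C \<in> G. card C = 6 * l - 6}" using r(3) by (auto simp: G_def)
    qed
    moreover have c: "card (chains R0 m) = 4 * l * 2 ^ m" using card_chains[of R0 m] unnested_R0 m by simp
    then have "finite (chains R0 m)" using l3 by (metis card.infinite mult_is_0 not_numeral_le_zero power_not_zero zero_neq_numeral)
    then have "card (component ` chains R0 m) * 2 = card (chains R0 m)" by (rule card_comps) (rule medium_rep_component)
    moreover have "4 * l * 2 ^ m = l * 2 ^ (l - 2) * 2" using m by simp
    ultimately show ?thesis using c by simp
  qed
qed

section \<open>Transfer from configurations to the graph of matchings\<close>

lemma is_matching_mat: "is_matching k M \<longleftrightarrow> mat (2 * k) M"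
  by (simp add: is_matching_def is_edge_def mat_def)

lemma dcm_adj_iff: "dcm_adj k M M' \<longleftrightarrow> adj (Conf (2 * k) M) (Conf (2 * k) M')"
  by (simp add: dcm_adj_def matchings_def is_matching_mat disjoint_compatible_def adj_def compat_def)

lemma dcm_reach: "(dcm_adj k)\<^sup>*\<^sup>* M M' \<longleftrightarrow> reach (Conf (2 * k) M) (Conf (2 * k) M')"
proof
  assume "(dcm_adj k)\<^sup>*\<^sup>* M M'"
  then show "reach (Conf (2 * k) M) (Conf (2 * k) M')"
  proof (induction rule: rtranclp_induct)
    case (step y z) then show ?case using dcm_adj_iff adj_reach reach_trans by blast
  qed simp
next
  have "sz d = 2 * k \<and> (dcm_adj k)\<^sup>*\<^sup>* M (edges d)" if "reach (Conf (2 * k) M) d" for d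
    using that unfolding reach_def
  proof (induction rule: rtranclp_induct)
    case (step y z)
    then have s: "sz y = 2 * k" "sz z = 2 * k" using adj_sz[OF step.hyps(2)] by auto
    have "y = Conf (2 * k) (edges y)" "z = Conf (2 * k) (edges z)" using s by (auto intro: conf_eqI)
    then have "dcm_adj k (edges y) (edges z)" unfolding dcm_adj_iff using step.hyps(2) by simp
    then show ?case using step.IH s by (simp add: rtranclp.rtrancl_into_rtrancl)
  qed simp
  then show "reach (Conf (2 * k) M) (Conf (2 * k) M') \<Longrightarrow> (dcm_adj k)\<^sup>*\<^sup>* M M'" by fastforce
qed

lemma dcm_component_component: "ok (Conf (2 * k) M) \<Longrightarrow> dcm_component k M = edges ` component (Conf (2 * k) M)"
proof -
  assume M: "ok (Conf (2 * k) M)"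
  have "M' \<in> edges ` component (Conf (2 * k) M) \<longleftrightarrow> reach (Conf (2 * k) M) (Conf (2 * k) M')" for M'
  proof
    assume "M' \<in> edges ` component (Conf (2 * k) M)"
    then obtain d where d: "reach (Conf (2 * k) M) d" "M' = edges d" by (auto simp: component_def)
    have "d = Conf (2 * k) M'" using reach_ok[OF d(1) M] d(2) by (intro conf_eqI) auto
    then show "reach (Conf (2 * k) M) (Conf (2 * k) M')" using d(1) by simp
  next
    assume "reach (Conf (2 * k) M) (Conf (2 * k) M')"
    then show "M' \<in> edges ` component (Conf (2 * k) M)" unfolding component_def by (intro image_eqI[of _ _ "Conf (2 * k) M'"]) simp_all
  qed
  then show ?thesis by (auto simp: dcm_component_def dcm_reach)
qed

lemma dcm_components_component: "dcm_components k = (\<lambda>S. edges ` S) ` component ` confs (2 * k)"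
proof -
  have c: "confs (2 * k) = Conf (2 * k) ` matchings k"
  proof (intro equalityI subsetI)
    fix x assume "x \<in> confs (2 * k)"
    then show "x \<in> Conf (2 * k) ` matchings k"
      by (cases x) (auto simp: confs_def matchings_def is_matching_mat)
  qed (auto simp: confs_def matchings_def is_matching_mat)
  have "dcm_component k M = edges ` component (Conf (2 * k) M)" if "M \<in> matchings k" for M
    using that by (intro dcm_component_component) (simp add: matchings_def is_matching_mat)
  then show ?thesis unfolding dcm_components_def c image_image by (intro image_cong) auto
qed

lemma inj_edges: "inj_on edges (confs n)"
  by (rule inj_onI) (auto simp: confs_def intro: conf_eqI)

lemma card_edges_image: assumes "S \<in> component ` confs n" shows "card (edges ` S) = card S"
proof -
  have "S \<subseteq> confs n" using assms component_ok by (auto simp: confs_def)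
  then show ?thesis using card_image inj_on_subset inj_edges by blast
qed

lemma card_components:
  "card ` dcm_components k = card ` component ` confs (2 * k)"
  "card {C \<in> dcm_components k. card C = c} = card {C \<in> component ` confs (2 * k). card C = c}"
proof -
  let ?G = "component ` confs (2 * k)"
  have "(\<lambda>S. card (edges ` S)) ` ?G = card ` ?G" by (intro image_cong) (auto simp: card_edges_image)
  then show "card ` dcm_components k = card ` ?G"
    unfolding dcm_components_component image_image by simp
  have sub: "S \<subseteq> confs (2 * k)" if "S \<in> ?G" for S
  proof -
    obtain x where x: "ok x" "sz x = 2 * k" "S = component x" using \<open>S \<in> ?G\<close> by (auto simp: confs_def)
    show ?thesis unfolding x(3) confs_def using component_ok[OF x(1)] x(2) by auto
  qed
  have inj: "inj_on (\<lambda>S. edges ` S) ?G"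
    by (rule inj_onI) (use inj_on_image_eq_iff[OF inj_edges] sub in metis)
  have "{C \<in> dcm_components k. card C = c} = (\<lambda>S. edges ` S) ` {C \<in> ?G. card C = c}"
  proof -
    have "{C \<in> (\<lambda>S. edges ` S) ` G. card C = c} = (\<lambda>S. edges ` S) ` {C \<in> G. card C = c}"
      if "\<And>S. S \<in> G \<Longrightarrow> card (edges ` S) = card S" for G
      using that by force
    from this[of ?G] show ?thesis unfolding dcm_components_component using card_edges_image by blast
  qed
  moreover have "inj_on (\<lambda>S. edges ` S) {C \<in> ?G. card C = c}" by (rule inj_on_subset[OF inj]) blast
  ultimately show "card {C \<in> dcm_components k. card C = c} = card {C \<in> ?G. card C = c}"
    by (simp add: card_image)
qed

theorem theorem3:
  fixes k :: nat
  assumes "k \<ge> 1" and "even k"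
  defines "l \<equiv> k div 2"
  shows "Min (card ` dcm_components k) = 2
       \<and> card {C \<in> dcm_components k. card C = 2} = l * 2 ^ (l - 1)
       \<and> (k \<ge> 4 \<longrightarrow> Min (card ` dcm_components k - {2}) = 6 * l - 6)
       \<and> (k \<ge> 6 \<longrightarrow> card {C \<in> dcm_components k. card C = 6 * l - 6} = l * 2 ^ (l - 2))"
proof -
  have l: "1 \<le> l" "2 * k = 4 * l" using assms by (auto simp: l_def elim!: evenE)
  have "k \<ge> 4 \<Longrightarrow> 2 \<le> l" "k \<ge> 6 \<Longrightarrow> 3 \<le> l" using l by linarith+
  then show ?thesis
    unfolding card_components l(2) using conf_theorem[OF l(1)] by blast
qed

end
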